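(* Assume that $f:\mathbb{R}^n\to\overline{\mathbb{R}}$ is prox-regular at $\bar x$ for $0$. Let $g(x):=\sqrt{\max\{f(x)-f(\bar x),0\}}$. Assume that $D(\partial f)(\bar x\mid0)$ is nonsingular, i.e. $[D(\partial f)(\bar x\mid0)]^{-1}(0)=\{0\}$. Then $f$ satisfies the KL property at $\bar x$ with exponent $\frac12$, which is sharp if $$W:=\{w\in\mathbb{R}^n\mid 0<d^2f(\bar x\mid0)(w)<+\infty\}\neq\emptyset.$$ If in addition $f$ is twice epi-differentiable and subdifferentially continuous at $\bar x$ for $0$, then: (a) $W\neq\emptyset$ if and only if there is some $v\in D(\partial f)(\bar x\mid0)(w)$ (for some $w$) such that $\langle v,w\rangle>0$. Moreover, $$\mathrm{KL}(f,\bar x,\tfrac12)=\mathrm{KL}(\tfrac12d^2f(\bar x\mid0),0,\tfrac12)\ge\sqrt{\frac{1}{2\,\mathrm{subreg}\,\partial f(\bar x\mid0)}}>0,$$ and $$\partial^{>}g(\bar x)=\bigcup_{w\in W}\frac{\frac12\partial[\frac12d^2f(\bar x\mid0)](w)}{\sqrt{\frac12d^2f(\bar x\mid0)(w)}}=\left\{\frac{v}{\sqrt{2\langle v,w\rangle}}\ \Big|\ v\in D(\partial f)(\bar x\mid0)(w),\ \langle v,w\rangle>0\right\}.$$ (b) For $\lambda>0$ define $\tilde g(x):=\sqrt{\max\{e_\lambda f(x)-e_\lambda f(\bar x),0\}}$ and $$\widetilde W:=\{w\in\mathbb{R}^n\mid 0<e_\lambda(\tfrac12d^2f(\bar x\mid0))(w)<+\infty\}.$$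 Then for all $\lambda>0$ sufficiently small, $e_\lambda f$ satisfies the KL property at $\bar x$ with exponent $\frac12$, which is sharp if $\widetilde W\neq\emptyset$, or equivalently if there is some $v\in D(\partial f)(\bar x\mid0)(w)$ such that $\langle v,w\rangle+\lambda\|v\|^2>0$. Moreover (for all such $\lambda$), $$\mathrm{KL}(e_\lambda f,\bar x,\tfrac12)=\mathrm{KL}(e_\lambda(\tfrac12d^2f(\bar x\mid0)),0,\tfrac12)\ge\sqrt{\frac{1}{2\lambda+2\,\mathrm{subreg}\,\partial f(\bar x\mid0)}}>0,$$ and $$\partial^{>}\tilde g(\bar x)=\bigcup_{w\in\widetilde W}\frac{\frac12\nabla e_\lambda(\frac12d^2f(\bar x\mid0))(w)}{\sqrt{e_\lambda(\frac12d^2f(\bar x\mid0))(w)}}=\left\{\frac{v}{\sqrt{2\langle v,w\rangle+2\lambda\|v\|^2}}\ \Big|\ v\in D(\partial f)(\bar x\mid0)(w),\ \langle v,w\rangle+\lambda\|v\|^2>0\right\}.$$ (c) In the sense of Painlevé–Kuratowski convergence, $$\lim_{\lambda\to0+}\partial^{>}\tilde g(\bar x)=\partial^{>}g(\bar x)$$ (where $\tilde g$ depends on $\lambda$ as in (b)), which implies that $\mathrm{KL}(e_\lambda f,\bar x,\frac12)\nearrow\mathrm{KL}(f,\bar x,\frac12)$ as $\lambda\searrow0$, i.e. $\mathrm{KL}(e_\lambda f,\bar x,\frac12)$ is nondecreasing as $\lambda$ decreases to $0$ (for $\lambda$ small) and converges to $\mathrm{KL}(f,\bar x,\frac12)$.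
   Context: $\overline{\mathbb{R}}=\mathbb{R}\cup\{\pm\infty\}$; $\mathbb{B}_\epsilon(\bar x)$ is the closed ball; $\mathbb{S}$ is the unit sphere; $d(v,A)=\inf_{a\in A}\|a-v\|$ with $d(v,\emptyset)=+\infty$. A function finite at $\bar x$ is locally lsc at $\bar x$ if its epigraph is locally closed at $(\bar x,f(\bar x))$. Subgradients. Let $\varphi(x)$ be finite. $v\in\widehat\partial\varphi(x)$ if $\varphi(y)\ge\varphi(x)+\langle v,y-x\rangle+o(\|y-x\|)$. $v\in\partial\varphi(x)$ (limiting) if there are $x_k\to x$, $v_k\to v$ with $\varphi(x_k)\to\varphi(x)$, $v_k\in\widehat\partial\varphi(x_k)$. $v\in\partial^{>}\varphi(x)$ (outer limiting) if there are $x_k\to x$, $v_k\to v$ with $\varphi(x_k)\to\varphi(x)$, $\varphi(x_k)>\varphi(x)$, $v_k\in\partial\varphi(x_k)$. Subdifferentials are empty where $\varphi$ is not finite. Prox-regularity at $\bar x$ for $\bar v$: $f$ is finite and locally lsc at $\bar x$, $\bar v\in\partial f(\bar x)$, and there are $\epsilon>0$, $\rho\ge0$ such that $f(x')\ge f(x)+\langle v,x'-x\rangle-\frac\rho2\|x'-x\|^2$ for all $x'\in\mathbb{B}_\epsilon(\bar x)$ whenever $v\in\partial f(x)$, $\|v-\bar v\|<\epsilon$, $\|x-\bar x\|<\epsilon$, $f(x)<f(\bar x)+\epsilon$. Subdifferential continuity at $\bar x$ for $\bar v$: $\bar v\in\partial f(\bar x)$ and $(x^\nu,v^\nu)\to(\bar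 x,\bar v)$ with $v^\nu\in\partial f(x^\nu)$ implies $f(x^\nu)\to f(\bar x)$. Second subderivative: $d^2f(\bar x\mid v)(w):=\liminf_{t\downarrow0,\ w'\to w}\frac{f(\bar x+tw')-f(\bar x)-t\langle v,w'\rangle}{\frac12t^2}$. $f$ is twice epi-differentiable at $\bar x$ for $v$ if for every $w$ and every $t^\nu\downarrow0$ there is $w^\nu\to w$ with $d^2f(\bar x\mid v)(w)=\lim_\nu\frac{f(\bar x+t^\nu w^\nu)-f(\bar x)-t^\nu\langle v,w^\nu\rangle}{\frac12(t^\nu)^2}$. Graphical derivative: for $S:\mathbb{R}^n\rightrightarrows\mathbb{R}^m$ and $\bar u\in S(\bar x)$, $z\in DS(\bar x\mid\bar u)(w)$ iff $(w,z)\in T_{\operatorname{gph}S}(\bar x,\bar u)$, where $w\in T_A(x)$ iff there are $t_k\downarrow0$, $w_k\to w$ with $x+t_kw_k\in A$. $D(\partial f)(\bar x\mid0)$ is the graphical derivative of $x\mapsto\partial f(x)$. Metric subregularity modulus: $\mathrm{subreg}\,S(\bar x\mid\bar u)$ is the infimum of all $\kappa>0$ for which there is a neighborhood $U$ of $\bar x$ with $d(x,S^{-1}(\bar u))\le\kappa\,d(\bar u,S(x))$ for all $x\in U$. When $DS(\bar x\mid\bar u)^{-1}(0)=\{0\}$ it equals $1/\inf\{\|v\|\mid v\in DS(\bar x\mid\bar u)(w),\ w\in\mathbb{S}\}$. Conventions $1/0=+\infty$, $1/(+\infty)=0$. Moreau envelope: $e_\lambda\varphi(x):=\inf_w\{\varphi(w)+\frac1{2\lambda}\|w-x\|^2\}$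 for a proper lsc $\varphi$ and $\lambda>0$. $\varphi$ is prox-bounded if $e_\lambda\varphi(x)>-\infty$ for some $\lambda>0$ and some $x$. In (b) and (c), where $e_\lambda f$ appears, $f$ is understood to be proper, lsc and prox-bounded; this is arranged if necessary by adding to $f$ the indicator function of a sufficiently small closed ball around $\bar x$ (so that $f$ becomes lsc and bounded below), all other quantities depending only on the local behavior of $f$ near $\bar x$. KL property. Let $\varphi$ be finite and locally lsc at $\bar x$. It satisfies the KL property at $\bar x$ with exponent $\theta\in[0,1)$ if there exist $\mu>0$ (modulus), $\epsilon>0$ and $\nu\in(0,+\infty]$ such that $d(0,\partial\varphi(x))\ge\frac{\mu}{1-\theta}(\varphi(x)-\varphi(\bar x))^{\theta}$ whenever $\|x-\bar x\|\le\epsilon$ and $\varphi(\bar x)<\varphi(x)<\varphi(\bar x)+\nu$. $\mathrm{KL}(\varphi,\bar x,\theta)$ is the supremum of all such $\mu$ ($\sup\emptyset:=0$); equivalently the liminf of $\frac{(1-\theta)d(0,\partial\varphi(x))}{(\varphi(x)-\varphi(\bar x))^{\theta}}$ as $x\to\bar x$, $\varphi(x)\to\varphi(\bar x)$, $\varphi(x)>\varphi(\bar x)$ ($+\infty$ if there are no such sequences). An exponent $\theta\in(0,1)$ is sharp if $\varphi$ satisfies the KL property at $\bar x$ with exponent $\theta$ but not with any exponent $\theta'\in[0,\theta)$. *)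

theory Defs
  imports "HOL-Analysis.Analysis"
begin

section \<open>Extended-real-valued functions\<close>

definition finite_at :: "('a \<Rightarrow> ereal) \<Rightarrow> 'a \<Rightarrow> bool" where
  "finite_at \<phi> x \<longleftrightarrow> \<bar>\<phi> x\<bar> \<noteq> \<infinity>"

definition epi :: "('a \<Rightarrow> ereal) \<Rightarrow> ('a \<times> real) set" where
  "epi \<phi> = {(x, \<alpha>). \<phi> x \<le> ereal \<alpha>}"

definition locally_closed_at :: "'b::topological_space set \<Rightarrow> 'b \<Rightarrow> bool" where
  "locally_closed_at C z \<longleftrightarrow> (\<exists>V. closed V \<and> z \<in> interior V \<and> closed (C \<inter> V))"

text \<open>To be used only where \<open>\<phi>\<close> is finite at \<open>x\<close>.\<close>

definition locally_lsc_at :: "('a::topological_space \<Rightarrow> ereal) \<Rightarrow> 'a \<Rightarrow> bool" where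
  "locally_lsc_at \<phi> x \<longleftrightarrow> locally_closed_at (epi \<phi>) (x, real_of_ereal (\<phi> x))"

definition lsc :: "('a::topological_space \<Rightarrow> ereal) \<Rightarrow> bool" where
  "lsc \<phi> \<longleftrightarrow> (\<forall>x. \<phi> x \<le> Liminf (at x) \<phi>)"

definition proper :: "('a \<Rightarrow> ereal) \<Rightarrow> bool" where
  "proper \<phi> \<longleftrightarrow> (\<forall>x. \<phi> x \<noteq> -\<infinity>) \<and> (\<exists>x. \<phi> x \<noteq> \<infinity>)"

definition ind_fun :: "'a set \<Rightarrow> 'a \<Rightarrow> ereal" where
  "ind_fun C x = (if x \<in> C then 0 else \<infinity>)"

text \<open>Only used for nonnegative arguments.\<close>

definition esqrt :: "ereal \<Rightarrow> ereal" where
  "esqrt r = (if r = \<infinity> then \<infinity> else ereal (sqrt (real_of_ereal r)))"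

text \<open>\<open>sqrt_gap f xbar\<close> is the function \<open>g\<close> (and, for the envelope of \<open>f\<close>, \<open>g\<close> with a tilde).\<close>

definition sqrt_gap :: "('a \<Rightarrow> ereal) \<Rightarrow> 'a \<Rightarrow> 'a \<Rightarrow> ereal" where
  "sqrt_gap f xbar x = esqrt (max (f x - f xbar) 0)"

text \<open>Unlike \<^const>\<open>infdist\<close>, this is \<open>\<infinity>\<close> for the empty set.\<close>

definition edist :: "'a::real_normed_vector \<Rightarrow> 'a set \<Rightarrow> ereal" where
  "edist v A = (INF a\<in>A. ereal (norm (a - v)))"

section \<open>Subgradients\<close>

text \<open>The condition \<open>\<phi> y \<ge> \<phi> x + \<langle>v, y - x\<rangle> + o(\<parallel>y - x\<parallel>)\<close> is one-sided: the error term only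
  has to bound \<open>\<phi>\<close> from below, so it is spelled out with \<open>- e * \<parallel>y - x\<parallel>\<close> for every \<open>e > 0\<close>.\<close>

definition regular_subdiff :: "('a::real_inner \<Rightarrow> ereal) \<Rightarrow> 'a \<Rightarrow> 'a set" where
  "regular_subdiff \<phi> x = {v. finite_at \<phi> x \<and>
     (\<forall>e>0. \<forall>\<^sub>F y in nhds x. \<phi> y \<ge> \<phi> x + ereal (v \<bullet> (y - x) - e * norm (y - x)))}"

definition limiting_subdiff :: "('a::real_inner \<Rightarrow> ereal) \<Rightarrow> 'a \<Rightarrow> 'a set" where
  "limiting_subdiff \<phi> x = {v. finite_at \<phi> x \<and>
     (\<exists>X V. X \<longlonglongrightarrow> x \<and> V \<longlonglongrightarrow> v \<and> (\<lambda>k. \<phi> (X k)) \<longlonglongrightarrow> \<phi> x \<and>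
            (\<forall>k. V k \<in> regular_subdiff \<phi> (X k)))}"

definition outer_subdiff :: "('a::real_inner \<Rightarrow> ereal) \<Rightarrow> 'a \<Rightarrow> 'a set" where
  "outer_subdiff \<phi> x = {v. finite_at \<phi> x \<and>
     (\<exists>X V. X \<longlonglongrightarrow> x \<and> V \<longlonglongrightarrow> v \<and> (\<lambda>k. \<phi> (X k)) \<longlonglongrightarrow> \<phi> x \<and>
            (\<forall>k. \<phi> (X k) > \<phi> x \<and> V k \<in> limiting_subdiff \<phi> (X k)))}"

definition has_egradient :: "('a::real_inner \<Rightarrow> ereal) \<Rightarrow> 'a \<Rightarrow> 'a \<Rightarrow> bool" where
  "has_egradient \<phi> x D \<longleftrightarrow>
     (\<forall>\<^sub>F y in nhds x. finite_at \<phi> y) \<and> GDERIV (\<lambda>y. real_of_ereal (\<phi> y)) x :> D"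

definition egradient :: "('a::real_inner \<Rightarrow> ereal) \<Rightarrow> 'a \<Rightarrow> 'a" where
  "egradient \<phi> x = (THE D. has_egradient \<phi> x D)"

section \<open>Prox-regularity and second-order notions\<close>

definition prox_regular :: "('a::real_inner \<Rightarrow> ereal) \<Rightarrow> 'a \<Rightarrow> 'a \<Rightarrow> bool" where
  "prox_regular f xbar vbar \<longleftrightarrow>
     finite_at f xbar \<and> locally_lsc_at f xbar \<and> vbar \<in> limiting_subdiff f xbar \<and>
     (\<exists>\<epsilon>>0. \<exists>\<rho>\<ge>0. \<forall>x v.
        v \<in> limiting_subdiff f x \<and> norm (v - vbar) < \<epsilon> \<and> norm (x - xbar) < \<epsilon> \<and>
        f x < f xbar + ereal \<epsilon> \<longrightarrow>
        (\<forall>x' \<in> cball xbar \<epsilon>.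
           f x' \<ge> f x + ereal (v \<bullet> (x' - x) - \<rho> / 2 * (norm (x' - x))\<^sup>2)))"

definition subdiff_continuous :: "('a::real_inner \<Rightarrow> ereal) \<Rightarrow> 'a \<Rightarrow> 'a \<Rightarrow> bool" where
  "subdiff_continuous f xbar vbar \<longleftrightarrow>
     vbar \<in> limiting_subdiff f xbar \<and>
     (\<forall>X V. X \<longlonglongrightarrow> xbar \<and> V \<longlonglongrightarrow> vbar \<and> (\<forall>k. V k \<in> limiting_subdiff f (X k)) \<longrightarrow>
            (\<lambda>k. f (X k)) \<longlonglongrightarrow> f xbar)"

definition second_quot :: "('a::real_inner \<Rightarrow> ereal) \<Rightarrow> 'a \<Rightarrow> 'a \<Rightarrow> real \<Rightarrow> 'a \<Rightarrow> ereal" where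
  "second_quot f xbar v t w =
     (f (xbar + t *\<^sub>R w) - f xbar - ereal (t * (v \<bullet> w))) / ereal (1 / 2 * t\<^sup>2)"

definition second_subderiv :: "('a::real_inner \<Rightarrow> ereal) \<Rightarrow> 'a \<Rightarrow> 'a \<Rightarrow> 'a \<Rightarrow> ereal" where
  "second_subderiv f xbar v w =
     Liminf (at_right 0 \<times>\<^sub>F nhds w) (\<lambda>(t, w'). second_quot f xbar v t w')"

definition twice_epi_diff :: "('a::real_inner \<Rightarrow> ereal) \<Rightarrow> 'a \<Rightarrow> 'a \<Rightarrow> bool" where
  "twice_epi_diff f xbar v \<longleftrightarrow>
     (\<forall>w (t :: nat \<Rightarrow> real). (\<forall>k. t k > 0) \<and> t \<longlonglongrightarrow> 0 \<longrightarrow>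
        (\<exists>w'. w' \<longlonglongrightarrow> w \<and>
              (\<lambda>k. second_quot f xbar v (t k) (w' k)) \<longlonglongrightarrow> second_subderiv f xbar v w))"

section \<open>Set-valued mappings\<close>

text \<open>A set-valued mapping is a function of type \<open>'a \<Rightarrow> 'b set\<close>.\<close>

definition gph :: "('a \<Rightarrow> 'b set) \<Rightarrow> ('a \<times> 'b) set" where
  "gph S = {(x, u). u \<in> S x}"

definition set_inv :: "('a \<Rightarrow> 'b set) \<Rightarrow> 'b \<Rightarrow> 'a set" where
  "set_inv S u = {x. u \<in> S x}"

definition tangent_cone :: "'a::real_normed_vector set \<Rightarrow> 'a \<Rightarrow> 'a set" where
  "tangent_cone A x = {w. \<exists>(t :: nat \<Rightarrow> real) W. (\<forall>k. t k > 0) \<and> t \<longlonglongrightarrow> 0 \<and> W \<longlonglongrightarrow> w \<and>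
                              (\<forall>k. x + t k *\<^sub>R W k \<in> A)}"

definition graphical_deriv ::
  "('a::real_normed_vector \<Rightarrow> 'b::real_normed_vector set) \<Rightarrow> 'a \<Rightarrow> 'b \<Rightarrow> 'a \<Rightarrow> 'b set" where
  "graphical_deriv S xbar ubar w = {z. (w, z) \<in> tangent_cone (gph S) (xbar, ubar)}"

definition subreg ::
  "('a::real_normed_vector \<Rightarrow> 'b::real_normed_vector set) \<Rightarrow> 'a \<Rightarrow> 'b \<Rightarrow> ereal" where
  "subreg S xbar ubar = Inf {ereal \<kappa> | \<kappa>. \<kappa> > 0 \<and>
     (\<forall>\<^sub>F x in nhds xbar. edist x (set_inv S ubar) \<le> ereal \<kappa> * edist ubar (S x))}"

text \<open>Painleve-Kuratowski limits as the real parameter tends to \<open>0\<close> from the right.\<close>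

definition outer_lim0 :: "(real \<Rightarrow> 'a::topological_space set) \<Rightarrow> 'a set" where
  "outer_lim0 C = {v. \<exists>l V. (\<forall>k::nat. l k > 0) \<and> l \<longlonglongrightarrow> 0 \<and> V \<longlonglongrightarrow> v \<and> (\<forall>k. V k \<in> C (l k))}"

definition inner_lim0 :: "(real \<Rightarrow> 'a::topological_space set) \<Rightarrow> 'a set" where
  "inner_lim0 C = {v. \<forall>l. (\<forall>k::nat. l k > 0) \<and> l \<longlonglongrightarrow> 0 \<longrightarrow>
                        (\<exists>V. V \<longlonglongrightarrow> v \<and> (\<forall>\<^sub>F k in sequentially. V k \<in> C (l k)))}"

definition pk_converges0 :: "(real \<Rightarrow> 'a::topological_space set) \<Rightarrow> 'a set \<Rightarrow> bool" where
  "pk_converges0 C L \<longleftrightarrow> outer_lim0 C = L \<and> inner_lim0 C = L"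

section \<open>Moreau envelopes\<close>

definition moreau_env :: "real \<Rightarrow> ('a::real_normed_vector \<Rightarrow> ereal) \<Rightarrow> 'a \<Rightarrow> ereal" where
  "moreau_env lam \<phi> x = (INF w. \<phi> w + ereal (1 / (2 * lam) * (norm (w - x))\<^sup>2))"

definition prox_bounded :: "('a::real_normed_vector \<Rightarrow> ereal) \<Rightarrow> bool" where
  "prox_bounded \<phi> \<longleftrightarrow> (\<exists>lam>0. \<exists>x. moreau_env lam \<phi> x > -\<infinity>)"

section \<open>The Kurdyka-Lojasiewicz property\<close>

definition kl_with_modulus :: "('a::real_inner \<Rightarrow> ereal) \<Rightarrow> 'a \<Rightarrow> real \<Rightarrow> real \<Rightarrow> bool" where
  "kl_with_modulus \<phi> xbar \<theta> \<mu> \<longleftrightarrow>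
     finite_at \<phi> xbar \<and> locally_lsc_at \<phi> xbar \<and> 0 \<le> \<theta> \<and> \<theta> < 1 \<and> \<mu> > 0 \<and>
     (\<exists>\<epsilon>>0. \<exists>\<nu>::ereal. 0 < \<nu> \<and>
        (\<forall>x. norm (x - xbar) \<le> \<epsilon> \<and> \<phi> xbar < \<phi> x \<and> \<phi> x < \<phi> xbar + \<nu> \<longrightarrow>
             edist 0 (limiting_subdiff \<phi> x)
               \<ge> ereal (\<mu> / (1 - \<theta>) * real_of_ereal (\<phi> x - \<phi> xbar) powr \<theta>)))"

definition kl_property :: "('a::real_inner \<Rightarrow> ereal) \<Rightarrow> 'a \<Rightarrow> real \<Rightarrow> bool" where
  "kl_property \<phi> xbar \<theta> \<longleftrightarrow> (\<exists>\<mu>. kl_with_modulus \<phi> xbar \<theta> \<mu>)"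

text \<open>Inserting \<open>0\<close> only matters when there is no modulus, all moduli being positive.\<close>

definition KL :: "('a::real_inner \<Rightarrow> ereal) \<Rightarrow> 'a \<Rightarrow> real \<Rightarrow> ereal" where
  "KL \<phi> xbar \<theta> = Sup (insert 0 (ereal ` {\<mu>. kl_with_modulus \<phi> xbar \<theta> \<mu>}))"

definition kl_sharp :: "('a::real_inner \<Rightarrow> ereal) \<Rightarrow> 'a \<Rightarrow> real \<Rightarrow> bool" where
  "kl_sharp \<phi> xbar \<theta> \<longleftrightarrow> 0 < \<theta> \<and> \<theta> < 1 \<and> kl_property \<phi> xbar \<theta> \<and>
     (\<forall>\<theta>'. 0 \<le> \<theta>' \<and> \<theta>' < \<theta> \<longrightarrow> \<not> kl_property \<phi> xbar \<theta>')"

section \<open>Functions whose envelope may be taken\<close>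

text \<open>Moreau envelopes are only taken of proper, lsc, prox-bounded functions. If \<open>f\<close> itself is not
  of this kind, adding the indicator of a small closed ball around \<open>xbar\<close> is meant to achieve it.\<close>

definition env_version ::
  "('a::real_normed_vector \<Rightarrow> ereal) \<Rightarrow> 'a \<Rightarrow> ('a \<Rightarrow> ereal) \<Rightarrow> bool" where
  "env_version f xbar F \<longleftrightarrow>
     (F = f \<or> (\<exists>r>0. F = (\<lambda>x. f x + ind_fun (cball xbar r) x))) \<and>
     proper F \<and> lsc F \<and> prox_bounded F"

end

theory Submission
  imports Defs
begin

text \<open>
  Write \<open>g\<close> for the square root of the gap \<open>f - f xbar\<close>, \<open>D\<close> for the graphical derivative of \<open>\<partial>f\<close> at
  \<open>xbar\<close> for \<open>0\<close>, and \<open>h\<close> for half the second subderivative. Since \<open>\<partial>g = \<partial>f / (2 g)\<close> wherever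
  \<open>0 < g < \<infinity>\<close>, a KL inequality with exponent \<open>1/2\<close> is a lower bound on the slopes of \<open>g\<close>, and the KL
  modulus is the distance from the origin to \<open>\<partial>\<^sup>>g(xbar)\<close> (\<open>KL_half_eq_edist_outer_subdiff\<close>). So the
  task is to compute this set, for \<open>f\<close>, for \<open>h\<close> and for the envelopes.

  By compactness, nonsingularity of \<open>D\<close> is an estimate \<open>\<parallel>x - xbar\<parallel> \<le> \<kappa> \<parallel>v\<parallel>\<close> for all \<open>v \<in> \<partial>f(x)\<close> with
  \<open>x\<close> near \<open>xbar\<close> (\<open>nonsingular_imp_strong_subregular\<close>). The prox-regularity inequality at \<open>(x, v)\<close>,
  tested at \<open>xbar\<close>, reads \<open>g(x)\<^sup>2 \<le> \<langle>v, x - xbar\<rangle> + \<rho>/2 \<parallel>x - xbar\<parallel>\<^sup>2\<close>; both together give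
  \<open>g(x) \<le> C \<parallel>v\<parallel>\<close>, which is the KL property. It is sharp as soon as \<open>0 < h(w) < \<infinity>\<close>: then \<open>f\<close> grows
  like \<open>t\<^sup>2\<close> near the ray of \<open>w\<close>, and minimising \<open>f\<close> plus a multiple of a squared distance over balls of
  radius proportional to \<open>t\<close> yields points with a gap of order \<open>t\<^sup>2\<close> and subgradients of order \<open>t\<close>.

  Under twice epi-differentiability the quotients \<open>(f(xbar + t w) - f xbar) / t\<^sup>2\<close> epi-converge to \<open>h\<close>.
  Passing to the limit in the prox-regularity inequality along the graph of \<open>\<partial>f\<close> shows that the
  quotients even converge along sequences defining \<open>z \<in> D(w)\<close>, and that \<open>z\<close> supports \<open>h\<close> at \<open>w\<close> up to
  a quadratic (\<open>graph_limit\<close>). As \<open>h\<close> is homogeneous of degree two, this forces \<open>h(w) = \<langle>z, w\<rangle> / 2\<close>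
  (\<open>euler\<close>). Conversely, proximal subgradients of \<open>h\<close> are recovered from minimisers of penalised
  quotients, whence \<open>D = \<partial>h\<close> (\<open>D_eq_limiting_subdiff\<close>). Rescaling a sequence that defines an element of
  \<open>\<partial>\<^sup>>g(xbar)\<close> by \<open>t = g(x)\<close>, so that all quotients equal \<open>1\<close>, now shows that \<open>\<partial>\<^sup>>g(xbar)\<close> consists of
  the vectors \<open>v / sqrt (2 \<langle>v, w\<rangle>)\<close> with \<open>v \<in> D(w)\<close> and \<open>\<langle>v, w\<rangle> > 0\<close> (\<open>outer_subdiff_root\<close>); the same
  set is found for \<open>h\<close> at \<open>0\<close>.

  For small \<open>\<lambda>\<close> the envelope \<open>e\<close> of \<open>f\<close> is differentiable near \<open>xbar\<close> with Lipschitz gradient, the graph of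
  the gradient is locally \<open>{(w + \<lambda> v, v) | v \<in> \<partial>f(w)}\<close>, and the quotients of \<open>e\<close> epi-converge to the
  envelope of \<open>h\<close>. Hence \<open>e\<close> satisfies the same hypotheses as \<open>f\<close>, and everything proved for \<open>f\<close> applies
  to it; the shift turns \<open>\<langle>v, w\<rangle>\<close> into \<open>\<langle>v, w\<rangle> + \<lambda> \<parallel>v\<parallel>\<^sup>2\<close>. What is left for \<open>\<lambda> \<rightarrow> 0\<close> is a statement about
  the closed cone \<open>D\<close> alone: with \<open>v\<close> normalised by \<open>2 \<langle>v, w\<rangle> + 2 \<lambda> \<parallel>v\<parallel>\<^sup>2 = 1\<close>, the estimate
  \<open>\<parallel>w\<parallel> \<le> \<sigma> \<parallel>v\<parallel>\<close> makes bounded families of slopes relatively compact (\<open>root_slopes_limit\<close>).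
\<close>

section \<open>Sequences, subgradients and localisation\<close>

lemma bounded_subseq:
  fixes X :: "nat \<Rightarrow> 'a::euclidean_space"
  assumes "\<And>k. norm (X k) \<le> B"
  shows "\<exists>l r. norm l \<le> B \<and> strict_mono r \<and> (X \<circ> r) \<longlonglongrightarrow> l"
proof -
  have "\<forall>k. X k \<in> cball 0 B" using assms by simp
  from seq_compactE[OF compact_imp_seq_compact[OF compact_cball] this]
  obtain l r where "l \<in> cball 0 B" "strict_mono r" "(X \<circ> r) \<longlonglongrightarrow> l" .
  then show ?thesis by auto
qed

lemma null_seq_Suc: "(\<forall>k. 0 < inverse (real (Suc k))) \<and> (\<lambda>k. inverse (real (Suc k))) \<longlonglongrightarrow> 0"
  using LIMSEQ_inverse_real_of_nat by simp

text \<open>Negated local statements provide witnesses for every radius; this picks one for each \<open>1/(k+1)\<close>.\<close>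

lemma null_seq_choice:
  assumes "\<And>\<delta>. \<delta> > 0 \<Longrightarrow> \<exists>x y. P \<delta> x y"
  shows "\<exists>X Y. \<forall>k. P (inverse (real (Suc k))) (X k) (Y k)"
proof -
  have "\<exists>x y. P (inverse (real (Suc k))) x y" for k by (rule assms) simp
  then show ?thesis by metis
qed

lemma tendsto_of_inverse_Suc:
  fixes X :: "nat \<Rightarrow> 'a::real_normed_vector"
  assumes "\<And>k. norm (X k - x) < inverse (real (Suc k))"
  shows "X \<longlonglongrightarrow> x"
  by (rule LIM_zero_cancel, rule Lim_null_comparison[OF _ LIMSEQ_inverse_real_of_nat], rule always_eventually)
    (use assms in \<open>simp add: less_imp_le del: of_nat_Suc\<close>)

lemma finite_at_ereal: "finite_at \<phi> x \<longleftrightarrow> (\<exists>c. \<phi> x = ereal c)"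
  unfolding finite_at_def by (cases "\<phi> x") auto

lemma proximal_subgradient:
  fixes \<phi> :: "'a::real_inner \<Rightarrow> ereal"
  assumes "\<phi> x = ereal a" and "r > 0"
    and ineq: "\<And>y. norm (y - x) < r \<Longrightarrow> ereal (a + v \<bullet> (y - x) - C * (norm (y - x))\<^sup>2) \<le> \<phi> y"
  shows "v \<in> regular_subdiff \<phi> x"
proof -
  have "\<forall>\<^sub>F y in nhds x. \<phi> y \<ge> \<phi> x + ereal (v \<bullet> (y - x) - e * norm (y - x))" if "e > 0" for e
  proof -
    let ?d = "min r (e / (\<bar>C\<bar> + 1))"
    have "?d > 0" using \<open>r > 0\<close> \<open>e > 0\<close> by (simp add: add_nonneg_pos)
    moreover have "\<phi> y \<ge> \<phi> x + ereal (v \<bullet> (y - x) - e * norm (y - x))" if d: "dist y x < ?d" for y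
    proof -
      have n: "norm (y - x) < r" "norm (y - x) \<le> e / (\<bar>C\<bar> + 1)" using d by (auto simp: dist_norm)
      then have "(\<bar>C\<bar> + 1) * norm (y - x) \<le> e"
        by (simp add: field_simps add_nonneg_pos)
      moreover have "C * norm (y - x) \<le> (\<bar>C\<bar> + 1) * norm (y - x)"
        by (rule mult_right_mono) auto
      ultimately have "C * norm (y - x) \<le> e" by linarith
      then have "C * norm (y - x) * norm (y - x) \<le> e * norm (y - x)"
        by (rule mult_right_mono) auto
      then have "C * (norm (y - x))\<^sup>2 \<le> e * norm (y - x)" by (simp add: power2_eq_square mult.assoc)
      then have "ereal (a + (v \<bullet> (y - x) - e * norm (y - x)))
          \<le> ereal (a + v \<bullet> (y - x) - C * (norm (y - x))\<^sup>2)" by simp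
      also have "\<dots> \<le> \<phi> y" by (rule ineq[OF n(1)])
      finally show ?thesis using assms(1) by simp
    qed
    ultimately show ?thesis unfolding eventually_nhds_metric by blast
  qed
  then show ?thesis using assms(1) by (auto simp: regular_subdiff_def finite_at_def)
qed

text \<open>Constructed subgradient sequences satisfy their defining relation only from some index on; dropping
  the initial terms repairs this.\<close>

lemma limiting_subdiff_iff_eventually:
  "v \<in> limiting_subdiff \<phi> x \<longleftrightarrow> finite_at \<phi> x \<and>
     (\<exists>X V. X \<longlonglongrightarrow> x \<and> V \<longlonglongrightarrow> v \<and> (\<lambda>k. \<phi> (X k)) \<longlonglongrightarrow> \<phi> x \<and>
            (\<forall>\<^sub>F k in sequentially. V k \<in> regular_subdiff \<phi> (X k)))" (is "?L \<longleftrightarrow> ?R")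
proof
  assume ?L then show ?R unfolding limiting_subdiff_def by (auto intro: always_eventually)
next
  assume ?R
  then obtain X V where X: "X \<longlonglongrightarrow> x" "V \<longlonglongrightarrow> v" "(\<lambda>k. \<phi> (X k)) \<longlonglongrightarrow> \<phi> x"
    and ev: "\<forall>\<^sub>F k in sequentially. V k \<in> regular_subdiff \<phi> (X k)" and fin: "finite_at \<phi> x" by blast
  from ev obtain N where N: "\<And>k. k \<ge> N \<Longrightarrow> V k \<in> regular_subdiff \<phi> (X k)"
    unfolding eventually_sequentially by blast
  have "(\<lambda>k. X (k + N)) \<longlonglongrightarrow> x" "(\<lambda>k. V (k + N)) \<longlonglongrightarrow> v" "(\<lambda>k. \<phi> (X (k + N))) \<longlonglongrightarrow> \<phi> x"
    using X[THEN LIMSEQ_ignore_initial_segment[where k=N]] by auto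
  then show ?L unfolding limiting_subdiff_def mem_Collect_eq using fin N
    by (intro conjI exI[of _ "\<lambda>k. X (k + N)"] exI[of _ "\<lambda>k. V (k + N)"]) auto
qed

lemma regular_subdiff_subset_limiting: "regular_subdiff \<phi> x \<subseteq> limiting_subdiff \<phi> x"
proof
  fix v assume v: "v \<in> regular_subdiff \<phi> x"
  then show "v \<in> limiting_subdiff \<phi> x"
    unfolding limiting_subdiff_def mem_Collect_eq
    by (intro conjI exI[of _ "\<lambda>_. x"] exI[of _ "\<lambda>_. v"] allI tendsto_const)
      (auto simp: regular_subdiff_def)
qed

lemma limiting_subdiff_finite: "v \<in> limiting_subdiff \<phi> x \<Longrightarrow> \<exists>a. \<phi> x = ereal a"
  by (auto simp: limiting_subdiff_def finite_at_ereal)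

lemma regular_subdiff_cong:
  assumes "\<forall>\<^sub>F y in nhds x. \<phi> y = \<psi> y"
  shows "regular_subdiff \<phi> x = regular_subdiff \<psi> x"
proof -
  have *: "regular_subdiff \<phi> x \<subseteq> regular_subdiff \<psi> x" if ev: "\<forall>\<^sub>F y in nhds x. \<phi> y = \<psi> y" for \<phi> \<psi>
  proof
    fix v assume v: "v \<in> regular_subdiff \<phi> x"
    have x: "\<phi> x = \<psi> x" using ev eventually_nhds_x_imp_x by blast
    have "\<forall>\<^sub>F y in nhds x. \<psi> y \<ge> \<psi> x + ereal (v \<bullet> (y - x) - e * norm (y - x))" if "e > 0" for e
    proof -
      have "\<forall>\<^sub>F y in nhds x. \<phi> y \<ge> \<phi> x + ereal (v \<bullet> (y - x) - e * norm (y - x))"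
        using v that by (auto simp: regular_subdiff_def)
      with ev show ?thesis by eventually_elim (simp add: x)
    qed
    then show "v \<in> regular_subdiff \<psi> x" using v x by (auto simp: regular_subdiff_def finite_at_def)
  qed
  have "\<forall>\<^sub>F y in nhds x. \<psi> y = \<phi> y" using assms by eventually_elim simp
  then show ?thesis using *[OF assms] * by blast
qed

lemma limiting_subdiff_cong:
  assumes "open U" "x \<in> U" and eq: "\<And>y. y \<in> U \<Longrightarrow> \<phi> y = \<psi> y"
  shows "limiting_subdiff \<phi> x = limiting_subdiff \<psi> x"
proof -
  have *: "limiting_subdiff \<phi> x \<subseteq> limiting_subdiff \<psi> x" if eq: "\<And>y. y \<in> U \<Longrightarrow> \<phi> y = \<psi> y" for \<phi> \<psi>
  proof
    fix v assume "v \<in> limiting_subdiff \<phi> x"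
    then obtain X V where fin: "finite_at \<phi> x"
      and X: "X \<longlonglongrightarrow> x" "V \<longlonglongrightarrow> v" "(\<lambda>k. \<phi> (X k)) \<longlonglongrightarrow> \<phi> x"
      and V: "\<And>k. V k \<in> regular_subdiff \<phi> (X k)" unfolding limiting_subdiff_def by blast
    have ev: "\<forall>\<^sub>F k in sequentially. X k \<in> U" using X(1) assms(1,2) topological_tendstoD by blast
    have lim: "(\<lambda>k. \<psi> (X k)) \<longlonglongrightarrow> \<psi> x"
    proof (rule Lim_transform_eventually)
      show "(\<lambda>k. \<phi> (X k)) \<longlonglongrightarrow> \<psi> x" using X(3) eq[OF assms(2)] by simp
      show "\<forall>\<^sub>F k in sequentially. \<phi> (X k) = \<psi> (X k)" using ev by eventually_elim (rule eq)
    qed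
    have "regular_subdiff \<phi> y = regular_subdiff \<psi> y" if "y \<in> U" for y
      by (rule regular_subdiff_cong) (use that assms(1) eq in \<open>auto simp: eventually_nhds\<close>)
    then have "\<forall>\<^sub>F k in sequentially. V k \<in> regular_subdiff \<psi> (X k)"
      using V by (intro eventually_mono[OF ev]) blast
    then show "v \<in> limiting_subdiff \<psi> x"
      unfolding limiting_subdiff_iff_eventually using fin X lim eq assms(2)
      by (auto simp: finite_at_def)
  qed
  show ?thesis using *[of \<phi> \<psi>] *[of \<psi> \<phi>] eq by auto
qed

section \<open>The square root of the gap and the KL modulus\<close>

lemma sqrt_gap_ereal:
  assumes "\<phi> xbar = ereal c" "\<phi> x = ereal a"
  shows "sqrt_gap \<phi> xbar x = ereal (sqrt (max (a - c) 0))"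
  using assms by (simp add: sqrt_gap_def esqrt_def zero_ereal_def flip: ereal_max)

lemma sqrt_gap_base: "\<phi> xbar = ereal c \<Longrightarrow> sqrt_gap \<phi> xbar xbar = 0"
  by (simp add: sqrt_gap_ereal zero_ereal_def)

lemma sqrt_gap_eq_ereal_pos:
  assumes "\<phi> xbar = ereal c" "s > 0"
  shows "sqrt_gap \<phi> xbar x = ereal s \<longleftrightarrow> \<phi> x = ereal (c + s\<^sup>2)"
proof (cases "\<phi> x")
  case (real a)
  have "sqrt (max (a - c) 0) = s \<longleftrightarrow> a = c + s\<^sup>2"
    using assms(2) by (auto simp: max_def split: if_splits)
  then show ?thesis using assms(1) real by (simp add: sqrt_gap_ereal)
qed (use assms in \<open>auto simp: sqrt_gap_def esqrt_def zero_ereal_def max_def\<close>)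

lemma ereal_le_sqrt_gap:
  assumes "\<phi> xbar = ereal c" "0 \<le> b" "ereal (c + b) \<le> \<phi> y"
  shows "ereal (sqrt b) \<le> sqrt_gap \<phi> xbar y"
proof (cases "\<phi> y")
  case (real a)
  then show ?thesis using assms by (simp add: sqrt_gap_ereal)
qed (use assms in \<open>auto simp: sqrt_gap_def esqrt_def\<close>)

lemma sqrt_gap_le_ereal:
  assumes "\<phi> xbar = ereal c" "0 < b" "ereal b \<le> sqrt_gap \<phi> xbar y"
  shows "ereal (c + b\<^sup>2) \<le> \<phi> y"
proof (cases "\<phi> y")
  case (real a)
  then have b: "b \<le> sqrt (max (a - c) 0)" using assms by (simp add: sqrt_gap_ereal)
  then have "b\<^sup>2 \<le> (sqrt (max (a - c) 0))\<^sup>2" using assms(2) by (intro power_mono) auto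
  then have "b\<^sup>2 \<le> max (a - c) 0" by simp
  moreover have "b\<^sup>2 > 0" using assms(2) by simp
  ultimately show ?thesis using real by (auto simp: max_def split: if_splits)
qed (use assms in \<open>auto simp: sqrt_gap_def esqrt_def zero_ereal_def max_def split: if_splits\<close>)

text \<open>After scaling to \<open>s = 1\<close> this is \<open>1 + x/2 - x\<^sup>2/2 \<le> sqrt (1 + x)\<close>. For \<open>x \<le> 3\<close> the difference of the squares
  is \<open>(1 + x) x\<^sup>2 (3 - x) / 4 \<ge> 0\<close>, and for \<open>x > 3\<close> the left-hand side is negative. It makes the error in
  the chain rule for the root explicit.\<close>

lemma sqrt_lower_quadratic:
  fixes d s :: real
  assumes "s > 0" "d \<ge> - s\<^sup>2"
  shows "s + d / (2 * s) - d\<^sup>2 / (2 * s^3) \<le> sqrt (s\<^sup>2 + d)"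
proof -
  define x where "x = d / s\<^sup>2"
  have d: "d = x * s\<^sup>2" using assms by (simp add: x_def)
  have x: "x \<ge> -1" using assms by (simp add: x_def field_simps)
  have k: "1 + x/2 - x\<^sup>2/2 = (1 + x) * (2 - x) / 2" by (simp add: field_simps power2_eq_square)
  have "1 + x/2 - x\<^sup>2/2 \<le> sqrt (1 + x)"
  proof (cases "x \<le> 3")
    case True
    have "1 + x - (1 + x/2 - x\<^sup>2/2)\<^sup>2 = (1 + x) * (x\<^sup>2 * (3 - x)) / 4"
      by (simp add: field_simps power2_eq_square)
    moreover have "(1 + x) * (x\<^sup>2 * (3 - x)) / 4 \<ge> 0" using True x by simp
    ultimately have "(1 + x/2 - x\<^sup>2/2)\<^sup>2 \<le> 1 + x" by linarith
    then show ?thesis by (rule real_le_rsqrt)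
  next
    case False
    then have "(1 + x) * (2 - x) / 2 \<le> 0" using x by (auto simp: mult_le_0_iff)
    also have "0 \<le> sqrt (1 + x)" using x by simp
    finally show ?thesis unfolding k .
  qed
  then have "s * (1 + x/2 - x\<^sup>2/2) \<le> s * sqrt (1 + x)" using assms(1) by simp
  also have "s * sqrt (1 + x) = sqrt (s\<^sup>2 * (1 + x))" using assms(1) by (simp add: real_sqrt_mult)
  also have "s\<^sup>2 * (1 + x) = s\<^sup>2 + d" by (simp add: d algebra_simps)
  also have "s * (1 + x/2 - x\<^sup>2/2) = s + d / (2 * s) - d\<^sup>2 / (2 * s^3)"
    using assms(1) unfolding d by (simp add: field_simps power2_eq_square power3_eq_cube)
  finally show ?thesis .
qed

text \<open>The root of the gap is \<open>f\<close> followed by an increasing function that is smooth, with derivative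
  \<open>1 / (2 s)\<close>, at the value in question. As regular subgradients are lower estimates, monotonicity carries
  them in both directions although \<open>\<phi>\<close> may be discontinuous: downwards the convexity estimate
  \<open>(s + d)\<^sup>2 \<ge> s\<^sup>2 + 2 s d\<close> suffices, upwards the quadratic lower bound for the root.\<close>

lemma regular_subdiff_sqrt_gap_iff:
  fixes \<phi> :: "'a::real_inner \<Rightarrow> ereal"
  assumes c: "\<phi> xbar = ereal c" and s: "s > 0" and x: "\<phi> x = ereal (c + s\<^sup>2)"
  shows "u \<in> regular_subdiff (sqrt_gap \<phi> xbar) x \<longleftrightarrow> (2 * s) *\<^sub>R u \<in> regular_subdiff \<phi> x"
proof
  have gx: "sqrt_gap \<phi> xbar x = ereal s" using sqrt_gap_eq_ereal_pos[where \<phi> = \<phi>, OF c s] x by simp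
  show "(2 * s) *\<^sub>R u \<in> regular_subdiff \<phi> x" if u: "u \<in> regular_subdiff (sqrt_gap \<phi> xbar) x"
  proof -
    have "\<forall>\<^sub>F y in nhds x. \<phi> y \<ge> \<phi> x + ereal (((2 * s) *\<^sub>R u) \<bullet> (y - x) - e * norm (y - x))"
      if "e > 0" for e
    proof -
      let ?b = "\<lambda>y. s + (u \<bullet> (y - x) - e / (2 * s) * norm (y - x))"
      have 1: "\<forall>\<^sub>F y in nhds x. sqrt_gap \<phi> xbar y \<ge> sqrt_gap \<phi> xbar x
            + ereal (u \<bullet> (y - x) - e / (2 * s) * norm (y - x))"
        using u divide_pos_pos[OF \<open>e > 0\<close>, of "2 * s"] s unfolding regular_subdiff_def by fastforce
      have "(?b \<longlongrightarrow> ?b x) (nhds x)" by (intro tendsto_intros filterlim_ident)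
      then have 2: "\<forall>\<^sub>F y in nhds x. ?b y > 0"
        by (rule order_tendstoD) (use s in simp)
      show ?thesis using 1 2
      proof eventually_elim
        case (elim y)
        then have "ereal (c + (?b y)\<^sup>2) \<le> \<phi> y"
          using gx by (intro sqrt_gap_le_ereal[where \<phi> = \<phi>, OF c]) auto
        moreover have "s\<^sup>2 + 2 * s * (u \<bullet> (y - x) - e / (2 * s) * norm (y - x)) \<le> (?b y)\<^sup>2"
          by (simp only: power2_sum) simp
        moreover have "2 * s * (u \<bullet> (y - x) - e / (2 * s) * norm (y - x))
            = ((2 * s) *\<^sub>R u) \<bullet> (y - x) - e * norm (y - x)"
          using s by (simp add: right_diff_distrib)
        ultimately have "c + s\<^sup>2 + (((2 * s) *\<^sub>R u) \<bullet> (y - x) - e * norm (y - x)) \<le> c + (?b y)\<^sup>2"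
          by linarith
        with \<open>ereal (c + (?b y)\<^sup>2) \<le> \<phi> y\<close>
        have "ereal (c + s\<^sup>2 + (((2 * s) *\<^sub>R u) \<bullet> (y - x) - e * norm (y - x))) \<le> \<phi> y"
          by (meson ereal_less_eq(3) order_trans)
        then show ?case using x by simp
      qed
    qed
    then show ?thesis using x by (auto simp: regular_subdiff_def finite_at_def)
  qed
  show "u \<in> regular_subdiff (sqrt_gap \<phi> xbar) x" if v: "(2 * s) *\<^sub>R u \<in> regular_subdiff \<phi> x"
  proof -
    have "\<forall>\<^sub>F y in nhds x. sqrt_gap \<phi> xbar y \<ge> sqrt_gap \<phi> xbar x + ereal (u \<bullet> (y - x) - e * norm (y - x))"
      if "e > 0" for e
    proof -
      let ?d = "\<lambda>y. 2 * s * (u \<bullet> (y - x)) - e * s * norm (y - x)"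
      define K where "K = 2 * s * norm u + e * s"
      have "K > 0" using s \<open>e > 0\<close> by (simp add: K_def add_nonneg_pos)
      have 1: "\<forall>\<^sub>F y in nhds x. \<phi> y \<ge> \<phi> x + ereal (((2 * s) *\<^sub>R u) \<bullet> (y - x) - e * s * norm (y - x))"
        using v mult_pos_pos[OF \<open>e > 0\<close> s] unfolding regular_subdiff_def by blast
      have "((\<lambda>y. K * norm (y - x)) \<longlongrightarrow> K * norm (x - x)) (nhds x)" by (intro tendsto_intros filterlim_ident)
      then have 2: "\<forall>\<^sub>F y in nhds x. K * norm (y - x) < s\<^sup>2"
        by (rule order_tendstoD) (use s in simp)
      have "((\<lambda>y. K\<^sup>2 * norm (y - x)) \<longlongrightarrow> K\<^sup>2 * norm (x - x)) (nhds x)" by (intro tendsto_intros filterlim_ident)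
      then have 3: "\<forall>\<^sub>F y in nhds x. K\<^sup>2 * norm (y - x) < e * s ^ 3"
        by (rule order_tendstoD) (use s \<open>e > 0\<close> in simp)
      show ?thesis using 1 2 3
      proof eventually_elim
        case (elim y)
        let ?n = "norm (y - x)"
        have "\<bar>u \<bullet> (y - x)\<bar> \<le> norm u * ?n" by (rule Cauchy_Schwarz_ineq2)
        then have "\<bar>2 * s * (u \<bullet> (y - x))\<bar> \<le> 2 * s * norm u * ?n"
          using s by (simp add: abs_mult mult.assoc)
        moreover have "\<bar>e * s * ?n\<bar> = e * s * ?n" using \<open>e > 0\<close> s by simp
        ultimately have dK: "\<bar>?d y\<bar> \<le> K * ?n" unfolding K_def by (simp add: distrib_right)
        then have d: "?d y \<ge> - s\<^sup>2" using elim(2) by linarith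
        have "(?d y)\<^sup>2 \<le> (K * ?n)\<^sup>2" using dK by (metis abs_ge_zero power2_abs power_mono)
        also have "\<dots> = K\<^sup>2 * ?n * ?n" by (simp add: power2_eq_square)
        also have "\<dots> \<le> e * s ^ 3 * ?n" using elim(3) by (intro mult_right_mono) auto
        finally have "(?d y)\<^sup>2 / (2 * s ^ 3) \<le> e / 2 * ?n" using s by (simp add: field_simps)
        moreover have "s + ?d y / (2 * s) - (?d y)\<^sup>2 / (2 * s ^ 3) \<le> sqrt (s\<^sup>2 + ?d y)"
          by (rule sqrt_lower_quadratic[OF s d])
        moreover have "?d y / (2 * s) = u \<bullet> (y - x) - e / 2 * ?n" using s by (simp add: field_simps)
        ultimately have "s + (u \<bullet> (y - x) - e * ?n) \<le> sqrt (s\<^sup>2 + ?d y)" by linarith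
        moreover have "ereal (sqrt (s\<^sup>2 + ?d y)) \<le> sqrt_gap \<phi> xbar y"
          by (rule ereal_le_sqrt_gap[where \<phi> = \<phi>, OF c]) (use d elim(1) x in \<open>auto simp: add.assoc\<close>)
        ultimately have "ereal (s + (u \<bullet> (y - x) - e * ?n)) \<le> sqrt_gap \<phi> xbar y"
          by (meson ereal_less_eq(3) order_trans)
        then show ?case unfolding gx by simp
      qed
    qed
    then show ?thesis using gx by (auto simp: regular_subdiff_def finite_at_def)
  qed
qed


lemma limiting_subdiff_sqrt_gap_iff:
  fixes \<phi> :: "'a::real_inner \<Rightarrow> ereal"
  assumes c: "\<phi> xbar = ereal c" and s: "s > 0" and x: "\<phi> x = ereal (c + s\<^sup>2)"
  shows "u \<in> limiting_subdiff (sqrt_gap \<phi> xbar) x \<longleftrightarrow> (2 * s) *\<^sub>R u \<in> limiting_subdiff \<phi> x"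
proof
  have gx: "sqrt_gap \<phi> xbar x = ereal s" using sqrt_gap_eq_ereal_pos[where \<phi> = \<phi>, OF c s] x by simp
  show "(2 * s) *\<^sub>R u \<in> limiting_subdiff \<phi> x" if "u \<in> limiting_subdiff (sqrt_gap \<phi> xbar) x"
  proof -
    obtain X U where X: "X \<longlonglongrightarrow> x" "U \<longlonglongrightarrow> u"
      and lim: "(\<lambda>k. sqrt_gap \<phi> xbar (X k)) \<longlonglongrightarrow> ereal s"
      and reg: "\<And>k. U k \<in> regular_subdiff (sqrt_gap \<phi> xbar) (X k)"
      using \<open>u \<in> _\<close> unfolding limiting_subdiff_def gx by blast
    define S where "S k = real_of_ereal (sqrt_gap \<phi> xbar (X k))" for k
    have S: "sqrt_gap \<phi> xbar (X k) = ereal (S k)" for k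
      using reg[of k] unfolding S_def regular_subdiff_def finite_at_def by (auto simp: ereal_real')
    have Slim: "S \<longlonglongrightarrow> s" using lim unfolding S by simp
    have pos: "\<forall>\<^sub>F k in sequentially. S k > 0" using order_tendstoD(1)[OF Slim s] .
    have phi: "\<phi> (X k) = ereal (c + (S k)\<^sup>2)" if "S k > 0" for k
      using sqrt_gap_eq_ereal_pos[where \<phi> = \<phi> and x = "X k", OF c that] S by simp
    show ?thesis unfolding limiting_subdiff_iff_eventually
    proof (intro conjI exI)
      show "finite_at \<phi> x" using x by (simp add: finite_at_def)
      show "X \<longlonglongrightarrow> x" by fact
      show "(\<lambda>k. (2 * S k) *\<^sub>R U k) \<longlonglongrightarrow> (2 * s) *\<^sub>R u" by (intro tendsto_intros Slim X)
      show "(\<lambda>k. \<phi> (X k)) \<longlonglongrightarrow> \<phi> x" unfolding x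
      proof (rule Lim_transform_eventually)
        show "(\<lambda>k. ereal (c + (S k)\<^sup>2)) \<longlonglongrightarrow> ereal (c + s\<^sup>2)"
          unfolding lim_ereal by (intro tendsto_intros Slim)
        show "\<forall>\<^sub>F k in sequentially. ereal (c + (S k)\<^sup>2) = \<phi> (X k)"
          using pos by eventually_elim (simp add: phi)
      qed
      show "\<forall>\<^sub>F k in sequentially. (2 * S k) *\<^sub>R U k \<in> regular_subdiff \<phi> (X k)"
        using pos by eventually_elim (use reg phi regular_subdiff_sqrt_gap_iff[where \<phi> = \<phi>, OF c] in blast)
    qed
  qed
  show "u \<in> limiting_subdiff (sqrt_gap \<phi> xbar) x" if "(2 * s) *\<^sub>R u \<in> limiting_subdiff \<phi> x"
  proof -
    obtain X V where X: "X \<longlonglongrightarrow> x" "V \<longlonglongrightarrow> (2 * s) *\<^sub>R u"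
      and lim: "(\<lambda>k. \<phi> (X k)) \<longlonglongrightarrow> ereal (c + s\<^sup>2)"
      and reg: "\<And>k. V k \<in> regular_subdiff \<phi> (X k)"
      using \<open>(2 * s) *\<^sub>R u \<in> _\<close> unfolding limiting_subdiff_def x by blast
    define A where "A k = real_of_ereal (\<phi> (X k)) - c" for k
    have A: "\<phi> (X k) = ereal (c + A k)" for k
      using reg[of k] unfolding A_def regular_subdiff_def finite_at_def by (auto simp: ereal_real')
    have "(\<lambda>k. c + A k) \<longlonglongrightarrow> c + s\<^sup>2" using lim unfolding A by simp
    from tendsto_diff[OF this tendsto_const[of c]] have Alim: "A \<longlonglongrightarrow> s\<^sup>2" by simp
    from tendsto_real_sqrt[OF this] have Slim: "(\<lambda>k. sqrt (A k)) \<longlonglongrightarrow> s" using s by simp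
    have pos: "\<forall>\<^sub>F k in sequentially. A k > 0" using order_tendstoD(1)[OF Alim, of 0] s by simp
    have g: "sqrt_gap \<phi> xbar (X k) = ereal (sqrt (A k))" if "A k > 0" for k
      using sqrt_gap_eq_ereal_pos[where \<phi> = \<phi>, OF c, of "sqrt (A k)" "X k"] A that by simp
    show ?thesis unfolding limiting_subdiff_iff_eventually
    proof (intro conjI exI)
      show "finite_at (sqrt_gap \<phi> xbar) x" using gx by (simp add: finite_at_def)
      show "X \<longlonglongrightarrow> x" by fact
      have "(\<lambda>k. (1 / (2 * sqrt (A k))) *\<^sub>R V k) \<longlonglongrightarrow> (1 / (2 * s)) *\<^sub>R ((2 * s) *\<^sub>R u)"
        by (intro tendsto_intros Slim X) (use s in auto)
      then show "(\<lambda>k. (1 / (2 * sqrt (A k))) *\<^sub>R V k) \<longlonglongrightarrow> u" using s by simp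
      show "(\<lambda>k. sqrt_gap \<phi> xbar (X k)) \<longlonglongrightarrow> sqrt_gap \<phi> xbar x" unfolding gx
      proof (rule Lim_transform_eventually)
        show "(\<lambda>k. ereal (sqrt (A k))) \<longlonglongrightarrow> ereal s" unfolding lim_ereal by (rule Slim)
        show "\<forall>\<^sub>F k in sequentially. ereal (sqrt (A k)) = sqrt_gap \<phi> xbar (X k)"
          using pos by eventually_elim (simp add: g)
      qed
      show "\<forall>\<^sub>F k in sequentially. (1 / (2 * sqrt (A k))) *\<^sub>R V k \<in> regular_subdiff (sqrt_gap \<phi> xbar) (X k)"
        using pos
      proof eventually_elim
        case (elim k)
        have "\<phi> (X k) = ereal (c + (sqrt (A k))\<^sup>2)" using A elim by simp
        from regular_subdiff_sqrt_gap_iff[where \<phi> = \<phi>, OF c _ this] show ?case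
          using reg[of k] elim by simp
      qed
    qed
  qed
qed

text \<open>Outer subgradients of the root in terms of \<open>\<phi>\<close> itself: \<open>s k\<close> is the value of the root at \<open>X k\<close>, and
  \<open>V k /\<^sub>R (2 * s k)\<close> the corresponding subgradient of the root.\<close>

lemma outer_subdiff_sqrt_gap_iff:
  fixes \<phi> :: "'a::real_inner \<Rightarrow> ereal"
  assumes c: "\<phi> xbar = ereal c"
  shows "u \<in> outer_subdiff (sqrt_gap \<phi> xbar) xbar \<longleftrightarrow>
    (\<exists>X V s. X \<longlonglongrightarrow> xbar \<and> s \<longlonglongrightarrow> 0 \<and> (\<lambda>k. V k /\<^sub>R (2 * s k)) \<longlonglongrightarrow> u \<and>
      (\<forall>k. s k > 0 \<and> \<phi> (X k) = ereal (c + (s k)\<^sup>2) \<and> V k \<in> limiting_subdiff \<phi> (X k)))" (is "?L \<longleftrightarrow> ?R")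
proof
  have g0: "sqrt_gap \<phi> xbar xbar = ereal 0" using sqrt_gap_base[where \<phi> = \<phi>, OF c] by (simp add: zero_ereal_def)
  show ?R if ?L
  proof -
    obtain X U where X: "X \<longlonglongrightarrow> xbar" "U \<longlonglongrightarrow> u" and lim: "(\<lambda>k. sqrt_gap \<phi> xbar (X k)) \<longlonglongrightarrow> ereal 0"
      and gt: "\<And>k. sqrt_gap \<phi> xbar (X k) > ereal 0"
      and sub: "\<And>k. U k \<in> limiting_subdiff (sqrt_gap \<phi> xbar) (X k)"
      using \<open>?L\<close> unfolding outer_subdiff_def g0 by auto
    define s where "s k = real_of_ereal (sqrt_gap \<phi> xbar (X k))" for k
    have S: "sqrt_gap \<phi> xbar (X k) = ereal (s k)" for k
      using limiting_subdiff_finite[OF sub[of k]] unfolding s_def by auto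
    have pos: "s k > 0" for k using gt[of k] unfolding S by simp
    have slim: "s \<longlonglongrightarrow> 0" using lim unfolding S by simp
    have phi: "\<phi> (X k) = ereal (c + (s k)\<^sup>2)" for k
      using sqrt_gap_eq_ereal_pos[where \<phi> = \<phi>, OF c pos] S by simp
    have "(2 * s k) *\<^sub>R U k \<in> limiting_subdiff \<phi> (X k)" for k
      using limiting_subdiff_sqrt_gap_iff[where \<phi> = \<phi>, OF c pos phi] sub by blast
    moreover have "(\<lambda>k. ((2 * s k) *\<^sub>R U k) /\<^sub>R (2 * s k)) = U" using pos by (auto simp: less_imp_neq[symmetric])
    ultimately show ?R using X slim pos phi
      by (intro exI[of _ X] exI[of _ "\<lambda>k. (2 * s k) *\<^sub>R U k"] exI[of _ s]) auto
  qed
  show ?L if ?R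
  proof -
    obtain X V s where X: "X \<longlonglongrightarrow> xbar" and slim: "s \<longlonglongrightarrow> 0" and V: "(\<lambda>k. V k /\<^sub>R (2 * s k)) \<longlonglongrightarrow> u"
      and pos: "\<And>k. s k > 0" and phi: "\<And>k. \<phi> (X k) = ereal (c + (s k)\<^sup>2)"
      and sub: "\<And>k. V k \<in> limiting_subdiff \<phi> (X k)" using \<open>?R\<close> by blast
    have g: "sqrt_gap \<phi> xbar (X k) = ereal (s k)" for k
      using sqrt_gap_eq_ereal_pos[where \<phi> = \<phi>, OF c pos] phi by blast
    have "V k /\<^sub>R (2 * s k) \<in> limiting_subdiff (sqrt_gap \<phi> xbar) (X k)" for k
      unfolding limiting_subdiff_sqrt_gap_iff[where \<phi> = \<phi>, OF c pos phi] using sub[of k] pos[of k] by simp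
    then show ?L unfolding outer_subdiff_def mem_Collect_eq g0 using X V slim pos
      by (intro conjI exI[of _ X] exI[of _ "\<lambda>k. V k /\<^sub>R (2 * s k)"])
        (auto simp: finite_at_def g0 g)
  qed
qed

lemma edist_zero_ge_iff: "ereal m \<le> edist 0 A \<longleftrightarrow> (\<forall>a\<in>A. m \<le> norm a)"
  by (simp add: edist_def le_INF_iff)

lemma edist_zero_nonneg: "0 \<le> edist 0 A"
  using edist_zero_ge_iff[of 0 A] by (simp add: zero_ereal_def)

text \<open>With \<open>s\<close> for the root of the gap, the power \<open>1/2\<close> and the threshold \<open>\<nu>\<close> disappear: the condition
  \<open>\<phi> x < \<phi> xbar + \<nu>\<close> becomes \<open>s < \<epsilon>\<close>, and \<open>\<mu> / (1 - 1/2)\<close> becomes \<open>2 * \<mu>\<close>.\<close>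

lemma kl_half_iff:
  assumes c: "\<phi> xbar = ereal c"
  shows "kl_with_modulus \<phi> xbar (1/2) \<mu> \<longleftrightarrow> locally_lsc_at \<phi> xbar \<and> \<mu> > 0 \<and>
     (\<exists>\<epsilon>>0. \<forall>x s v. norm (x - xbar) \<le> \<epsilon> \<and> 0 < s \<and> s < \<epsilon> \<and> \<phi> x = ereal (c + s\<^sup>2) \<and> v \<in> limiting_subdiff \<phi> x
         \<longrightarrow> 2 * \<mu> * s \<le> norm v)" (is "_ \<longleftrightarrow> _ \<and> _ \<and> ?R")
proof -
  have key: "ereal (\<mu> / (1 - 1/2) * real_of_ereal (\<phi> x - \<phi> xbar) powr (1/2)) \<le> edist 0 (limiting_subdiff \<phi> x)
     \<longleftrightarrow> (\<forall>v\<in>limiting_subdiff \<phi> x. 2 * \<mu> * s \<le> norm v)" if "\<phi> x = ereal (c + s\<^sup>2)" "s > 0" for x s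
  proof -
    have "real_of_ereal (\<phi> x - \<phi> xbar) powr (1/2) = s"
      using that c by (simp add: powr_half_sqrt)
    then show ?thesis unfolding edist_zero_ge_iff by (simp add: mult.commute[of \<mu> 2])
  qed
  have root: "\<exists>s>0. \<phi> x = ereal (c + s\<^sup>2)" if "\<phi> xbar < \<phi> x" "\<phi> x < \<infinity>" for x
  proof (cases "\<phi> x")
    case (real a)
    then have "sqrt (a - c) > 0" "a = c + (sqrt (a - c))\<^sup>2" using that c by auto
    then show ?thesis using real by (intro exI[of _ "sqrt (a - c)"]) simp
  qed (use that c in auto)
  show ?thesis
  proof
    assume "kl_with_modulus \<phi> xbar (1/2) \<mu>"
    then obtain e \<nu> where "locally_lsc_at \<phi> xbar" "\<mu> > 0" "e > 0" "(0::ereal) < \<nu>"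
      and H: "\<And>x. norm (x - xbar) \<le> e \<Longrightarrow> \<phi> xbar < \<phi> x \<Longrightarrow> \<phi> x < \<phi> xbar + \<nu> \<Longrightarrow>
        ereal (\<mu> / (1 - 1/2) * real_of_ereal (\<phi> x - \<phi> xbar) powr (1/2)) \<le> edist 0 (limiting_subdiff \<phi> x)"
      unfolding kl_with_modulus_def by blast
    have "\<exists>n>0. ereal n \<le> \<nu>"
    proof (cases \<nu>)
      case (real r) then show ?thesis using \<open>0 < \<nu>\<close> by (intro exI[of _ r]) simp
    next
      case PInf then show ?thesis by (intro exI[of _ 1]) simp
    next
      case MInf then show ?thesis using \<open>0 < \<nu>\<close> by simp
    qed
    then obtain n where n: "n > 0" "ereal n \<le> \<nu>" by blast
    define d where "d = min e (min 1 n)"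
    have "d > 0" using \<open>e > 0\<close> n by (simp add: d_def)
    moreover have "2 * \<mu> * s \<le> norm v"
      if x: "norm (x - xbar) \<le> d" "0 < s" "s < d" "\<phi> x = ereal (c + s\<^sup>2)" "v \<in> limiting_subdiff \<phi> x"
      for x s v
    proof -
      have "s\<^sup>2 < n"
      proof -
        have "s * s < 1 * n" by (rule mult_strict_mono) (use x n in \<open>auto simp: d_def\<close>)
        then show ?thesis by (simp add: power2_eq_square)
      qed
      then have "ereal (c + s\<^sup>2) < ereal (c + n)" by simp
      also have "\<dots> \<le> \<phi> xbar + \<nu>" using c add_left_mono[OF n(2), of "ereal c"] by simp
      finally have 1: "\<phi> x < \<phi> xbar + \<nu>" using x(4) by simp
      have 2: "\<phi> xbar < \<phi> x" using x c by simp
      have "norm (x - xbar) \<le> e" using x(1) by (simp add: d_def)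
      from H[OF this 2 1] show ?thesis using key[OF x(4,2)] x(5) by blast
    qed
    ultimately have ?R by blast
    then show "locally_lsc_at \<phi> xbar \<and> \<mu> > 0 \<and> ?R" using \<open>locally_lsc_at \<phi> xbar\<close> \<open>\<mu> > 0\<close> by blast
  next
    assume a: "locally_lsc_at \<phi> xbar \<and> \<mu> > 0 \<and> ?R"
    then obtain e where e: "e > 0" and H: "\<And>x s v. norm (x - xbar) \<le> e \<Longrightarrow> 0 < s \<Longrightarrow> s < e \<Longrightarrow>
        \<phi> x = ereal (c + s\<^sup>2) \<Longrightarrow> v \<in> limiting_subdiff \<phi> x \<Longrightarrow> 2 * \<mu> * s \<le> norm v" by blast
    show "kl_with_modulus \<phi> xbar (1/2) \<mu>" unfolding kl_with_modulus_def
    proof (intro conjI exI[of _ e] exI[of _ "ereal (e\<^sup>2)"] allI impI)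
      fix x assume x: "norm (x - xbar) \<le> e \<and> \<phi> xbar < \<phi> x \<and> \<phi> x < \<phi> xbar + ereal (e\<^sup>2)"
      then have "\<phi> x < \<infinity>" using c by auto
      with x root obtain s where s: "s > 0" "\<phi> x = ereal (c + s\<^sup>2)" by blast
      then have "s\<^sup>2 < e\<^sup>2" using x c by simp
      then have "s < e" using e by (meson less_eq_real_def power_less_imp_less_base)
      then show "ereal (\<mu> / (1 - 1/2) * real_of_ereal (\<phi> x - \<phi> xbar) powr (1/2)) \<le> edist 0 (limiting_subdiff \<phi> x)"
        using key[OF s(2,1)] H x s by blast
    qed (use a c e in \<open>auto simp: finite_at_def\<close>)
  qed
qed

text \<open>A modulus \<open>\<mu>\<close> bounds the norms of all subgradients of the root near \<open>xbar\<close> from below, hence also those of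
  their limits. Conversely, if \<open>\<mu>\<close> is no modulus, there are subgradients of the root of norm less than
  \<open>\<mu>\<close> at points tending to \<open>xbar\<close>, and in finite dimension they accumulate at an outer subgradient.\<close>

lemma KL_half_eq_edist_outer_subdiff:
  fixes \<phi> :: "'a::euclidean_space \<Rightarrow> ereal"
  assumes c: "\<phi> xbar = ereal c" and lsc: "locally_lsc_at \<phi> xbar"
  shows "KL \<phi> xbar (1/2) = edist 0 (outer_subdiff (sqrt_gap \<phi> xbar) xbar)" (is "_ = edist 0 ?A")
proof (rule antisym)
  show "KL \<phi> xbar (1/2) \<le> edist 0 ?A" unfolding KL_def
  proof (rule Sup_least)
    fix m assume "m \<in> insert 0 (ereal ` {\<mu>. kl_with_modulus \<phi> xbar (1/2) \<mu>})"
    then consider "m = 0" | \<mu> where "m = ereal \<mu>" "kl_with_modulus \<phi> xbar (1/2) \<mu>" by blast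
    then show "m \<le> edist 0 ?A"
    proof cases
      case 2
      then obtain e where e: "e > 0" and H: "\<And>x s v. norm (x - xbar) \<le> e \<Longrightarrow> 0 < s \<Longrightarrow> s < e \<Longrightarrow>
          \<phi> x = ereal (c + s\<^sup>2) \<Longrightarrow> v \<in> limiting_subdiff \<phi> x \<Longrightarrow> 2 * \<mu> * s \<le> norm v"
        unfolding kl_half_iff[where \<phi> = \<phi>, OF c] by blast
      have "\<mu> \<le> norm u" if "u \<in> ?A" for u
      proof -
        obtain X V s where X: "X \<longlonglongrightarrow> xbar" and slim: "s \<longlonglongrightarrow> 0" and V: "(\<lambda>k. V k /\<^sub>R (2 * s k)) \<longlonglongrightarrow> u"
          and pos: "\<And>k. s k > 0" and phi: "\<And>k. \<phi> (X k) = ereal (c + (s k)\<^sup>2)"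
          and sub: "\<And>k. V k \<in> limiting_subdiff \<phi> (X k)"
          using \<open>u \<in> ?A\<close> unfolding outer_subdiff_sqrt_gap_iff[where \<phi> = \<phi>, OF c] by blast
        have "\<forall>\<^sub>F k in sequentially. dist (X k) xbar < e" using tendstoD[OF X e] .
        moreover have "\<forall>\<^sub>F k in sequentially. s k < e" using order_tendstoD(2)[OF slim e] .
        ultimately have "\<forall>\<^sub>F k in sequentially. \<mu> \<le> norm (V k /\<^sub>R (2 * s k))"
        proof eventually_elim
          case (elim k)
          then have "2 * \<mu> * s k \<le> norm (V k)"
            by (intro H[OF _ pos _ phi sub]) (auto simp: dist_norm)
          then show ?case using pos[of k] by (simp add: field_simps)
        qed
        then show ?thesis by (rule tendsto_lowerbound[OF tendsto_norm[OF V]]) simp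
      qed
      then show ?thesis using 2 edist_zero_ge_iff by blast
    qed (simp add: edist_zero_nonneg)
  qed
  show "edist 0 ?A \<le> KL \<phi> xbar (1/2)"
  proof (rule dense_le)
    fix m assume m: "m < edist 0 ?A"
    show "m \<le> KL \<phi> xbar (1/2)"
    proof (cases "m \<le> 0")
      case True
      also have "0 \<le> KL \<phi> xbar (1/2)" unfolding KL_def by (rule Sup_upper) simp
      finally show ?thesis .
    next
      case False
      then obtain \<mu> where \<mu>: "m = ereal \<mu>" "\<mu> > 0" using m by (cases m) auto
      have "kl_with_modulus \<phi> xbar (1/2) \<mu>"
      proof (rule ccontr)
        assume "\<not> ?thesis"
        then have neg: "\<not> (\<exists>e>0. \<forall>x s v. norm (x - xbar) \<le> e \<and> 0 < s \<and> s < e \<and> \<phi> x = ereal (c + s\<^sup>2)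
            \<and> v \<in> limiting_subdiff \<phi> x \<longrightarrow> 2 * \<mu> * s \<le> norm v)"
          unfolding kl_half_iff[where \<phi> = \<phi>, OF c] using lsc \<mu>(2) by blast
        have ex: "\<exists>x s. norm (x - xbar) < e \<and> 0 < s \<and> s < e \<and> (\<exists>v. \<phi> x = ereal (c + s\<^sup>2)
            \<and> v \<in> limiting_subdiff \<phi> x \<and> norm v < 2 * \<mu> * s)" if "e > 0" for e
        proof -
          obtain x s v where "norm (x - xbar) \<le> e / 2" "0 < s" "s < e / 2" "\<phi> x = ereal (c + s\<^sup>2)"
            "v \<in> limiting_subdiff \<phi> x" "\<not> 2 * \<mu> * s \<le> norm v"
            using neg half_gt_zero[OF \<open>e > 0\<close>] by blast
          then show ?thesis using \<open>e > 0\<close> by (intro exI[of _ x] exI[of _ s]) auto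
        qed
        obtain X s where Xs: "\<And>k. norm (X k - xbar) < inverse (real (Suc k)) \<and> 0 < s k \<and> s k < inverse (real (Suc k)) \<and>
            (\<exists>v. \<phi> (X k) = ereal (c + (s k)\<^sup>2) \<and> v \<in> limiting_subdiff \<phi> (X k) \<and> norm v < 2 * \<mu> * s k)"
          using null_seq_choice[of "\<lambda>e x s. norm (x - xbar) < e \<and> 0 < s \<and> s < e \<and> (\<exists>v. \<phi> x = ereal (c + s\<^sup>2)
            \<and> v \<in> limiting_subdiff \<phi> x \<and> norm v < 2 * \<mu> * s)", OF ex] by blast
        then obtain V where XsV: "\<And>k. 0 < s k \<and> \<phi> (X k) = ereal (c + (s k)\<^sup>2) \<and> V k \<in> limiting_subdiff \<phi> (X k)
            \<and> norm (V k) < 2 * \<mu> * s k" by metis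
        have X: "X \<longlonglongrightarrow> xbar" by (rule tendsto_of_inverse_Suc) (use Xs in blast)
        have slim: "s \<longlonglongrightarrow> 0" by (rule tendsto_of_inverse_Suc) (use Xs in \<open>simp add: abs_of_pos\<close>)
        let ?U = "\<lambda>k. V k /\<^sub>R (2 * s k)"
        have U: "?U k \<in> cball 0 \<mu>" for k
          using XsV[of k] by (simp add: field_simps less_imp_le)
        then obtain u r where u: "norm u \<le> \<mu>" "strict_mono (r::nat\<Rightarrow>nat)" "(?U \<circ> r) \<longlonglongrightarrow> u"
          using bounded_subseq[of ?U \<mu>] by (auto simp: dist_norm)
        have "u \<in> ?A" unfolding outer_subdiff_sqrt_gap_iff[where \<phi> = \<phi>, OF c]
          using XsV u(3) LIMSEQ_subseq_LIMSEQ[OF X u(2)] LIMSEQ_subseq_LIMSEQ[OF slim u(2)]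
          by (intro exI[of _ "X \<circ> r"] exI[of _ "V \<circ> r"] exI[of _ "s \<circ> r"]) (auto simp: o_def)
        then have "edist 0 ?A \<le> ereal (norm u)" unfolding edist_def by (intro INF_lower2) auto
        also have "\<dots> \<le> m" using u(1) \<mu>(1) by simp
        finally show False using m by simp
      qed
      then show ?thesis unfolding KL_def \<mu>(1) by (intro Sup_upper) simp
    qed
  qed
qed

section \<open>Lower semicontinuity and minimisation of quadratic perturbations\<close>

text \<open>Sequential lower semicontinuity on \<open>K\<close> of the part of \<open>\<phi>\<close> below the level \<open>M\<close>. A locally closed
  epigraph at \<open>(x, \<phi> x)\<close> says nothing about \<open>\<phi>\<close> at points where its values stay well above \<open>\<phi> x\<close>,
  so the level cannot be left out; for a globally lower semicontinuous function it is \<open>\<infinity>\<close>.\<close>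

definition lsc_upto :: "('a::metric_space \<Rightarrow> ereal) \<Rightarrow> 'a set \<Rightarrow> ereal \<Rightarrow> bool" where
  "lsc_upto \<phi> K M \<longleftrightarrow> (\<forall>X a x b. (\<forall>k. X k \<in> K \<and> \<phi> (X k) \<le> ereal (a k)) \<and>
      X \<longlonglongrightarrow> x \<and> a \<longlonglongrightarrow> b \<and> ereal b < M \<longrightarrow> \<phi> x \<le> ereal b)"

lemma lsc_uptoD:
  assumes "lsc_upto \<phi> K M" "\<And>k. X k \<in> K" "\<And>k. \<phi> (X k) \<le> ereal (a k)" "X \<longlonglongrightarrow> x" "a \<longlonglongrightarrow> b" "ereal b < M"
  shows "\<phi> x \<le> ereal b"
  using assms unfolding lsc_upto_def by blast

lemma lsc_upto_mono: "lsc_upto \<phi> K M \<Longrightarrow> K' \<subseteq> K \<Longrightarrow> M' \<le> M \<Longrightarrow> lsc_upto \<phi> K' M'"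
  unfolding lsc_upto_def by (meson less_le_trans subsetD)

lemma lsc_imp_lsc_upto:
  assumes "lsc \<phi>" shows "lsc_upto \<phi> K M"
  unfolding lsc_upto_def
proof (intro allI impI, elim conjE)
  fix X a x b assume *: "\<forall>k. X k \<in> K \<and> \<phi> (X k) \<le> ereal (a k)" "X \<longlonglongrightarrow> x" "a \<longlonglongrightarrow> b" "ereal b < M"
  show "\<phi> x \<le> ereal b"
  proof (rule ccontr)
    assume "\<not> ?thesis"
    then obtain c where c: "ereal b < ereal c" "ereal c < \<phi> x" using ereal_dense2[of "ereal b" "\<phi> x"] by (metis not_le)
    then have "ereal c < Liminf (at x) \<phi>" using assms unfolding lsc_def by (meson less_le_trans)
    then have "\<forall>\<^sub>F y in at x. ereal c < \<phi> y" by (rule less_LiminfD)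
    then have "\<forall>\<^sub>F y in nhds x. ereal c < \<phi> y" using c(2) by (auto simp: eventually_at_filter elim: eventually_mono)
    then have "\<forall>\<^sub>F k in sequentially. ereal c < \<phi> (X k)" by (rule eventually_compose_filterlim[OF _ *(2)])
    moreover have "\<forall>\<^sub>F k in sequentially. a k < c" using order_tendstoD(2)[OF *(3), of c] c(1) by simp
    ultimately have "\<forall>\<^sub>F k in sequentially. False"
    proof eventually_elim
      case (elim k)
      then have "ereal c < ereal (a k)" using *(1) by (meson less_le_trans)
      then show ?case using elim by simp
    qed
    then show False by simp
  qed
qed

text \<open>The lower bound keeps the points of the epigraph that approximate a limit point inside the neighbourhood
  of \<open>(x, c)\<close> in which the epigraph is closed.\<close>

lemma locally_lsc_at_imp_lsc_upto:
  fixes \<phi> :: "'a::euclidean_space \<Rightarrow> ereal"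
  assumes c: "\<phi> x = ereal c" and "locally_lsc_at \<phi> x"
    and low: "\<And>\<eta>. \<eta> > 0 \<Longrightarrow> \<forall>\<^sub>F y in nhds x. ereal (c - \<eta>) \<le> \<phi> y"
  shows "\<exists>r>0. lsc_upto \<phi> (cball x r) (ereal (c + r))"
proof -
  obtain V where V: "(x, c) \<in> interior V" "closed (epi \<phi> \<inter> V)"
    using assms(2) c unfolding locally_lsc_at_def locally_closed_at_def by auto
  obtain d where d: "d > 0" "ball (x, c) d \<subseteq> V" using V(1) by (auto simp: mem_interior)
  have "\<forall>\<^sub>F y in nhds x. ereal (c - d/3) \<le> \<phi> y" using low d(1) by simp
  then obtain e where e: "e > 0" "\<And>y. dist y x < e \<Longrightarrow> ereal (c - d/3) \<le> \<phi> y"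
    unfolding eventually_nhds_metric by blast
  define r where "r = min (e/2) (d/3)"
  have r: "r > 0" "r < e" "r \<le> d/3" using e d by (auto simp: r_def)
  have "lsc_upto \<phi> (cball x r) (ereal (c + r))" unfolding lsc_upto_def
  proof (intro allI impI, elim conjE)
    fix X a y b assume *: "\<forall>k. X k \<in> cball x r \<and> \<phi> (X k) \<le> ereal (a k)" "X \<longlonglongrightarrow> y" "a \<longlonglongrightarrow> b" "ereal b < ereal (c + r)"
    have ak: "a k \<ge> c - d/3" for k
    proof -
      have "dist (X k) x < e" using *(1)[rule_format, of k] r by (auto simp: dist_commute)
      then have "ereal (c - d/3) \<le> ereal (a k)" using e(2) *(1) by (meson order_trans)
      then show ?thesis by simp
    qed
    have "\<forall>\<^sub>F k in sequentially. a k < c + r" using order_tendstoD(2)[OF *(3)] *(4) by simp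
    then have "\<forall>\<^sub>F k in sequentially. (X k, a k) \<in> epi \<phi> \<inter> V"
    proof eventually_elim
      case (elim k)
      have "dist (x, c) (X k, a k) \<le> dist x (X k) + dist c (a k)"
        unfolding dist_Pair_Pair by (rule sqrt_sum_squares_le_sum) auto
      also have "\<dots> \<le> r + d/3" using *(1)[rule_format, of k] ak[of k] elim r(3) by (auto simp: dist_real_def)
      also have "\<dots> < d" using r(3) d(1) by simp
      finally show ?case using d(2) *(1) by (auto simp: epi_def)
    qed
    moreover have "(\<lambda>k. (X k, a k)) \<longlonglongrightarrow> (y, b)" using *(2,3) by (rule tendsto_Pair)
    ultimately have "(y, b) \<in> epi \<phi> \<inter> V" by (intro Lim_in_closed_set[OF V(2)]) auto
    then show "\<phi> y \<le> ereal b" by (simp add: epi_def)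
  qed
  with r(1) show ?thesis by blast
qed

lemma lsc_upto_of_quadratic_lower_bound:
  fixes f :: "'a::euclidean_space \<Rightarrow> ereal"
  assumes c: "f xbar = ereal c" and lsc: "locally_lsc_at f xbar" and eps: "\<epsilon> > 0"
    and growth: "\<And>y. y \<in> cball xbar \<epsilon> \<Longrightarrow> ereal (c - \<rho> / 2 * (norm (y - xbar))\<^sup>2) \<le> f y"
  shows "\<exists>r>0. r \<le> \<epsilon> \<and> lsc_upto f (cball xbar r) (ereal (c + r))"
proof -
  have "\<forall>\<^sub>F y in nhds xbar. ereal (c - \<eta>) \<le> f y" if "\<eta> > 0" for \<eta>
  proof -
    have "((\<lambda>y. \<rho> / 2 * (norm (y - xbar))\<^sup>2) \<longlongrightarrow> \<rho> / 2 * (norm (xbar - xbar))\<^sup>2) (nhds xbar)"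
      by (intro tendsto_intros filterlim_ident)
    then have 1: "\<forall>\<^sub>F y in nhds xbar. \<rho> / 2 * (norm (y - xbar))\<^sup>2 < \<eta>" by (rule order_tendstoD) (use that in simp)
    have 2: "\<forall>\<^sub>F y in nhds xbar. y \<in> cball xbar \<epsilon>"
      unfolding eventually_nhds_metric using eps by (intro exI[of _ \<epsilon>]) (auto simp: dist_commute)
    show ?thesis using 1 2
    proof eventually_elim
      case (elim y)
      have "ereal (c - \<eta>) \<le> ereal (c - \<rho> / 2 * (norm (y - xbar))\<^sup>2)" using elim(1) by simp
      also have "\<dots> \<le> f y" by (rule growth) (rule elim(2))
      finally show ?case .
    qed
  qed
  from locally_lsc_at_imp_lsc_upto[where \<phi> = f, OF c lsc this]
  obtain r where r: "r > 0" "lsc_upto f (cball xbar r) (ereal (c + r))" by blast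
  have "lsc_upto f (cball xbar (min r \<epsilon>)) (ereal (c + min r \<epsilon>))"
    by (rule lsc_upto_mono[OF r(2)]) auto
  then show ?thesis using r(1) eps by (intro exI[of _ "min r \<epsilon>"]) auto
qed

lemma lsc_upto_imp_locally_lsc_at:
  fixes \<phi> :: "'a::euclidean_space \<Rightarrow> ereal"
  assumes c: "\<phi> x = ereal c" and "r > 0" and lsc: "lsc_upto \<phi> (cball x r) (ereal (c + r))"
  shows "locally_lsc_at \<phi> x"
  unfolding locally_lsc_at_def locally_closed_at_def c
proof (intro exI conjI)
  let ?V = "cball x r \<times> cball c (r/2)"
  show "closed ?V" by (intro closed_Times) auto
  show "(x, real_of_ereal (ereal c)) \<in> interior ?V" using \<open>r > 0\<close> by (simp add: interior_Times)
  show "closed (epi \<phi> \<inter> ?V)" unfolding closed_sequential_limits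
  proof (intro allI impI, elim conjE)
    fix P l assume P: "\<forall>n. P n \<in> epi \<phi> \<inter> ?V" "P \<longlonglongrightarrow> l"
    obtain y b where l: "l = (y, b)" by (cases l)
    have lim: "(\<lambda>n. fst (P n)) \<longlonglongrightarrow> y" "(\<lambda>n. snd (P n)) \<longlonglongrightarrow> b"
      using tendsto_fst[OF P(2)] tendsto_snd[OF P(2)] l by auto
    have "closed ?V" by (intro closed_Times) auto
    then have lV: "(y, b) \<in> ?V" using P l closed_sequentially[of ?V P] by auto
    have "\<phi> y \<le> ereal b"
    proof (rule lsc_uptoD[OF lsc _ _ lim])
      fix k
      show "fst (P k) \<in> cball x r" using P(1)[rule_format, of k] by (auto simp: mem_Times_iff)
      show "\<phi> (fst (P k)) \<le> ereal (snd (P k))" using P(1)[rule_format, of k] by (auto simp: epi_def)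
      have "\<bar>c - b\<bar> \<le> r/2" using lV by (simp add: dist_real_def)
      then have "b < c + r" using \<open>r > 0\<close> by linarith
      then show "ereal b < ereal (c + r)" by simp
    qed
    then show "l \<in> epi \<phi> \<inter> ?V" using lV l by (simp add: epi_def)
  qed
qed

text \<open>The direct method. A minimising sequence has a cluster point in the compact ball, and the values of
  \<open>\<phi>\<close> along it converge to the infimum minus the penalty there. The condition on \<open>M\<close> ensures that this
  limit stays below the level up to which \<open>\<phi>\<close> is lower semicontinuous, since \<open>norm z * r\<close> bounds the
  linear term on the ball.\<close>

lemma quadratic_minimizer_exists:
  fixes \<phi> :: "'a::euclidean_space \<Rightarrow> ereal"
  assumes lsc: "lsc_upto \<phi> (cball p r) M"
    and low: "\<And>y. y \<in> cball p r \<Longrightarrow> ereal m \<le> \<phi> y"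
    and x0: "x0 \<in> cball p r" "\<phi> x0 \<le> ereal b0"
    and M: "ereal (b0 - z \<bullet> (x0 - p) + a * (norm (x0 - p))\<^sup>2 + norm z * r) < M" and "a \<ge> 0"
  shows "\<exists>y b. y \<in> cball p r \<and> \<phi> y = ereal b \<and> (\<forall>y' b'. y' \<in> cball p r \<and> \<phi> y' \<le> ereal b' \<longrightarrow>
    b - z \<bullet> (y - p) + a * (norm (y - p))\<^sup>2 \<le> b' - z \<bullet> (y' - p) + a * (norm (y' - p))\<^sup>2)"
proof -
  define val where "val y b = b - z \<bullet> (y - p) + a * (norm (y - p))\<^sup>2" for y b
  have zr: "z \<bullet> (y - p) \<le> norm z * r" if "y \<in> cball p r" for y
  proof -
    have "z \<bullet> (y - p) \<le> norm z * norm (y - p)" by (rule norm_cauchy_schwarz)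
    also have "\<dots> \<le> norm z * r" using that by (intro mult_left_mono) (auto simp: dist_norm norm_minus_commute)
    finally show ?thesis .
  qed
  define S where "S = {val y b | y b. y \<in> cball p r \<and> \<phi> y \<le> ereal b}"
  have S0: "val x0 b0 \<in> S" using x0 by (auto simp: S_def)
  have bdd: "bdd_below S"
  proof (rule bdd_belowI[of _ "m - norm z * r"])
    fix s assume "s \<in> S"
    then obtain y b where y: "s = val y b" "y \<in> cball p r" "\<phi> y \<le> ereal b" by (auto simp: S_def)
    have "ereal m \<le> ereal b" using low[OF y(2)] y(3) by (rule order_trans)
    moreover have "a * (norm (y - p))\<^sup>2 \<ge> 0" using \<open>a \<ge> 0\<close> by simp
    ultimately show "m - norm z * r \<le> s" using zr[OF y(2)] y(1) by (simp add: val_def)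
  qed
  define I where "I = Inf S"
  have I: "I \<le> s" if "s \<in> S" for s unfolding I_def using that bdd by (rule cInf_lower)
  have "\<exists>y b. y \<in> cball p r \<and> \<phi> y \<le> ereal b \<and> val y b < I + inverse (real (Suc k))" for k
  proof -
    have "Inf S < I + inverse (real (Suc k))" by (simp add: I_def del: of_nat_Suc)
    then obtain s where "s \<in> S" "s < I + inverse (real (Suc k))" using cInf_lessD[of S] S0 by blast
    then show ?thesis by (auto simp: S_def)
  qed
  then obtain Y B where Y: "\<And>k. Y k \<in> cball p r" and B: "\<And>k. \<phi> (Y k) \<le> ereal (B k)"
    and v: "\<And>k. val (Y k) (B k) < I + inverse (real (Suc k))" by metis
  have "\<forall>k. Y k \<in> cball p r" using Y by blast
  from seq_compactE[OF compact_imp_seq_compact[OF compact_cball] this]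
  obtain y \<sigma> where y: "y \<in> cball p r" and \<sigma>: "strict_mono \<sigma>" and Ylim: "(Y \<circ> \<sigma>) \<longlonglongrightarrow> y" .
  have "(\<lambda>k. val (Y k) (B k)) \<longlonglongrightarrow> I"
  proof (rule tendsto_sandwich)
    show "\<forall>\<^sub>F k in sequentially. I \<le> val (Y k) (B k)" using Y B by (intro always_eventually allI I) (auto simp: S_def)
    show "\<forall>\<^sub>F k in sequentially. val (Y k) (B k) \<le> I + inverse (real (Suc k))"
      using v by (auto intro!: always_eventually less_imp_le simp del: of_nat_Suc)
    show "(\<lambda>k. I + inverse (real (Suc k))) \<longlonglongrightarrow> I"
      using tendsto_add[OF tendsto_const[of I] LIMSEQ_inverse_real_of_nat] by simp
  qed simp
  from LIMSEQ_subseq_LIMSEQ[OF this \<sigma>] have vlim: "(\<lambda>k. val (Y (\<sigma> k)) (B (\<sigma> k))) \<longlonglongrightarrow> I" by (simp add: o_def)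
  have Yl: "(\<lambda>k. Y (\<sigma> k)) \<longlonglongrightarrow> y" using Ylim by (simp add: o_def)
  let ?b = "I + z \<bullet> (y - p) - a * (norm (y - p))\<^sup>2"
  have "(\<lambda>k. val (Y (\<sigma> k)) (B (\<sigma> k)) + z \<bullet> (Y (\<sigma> k) - p) - a * (norm (Y (\<sigma> k) - p))\<^sup>2) \<longlonglongrightarrow> ?b"
    by (intro tendsto_intros vlim Yl)
  then have Blim: "(\<lambda>k. B (\<sigma> k)) \<longlonglongrightarrow> ?b" by (simp add: val_def)
  have "?b \<le> val x0 b0 + norm z * r"
    using I[OF S0] zr[OF y] \<open>a \<ge> 0\<close> by (simp add: add_mono le_diff_eq add_increasing2 diff_le_eq)
  then have "ereal ?b < M" using M unfolding val_def by (meson ereal_less_eq(3) le_less_trans)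
  then have phi: "\<phi> y \<le> ereal ?b" using lsc_uptoD[OF lsc, of "\<lambda>k. Y (\<sigma> k)" "\<lambda>k. B (\<sigma> k)" y ?b] Y B Yl Blim by blast
  then obtain b where b: "\<phi> y = ereal b" using low[OF y] by (cases "\<phi> y") auto
  have "val y b \<le> val y ?b" using phi b by (simp add: val_def)
  also have "\<dots> = I" by (simp add: val_def)
  finally have "val y b \<le> I" .
  then have "val y b \<le> val y' b'" if "y' \<in> cball p r" "\<phi> y' \<le> ereal b'" for y' b'
    using I[of "val y' b'"] that by (force simp: S_def)
  then show ?thesis using y b unfolding val_def by blast
qed

text \<open>Expanding the penalty at the minimiser turns minimality into the inequality of a proximal subgradient.\<close>

lemma quadratic_minimizer_ineq:
  fixes \<phi> :: "'a::real_inner \<Rightarrow> ereal"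
  assumes min: "\<And>b'. \<phi> y' \<le> ereal b' \<Longrightarrow>
     b - z \<bullet> (y - p) + a * (norm (y - p))\<^sup>2 \<le> b' - z \<bullet> (y' - p) + a * (norm (y' - p))\<^sup>2"
  shows "ereal (b + (z - (2 * a) *\<^sub>R (y - p)) \<bullet> (y' - y) - a * (norm (y' - y))\<^sup>2) \<le> \<phi> y'"
proof (rule ereal_le_real)
  fix b' assume "\<phi> y' \<le> ereal b'"
  from min[OF this] show "ereal (b + (z - (2 * a) *\<^sub>R (y - p)) \<bullet> (y' - y) - a * (norm (y' - y))\<^sup>2) \<le> ereal b'"
    by (simp add: power2_norm_eq_inner algebra_simps inner_commute)
qed

text \<open>The source of all subgradients constructed below: minimise the second-order quotient of \<open>f\<close> at scale \<open>t\<close>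
  with a quadratic penalty centred at \<open>w\<close>. Undoing the scaling turns a minimiser in the inner half of the
  ball into a subgradient of \<open>f\<close> of order \<open>t\<close>.\<close>

lemma scaled_quadratic_minimizer:
  fixes f :: "'a::euclidean_space \<Rightarrow> ereal"
  assumes lsc: "lsc_upto f K M" and t: "t > 0" and "r > 0" "\<alpha> \<ge> 0"
    and K: "\<And>u. norm (u - w) \<le> r \<Longrightarrow> xbar + t *\<^sub>R u \<in> K" and low: "\<And>u. norm (u - w) \<le> r \<Longrightarrow> ereal m \<le> f (xbar + t *\<^sub>R u)"
    and u0: "norm (u0 - w) \<le> r" "f (xbar + t *\<^sub>R u0) \<le> ereal (c + t\<^sup>2 * b0)"
    and M: "ereal (c + t\<^sup>2 * (b0 - z \<bullet> (u0 - w) + \<alpha> * (norm (u0 - w))\<^sup>2 + norm z * r)) < M"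
  shows "\<exists>u b. norm (u - w) \<le> r \<and> f (xbar + t *\<^sub>R u) = ereal (c + t\<^sup>2 * b) \<and>
    (\<forall>u' b'. norm (u' - w) \<le> r \<and> f (xbar + t *\<^sub>R u') \<le> ereal (c + t\<^sup>2 * b') \<longrightarrow>
      b - z \<bullet> (u - w) + \<alpha> * (norm (u - w))\<^sup>2 \<le> b' - z \<bullet> (u' - w) + \<alpha> * (norm (u' - w))\<^sup>2) \<and>
    (norm (u - w) \<le> r / 2 \<longrightarrow> t *\<^sub>R (z - (2 * \<alpha>) *\<^sub>R (u - w)) \<in> limiting_subdiff f (xbar + t *\<^sub>R u))"
proof -
  let ?f = "\<lambda>u. f (xbar + t *\<^sub>R u)"
  have mem: "u \<in> cball w r \<longleftrightarrow> norm (u - w) \<le> r" for u by (simp add: dist_norm norm_minus_commute)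
  have lsc': "lsc_upto ?f (cball w r) M" unfolding lsc_upto_def
  proof (intro allI impI, elim conjE)
    fix X A x b assume *: "\<forall>k. X k \<in> cball w r \<and> ?f (X k) \<le> ereal (A k)" "X \<longlonglongrightarrow> x" "A \<longlonglongrightarrow> b" "ereal b < M"
    have lim: "(\<lambda>k. xbar + t *\<^sub>R X k) \<longlonglongrightarrow> xbar + t *\<^sub>R x" by (intro tendsto_intros *(2))
    show "?f x \<le> ereal b"
    proof (rule lsc_uptoD[OF lsc _ _ lim *(3,4)])
      show "xbar + t *\<^sub>R X k \<in> K" for k by (rule K) (use *(1) mem in blast)
      show "?f (X k) \<le> ereal (A k)" for k using *(1) by blast
    qed
  qed
  have "\<exists>u b. u \<in> cball w r \<and> ?f u = ereal b \<and> (\<forall>u' b'. u' \<in> cball w r \<and> ?f u' \<le> ereal b' \<longrightarrow>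
     b - (t\<^sup>2 *\<^sub>R z) \<bullet> (u - w) + (t\<^sup>2 * \<alpha>) * (norm (u - w))\<^sup>2 \<le> b' - (t\<^sup>2 *\<^sub>R z) \<bullet> (u' - w) + (t\<^sup>2 * \<alpha>) * (norm (u' - w))\<^sup>2)"
  proof (rule quadratic_minimizer_exists[OF lsc', of m u0])
    have "c + t\<^sup>2 * b0 - (t\<^sup>2 *\<^sub>R z) \<bullet> (u0 - w) + t\<^sup>2 * \<alpha> * (norm (u0 - w))\<^sup>2 + norm (t\<^sup>2 *\<^sub>R z) * r
       = c + t\<^sup>2 * (b0 - z \<bullet> (u0 - w) + \<alpha> * (norm (u0 - w))\<^sup>2 + norm z * r)" by (simp add: algebra_simps)
    then show "ereal (c + t\<^sup>2 * b0 - (t\<^sup>2 *\<^sub>R z) \<bullet> (u0 - w) + t\<^sup>2 * \<alpha> * (norm (u0 - w))\<^sup>2 + norm (t\<^sup>2 *\<^sub>R z) * r) < M"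
      using M by (simp only:)
  qed (use u0 low mem \<open>\<alpha> \<ge> 0\<close> in auto)
  then obtain u b1 where u: "norm (u - w) \<le> r" "?f u = ereal b1"
    and min: "\<And>u' b'. norm (u' - w) \<le> r \<Longrightarrow> ?f u' \<le> ereal b' \<Longrightarrow>
     b1 - (t\<^sup>2 *\<^sub>R z) \<bullet> (u - w) + (t\<^sup>2 * \<alpha>) * (norm (u - w))\<^sup>2 \<le> b' - (t\<^sup>2 *\<^sub>R z) \<bullet> (u' - w) + (t\<^sup>2 * \<alpha>) * (norm (u' - w))\<^sup>2"
    unfolding mem by blast
  define b where "b = (b1 - c) / t\<^sup>2"
  have b: "b1 = c + t\<^sup>2 * b" using t by (simp add: b_def)
  have "b - z \<bullet> (u - w) + \<alpha> * (norm (u - w))\<^sup>2 \<le> b' - z \<bullet> (u' - w) + \<alpha> * (norm (u' - w))\<^sup>2"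
    if "norm (u' - w) \<le> r" "?f u' \<le> ereal (c + t\<^sup>2 * b')" for u' b'
  proof -
    have "t\<^sup>2 * (b - z \<bullet> (u - w) + \<alpha> * (norm (u - w))\<^sup>2) \<le> t\<^sup>2 * (b' - z \<bullet> (u' - w) + \<alpha> * (norm (u' - w))\<^sup>2)"
      using min[OF that] by (simp add: b algebra_simps)
    then show ?thesis using t by (simp only: mult_le_cancel_left_pos zero_less_power)
  qed
  moreover have "t *\<^sub>R (z - (2 * \<alpha>) *\<^sub>R (u - w)) \<in> limiting_subdiff f (xbar + t *\<^sub>R u)" if near: "norm (u - w) \<le> r / 2"
  proof -
    have "t *\<^sub>R (z - (2 * \<alpha>) *\<^sub>R (u - w)) \<in> regular_subdiff f (xbar + t *\<^sub>R u)"
    proof (rule proximal_subgradient[where \<phi> = f, OF u(2)])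
      show "t * (r / 2) > 0" using t \<open>r > 0\<close> by simp
      fix y assume y: "norm (y - (xbar + t *\<^sub>R u)) < t * (r / 2)"
      define u' where "u' = (y - xbar) /\<^sub>R t"
      have yu: "y = xbar + t *\<^sub>R u'" using t by (simp add: u'_def)
      have d: "xbar + t *\<^sub>R u' - (xbar + t *\<^sub>R u) = t *\<^sub>R (u' - u)" by (simp add: algebra_simps)
      have "norm (u' - u) < r / 2" using y t unfolding yu d by simp
      then have "norm (u' - w) \<le> r" using near norm_triangle_ineq[of "u' - u" "u - w"] by simp
      then have "ereal (b1 + (t\<^sup>2 *\<^sub>R z - (2 * (t\<^sup>2 * \<alpha>)) *\<^sub>R (u - w)) \<bullet> (u' - u) - (t\<^sup>2 * \<alpha>) * (norm (u' - u))\<^sup>2) \<le> ?f u'"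
        by (intro quadratic_minimizer_ineq[of ?f] min)
      moreover have "b1 + (t\<^sup>2 *\<^sub>R z - (2 * (t\<^sup>2 * \<alpha>)) *\<^sub>R (u - w)) \<bullet> (u' - u) - (t\<^sup>2 * \<alpha>) * (norm (u' - u))\<^sup>2
         = b1 + (t *\<^sub>R (z - (2 * \<alpha>) *\<^sub>R (u - w))) \<bullet> (t *\<^sub>R (u' - u)) - \<alpha> * (norm (t *\<^sub>R (u' - u)))\<^sup>2"
        by (simp add: power_mult_distrib) (simp add: power2_eq_square algebra_simps)
      ultimately show "ereal (b1 + (t *\<^sub>R (z - (2 * \<alpha>) *\<^sub>R (u - w))) \<bullet> (y - (xbar + t *\<^sub>R u))
          - \<alpha> * (norm (y - (xbar + t *\<^sub>R u)))\<^sup>2) \<le> f y" unfolding yu d by simp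
    qed
    then show ?thesis using regular_subdiff_subset_limiting by blast
  qed
  ultimately show ?thesis using u unfolding b by blast
qed

section \<open>Graphical derivatives and metric subregularity\<close>

lemma graphical_deriv_seq:
  "z \<in> graphical_deriv S x u w \<longleftrightarrow> (\<exists>t W Z. (\<forall>k. t k > 0) \<and> t \<longlonglongrightarrow> (0::real) \<and> W \<longlonglongrightarrow> w \<and> Z \<longlonglongrightarrow> z \<and>
     (\<forall>k. u + t k *\<^sub>R Z k \<in> S (x + t k *\<^sub>R W k)))" (is "?L \<longleftrightarrow> ?R")
proof
  assume ?L
  then obtain t P where t: "\<forall>k. t k > 0" "t \<longlonglongrightarrow> (0::real)" and P: "P \<longlonglongrightarrow> (w, z)"
    and g: "\<forall>k. (x, u) + t k *\<^sub>R P k \<in> gph S" by (auto simp: graphical_deriv_def tangent_cone_def)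
  have "u + t k *\<^sub>R snd (P k) \<in> S (x + t k *\<^sub>R fst (P k))" for k
    using g[rule_format, of k] by (cases "P k") (auto simp: gph_def)
  then show ?R using t tendsto_fst[OF P] tendsto_snd[OF P]
    by (intro exI[of _ t] exI[of _ "\<lambda>k. fst (P k)"] exI[of _ "\<lambda>k. snd (P k)"]) auto
next
  assume ?R
  then obtain t W Z where t: "\<forall>k. t k > 0" "t \<longlonglongrightarrow> (0::real)" "W \<longlonglongrightarrow> w" "Z \<longlonglongrightarrow> z"
    and g: "\<forall>k. u + t k *\<^sub>R Z k \<in> S (x + t k *\<^sub>R W k)" by blast
  then show ?L unfolding graphical_deriv_def tangent_cone_def mem_Collect_eq
    by (intro exI[of _ t] exI[of _ "\<lambda>k. (W k, Z k)"] conjI tendsto_Pair) (auto simp: gph_def)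
qed

lemma graphical_deriv_eventuallyI:
  assumes "\<And>k. t k > 0" "t \<longlonglongrightarrow> (0::real)" "W \<longlonglongrightarrow> w" "Z \<longlonglongrightarrow> z"
    and "\<forall>\<^sub>F k in sequentially. u + t k *\<^sub>R Z k \<in> S (x + t k *\<^sub>R W k)"
  shows "z \<in> graphical_deriv S x u w"
proof -
  obtain N where N: "\<And>k. k \<ge> N \<Longrightarrow> u + t k *\<^sub>R Z k \<in> S (x + t k *\<^sub>R W k)"
    using assms(5) unfolding eventually_sequentially by blast
  show ?thesis unfolding graphical_deriv_seq
  proof (rule exI[of _ "\<lambda>k. t (k + N)"], rule exI[of _ "\<lambda>k. W (k + N)"], rule exI[of _ "\<lambda>k. Z (k + N)"], intro conjI allI)
    show "(\<lambda>k. t (k + N)) \<longlonglongrightarrow> 0" by (rule LIMSEQ_ignore_initial_segment[OF assms(2)])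
    show "(\<lambda>k. W (k + N)) \<longlonglongrightarrow> w" by (rule LIMSEQ_ignore_initial_segment[OF assms(3)])
    show "(\<lambda>k. Z (k + N)) \<longlonglongrightarrow> z" by (rule LIMSEQ_ignore_initial_segment[OF assms(4)])
  qed (use assms(1) N in auto)
qed

text \<open>Without sequences, the closedness of the graph of the derivative is a matter of two halves of \<open>\<delta>\<close>.\<close>

lemma graphical_deriv_iff:
  "z \<in> graphical_deriv S x u w \<longleftrightarrow> (\<forall>\<delta>>0. \<exists>t w' z'. 0 < t \<and> t < \<delta> \<and> norm (w' - w) < \<delta> \<and> norm (z' - z) < \<delta> \<and>
     u + t *\<^sub>R z' \<in> S (x + t *\<^sub>R w'))" (is "?L \<longleftrightarrow> ?R")
proof
  assume ?L
  then obtain t W Z where t: "\<And>k. t k > 0" and l: "t \<longlonglongrightarrow> (0::real)" "W \<longlonglongrightarrow> w" "Z \<longlonglongrightarrow> z"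
    and g: "\<And>k. u + t k *\<^sub>R Z k \<in> S (x + t k *\<^sub>R W k)" unfolding graphical_deriv_seq by blast
  show ?R
  proof (intro allI impI)
    fix \<delta> :: real assume "\<delta> > 0"
    have "\<forall>\<^sub>F k in sequentially. t k < \<delta> \<and> norm (W k - w) < \<delta> \<and> norm (Z k - z) < \<delta>"
      using order_tendstoD(2)[OF l(1) \<open>\<delta> > 0\<close>] tendstoD[OF l(2) \<open>\<delta> > 0\<close>] tendstoD[OF l(3) \<open>\<delta> > 0\<close>]
      by eventually_elim (simp add: dist_norm)
    then obtain k where "t k < \<delta>" "norm (W k - w) < \<delta>" "norm (Z k - z) < \<delta>"
      using eventually_happens by fastforce
    then show "\<exists>t w' z'. 0 < t \<and> t < \<delta> \<and> norm (w' - w) < \<delta> \<and> norm (z' - z) < \<delta> \<and>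
      u + t *\<^sub>R z' \<in> S (x + t *\<^sub>R w')" using t g by blast
  qed
next
  assume ?R
  then have "\<exists>t w'. 0 < t \<and> t < \<delta> \<and> norm (w' - w) < \<delta> \<and> (\<exists>z'. norm (z' - z) < \<delta> \<and> u + t *\<^sub>R z' \<in> S (x + t *\<^sub>R w'))"
    if "\<delta> > 0" for \<delta> using that by blast
  then obtain t W where H: "\<And>k. 0 < t k \<and> t k < inverse (real (Suc k)) \<and> norm (W k - w) < inverse (real (Suc k)) \<and>
      (\<exists>z'. norm (z' - z) < inverse (real (Suc k)) \<and> u + t k *\<^sub>R z' \<in> S (x + t k *\<^sub>R W k))"
    using null_seq_choice[of "\<lambda>\<delta> t w'. 0 < t \<and> t < \<delta> \<and> norm (w' - w) < \<delta> \<and> (\<exists>z'. norm (z' - z) < \<delta> \<and> u + t *\<^sub>R z' \<in> S (x + t *\<^sub>R w'))"]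
    by blast
  then obtain Z where Z: "\<And>k. norm (Z k - z) < inverse (real (Suc k)) \<and> u + t k *\<^sub>R Z k \<in> S (x + t k *\<^sub>R W k)" by metis
  have "t \<longlonglongrightarrow> 0" by (rule tendsto_of_inverse_Suc) (use H in \<open>simp add: abs_of_pos\<close>)
  moreover have "W \<longlonglongrightarrow> w" "Z \<longlonglongrightarrow> z" using H Z by (blast intro: tendsto_of_inverse_Suc)+
  ultimately show ?L unfolding graphical_deriv_seq using H Z by blast
qed

lemma graphical_deriv_closed:
  assumes "\<And>k. Z k \<in> graphical_deriv S x u (W k)" "W \<longlonglongrightarrow> w" "Z \<longlonglongrightarrow> z"
  shows "z \<in> graphical_deriv S x u w"
  unfolding graphical_deriv_iff
proof (intro allI impI)
  fix \<delta> :: real assume "\<delta> > 0"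
  then have "\<delta>/2 > 0" by simp
  from tendstoD[OF assms(2) this] tendstoD[OF assms(3) this]
  have "\<forall>\<^sub>F k in sequentially. norm (W k - w) < \<delta>/2 \<and> norm (Z k - z) < \<delta>/2"
    by eventually_elim (simp add: dist_norm)
  then obtain k where k: "norm (W k - w) < \<delta>/2" "norm (Z k - z) < \<delta>/2"
    using eventually_happens by fastforce
  obtain t w' z' where t: "0 < t" "t < \<delta>/2" "norm (w' - W k) < \<delta>/2" "norm (z' - Z k) < \<delta>/2"
    "u + t *\<^sub>R z' \<in> S (x + t *\<^sub>R w')"
    using assms(1)[of k] \<open>\<delta>/2 > 0\<close> unfolding graphical_deriv_iff by meson
  have "norm (w' - w) < \<delta>" using norm_triangle_lt[of "w' - W k" "W k - w" \<delta>] k(1) t(3) by simp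
  moreover have "norm (z' - z) < \<delta>" using norm_triangle_lt[of "z' - Z k" "Z k - z" \<delta>] k(2) t(4) by simp
  ultimately show "\<exists>t w' z'. 0 < t \<and> t < \<delta> \<and> norm (w' - w) < \<delta> \<and> norm (z' - z) < \<delta> \<and>
      u + t *\<^sub>R z' \<in> S (x + t *\<^sub>R w')" using t by (intro exI[of _ t] exI[of _ w'] exI[of _ z']) auto
qed

lemma graphical_deriv_cone:
  assumes "z \<in> graphical_deriv S x u w" "s > 0"
  shows "s *\<^sub>R z \<in> graphical_deriv S x u (s *\<^sub>R w)"
proof -
  obtain t W Z where t: "\<And>k. t k > 0" and l: "t \<longlonglongrightarrow> (0::real)" "W \<longlonglongrightarrow> w" "Z \<longlonglongrightarrow> z"
    and g: "\<And>k. u + t k *\<^sub>R Z k \<in> S (x + t k *\<^sub>R W k)" using assms(1) unfolding graphical_deriv_seq by blast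
  have "(\<lambda>k. t k / s) \<longlonglongrightarrow> 0 / s" by (intro tendsto_intros l) (use assms in auto)
  then have "(\<lambda>k. t k / s) \<longlonglongrightarrow> 0" by simp
  moreover have "(\<lambda>k. s *\<^sub>R W k) \<longlonglongrightarrow> s *\<^sub>R w" "(\<lambda>k. s *\<^sub>R Z k) \<longlonglongrightarrow> s *\<^sub>R z" by (intro tendsto_intros l)+
  ultimately show ?thesis unfolding graphical_deriv_seq using t g assms(2)
    by (intro exI[of _ "\<lambda>k. t k / s"] exI[of _ "\<lambda>k. s *\<^sub>R W k"] exI[of _ "\<lambda>k. s *\<^sub>R Z k"]) auto
qed

lemma graphical_deriv_cong:
  assumes "open U" "x \<in> U" "\<And>y. y \<in> U \<Longrightarrow> S y = T y"
  shows "graphical_deriv S x u w = graphical_deriv T x u w"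
proof -
  have *: "graphical_deriv S x u w \<subseteq> graphical_deriv T x u w" if "\<And>y. y \<in> U \<Longrightarrow> S y = T y" for S T
  proof
    fix z assume "z \<in> graphical_deriv S x u w"
    then obtain t W Z where t: "\<And>k. t k > 0" and l: "t \<longlonglongrightarrow> (0::real)" "W \<longlonglongrightarrow> w" "Z \<longlonglongrightarrow> z"
      and g: "\<And>k. u + t k *\<^sub>R Z k \<in> S (x + t k *\<^sub>R W k)" unfolding graphical_deriv_seq by blast
    have "(\<lambda>k. x + t k *\<^sub>R W k) \<longlonglongrightarrow> x + 0 *\<^sub>R w" by (intro tendsto_intros l)
    then have "\<forall>\<^sub>F k in sequentially. x + t k *\<^sub>R W k \<in> U" using assms(1,2) by (auto dest: topological_tendstoD)
    then obtain N where N: "\<And>k. k \<ge> N \<Longrightarrow> x + t k *\<^sub>R W k \<in> U" unfolding eventually_sequentially by blast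
    have g': "u + t (k + N) *\<^sub>R Z (k + N) \<in> T (x + t (k + N) *\<^sub>R W (k + N))" for k
      using g[of "k + N"] that[OF N[of "k + N"]] by simp
    show "z \<in> graphical_deriv T x u w" unfolding graphical_deriv_seq
      using t l[THEN LIMSEQ_ignore_initial_segment[where k=N]] g' 
      by (intro exI[of _ "\<lambda>k. t (k + N)"] exI[of _ "\<lambda>k. W (k + N)"] exI[of _ "\<lambda>k. Z (k + N)"]) simp
  qed
  show ?thesis using *[of S T] *[of T S] assms(3) by auto
qed

text \<open>If the estimate failed for every \<open>\<kappa>\<close>, there would be \<open>v \<in> S y\<close> with \<open>y \<rightarrow> x\<close> and \<open>v\<close> negligible against
  \<open>y - x\<close>. Dividing by the length of \<open>y - x\<close> and passing to a cluster point gives a unit vector \<open>w\<close> whose image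
  under the derivative contains \<open>0\<close>.\<close>

lemma nonsingular_imp_strong_subregular:
  fixes S :: "'a::euclidean_space \<Rightarrow> 'b::real_normed_vector set"
  assumes nonsing: "set_inv (graphical_deriv S x 0) 0 = {0}"
  shows "\<exists>\<kappa>>0. \<exists>\<delta>>0. \<forall>y v. norm (y - x) < \<delta> \<and> v \<in> S y \<longrightarrow> norm (y - x) \<le> \<kappa> * norm v"
proof (rule ccontr)
  assume neg: "\<not> ?thesis"
  have ex: "\<exists>y v. norm (y - x) < e \<and> v \<in> S y \<and> norm v / e < norm (y - x)" if "e > 0" for e
  proof -
    have "1 / e > 0" using that by simp
    then obtain y v where "norm (y - x) < e" "v \<in> S y" "\<not> norm (y - x) \<le> 1 / e * norm v" using neg \<open>e > 0\<close> by blast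
    then show ?thesis by (intro exI[of _ y] exI[of _ v]) simp
  qed
  obtain Y V where "\<And>k. norm (Y k - x) < inverse (real (Suc k)) \<and> V k \<in> S (Y k)
      \<and> norm (V k) / inverse (real (Suc k)) < norm (Y k - x)"
    using null_seq_choice[of "\<lambda>e y v. norm (y - x) < e \<and> v \<in> S y \<and> norm v / e < norm (y - x)", OF ex] by blast
  then have Y: "\<And>k. norm (Y k - x) < inverse (real (Suc k))" and V: "\<And>k. V k \<in> S (Y k)"
    and YV: "\<And>k. norm (Y k - x) > real (Suc k) * norm (V k)" by (simp_all del: of_nat_Suc add: divide_inverse mult.commute)
  define t where "t k = norm (Y k - x)" for k
  have t: "t k > 0" for k
  proof -
    have "0 \<le> real (Suc k) * norm (V k)" by (intro mult_nonneg_nonneg) auto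
    then show ?thesis using YV[of k] unfolding t_def by linarith
  qed
  have inv: "(\<lambda>k. inverse (real (Suc k))) \<longlonglongrightarrow> 0" by (rule LIMSEQ_inverse_real_of_nat)
  have tlim: "t \<longlonglongrightarrow> 0"
    by (rule Lim_null_comparison[OF _ inv]) (use Y in \<open>auto intro!: always_eventually less_imp_le simp: t_def simp del: of_nat_Suc\<close>)
  define W where "W k = (Y k - x) /\<^sub>R t k" for k
  have W1: "norm (W k) = 1" for k using t[of k] by (simp add: W_def t_def)
  then obtain w r where r: "strict_mono r" and Wl: "(W \<circ> r) \<longlonglongrightarrow> w" using bounded_subseq[of W 1] by auto
  have "norm w = 1" using tendsto_norm[OF Wl] W1 by (simp add: LIMSEQ_const_iff)
  define Z where "Z k = V k /\<^sub>R t k" for k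
  have "Z \<longlonglongrightarrow> 0"
  proof (rule Lim_null_comparison[OF _ inv], intro always_eventually allI)
    fix k
    have "real (Suc k) * norm (V k) \<le> t k" using YV[of k] by (simp add: t_def)
    from mult_left_mono[OF this, of "inverse (real (Suc k))"]
    have "norm (V k) \<le> inverse (real (Suc k)) * t k" by (simp add: mult.assoc[symmetric] del: of_nat_Suc)
    then have "norm (V k) / t k \<le> inverse (real (Suc k))" using t[of k] by (simp only: pos_divide_le_eq)
    then show "norm (Z k) \<le> inverse (real (Suc k))" using t[of k]
      by (simp add: Z_def divide_inverse mult.commute)
  qed
  have "0 \<in> graphical_deriv S x 0 w" unfolding graphical_deriv_seq
  proof (intro exI[of _ "t \<circ> r"] exI[of _ "W \<circ> r"] exI[of _ "Z \<circ> r"] conjI allI)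
    fix k
    show "(t \<circ> r) k > 0" using t by simp
    show "0 + (t \<circ> r) k *\<^sub>R (Z \<circ> r) k \<in> S (x + (t \<circ> r) k *\<^sub>R (W \<circ> r) k)"
      using V[of "r k"] t[of "r k"] by (simp add: Z_def W_def)
    show "(t \<circ> r) \<longlonglongrightarrow> 0" by (rule LIMSEQ_subseq_LIMSEQ[OF tlim r])
    show "(Z \<circ> r) \<longlonglongrightarrow> 0" by (rule LIMSEQ_subseq_LIMSEQ[OF \<open>Z \<longlonglongrightarrow> 0\<close> r])
    show "(W \<circ> r) \<longlonglongrightarrow> w" by (rule Wl)
  qed
  then have "w = 0" using nonsing by (auto simp: set_inv_def)
  then show False using \<open>norm w = 1\<close> by simp
qed

lemma graphical_deriv_bound:
  assumes "\<delta> > 0" and est: "\<And>y v. norm (y - x) < \<delta> \<Longrightarrow> v \<in> S y \<Longrightarrow> norm (y - x) \<le> \<kappa> * norm v"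
    and z: "z \<in> graphical_deriv S x 0 w"
  shows "norm w \<le> \<kappa> * norm z"
proof -
  obtain t W Z where t: "\<And>k. t k > 0" and l: "t \<longlonglongrightarrow> (0::real)" "W \<longlonglongrightarrow> w" "Z \<longlonglongrightarrow> z"
    and g: "\<And>k. 0 + t k *\<^sub>R Z k \<in> S (x + t k *\<^sub>R W k)" using z unfolding graphical_deriv_seq by blast
  have "(\<lambda>k. norm (t k *\<^sub>R W k)) \<longlonglongrightarrow> norm (0 *\<^sub>R w)" by (intro tendsto_intros l)
  then have "\<forall>\<^sub>F k in sequentially. norm (t k *\<^sub>R W k) < \<delta>" by (rule order_tendstoD) (use assms in simp)
  then have "\<forall>\<^sub>F k in sequentially. norm (W k) \<le> \<kappa> * norm (Z k)"
  proof eventually_elim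
    case (elim k)
    then have "norm (t k *\<^sub>R W k) \<le> \<kappa> * norm (t k *\<^sub>R Z k)"
      using est[of "x + t k *\<^sub>R W k" "t k *\<^sub>R Z k"] g[of k] by simp
    then show ?case using t[of k] by (simp add: mult.left_commute)
  qed
  moreover have "(\<lambda>k. norm (W k)) \<longlonglongrightarrow> norm w" "(\<lambda>k. \<kappa> * norm (Z k)) \<longlonglongrightarrow> \<kappa> * norm z" by (intro tendsto_intros l)+
  ultimately show ?thesis by (intro tendsto_le[of sequentially]) auto
qed

text \<open>If \<open>x\<close> is isolated in \<open>A\<close>, then \<open>x\<close> is the nearest point of \<open>A\<close> for all points close enough to it.\<close>

lemma edist_singleton_local:
  assumes x: "x \<in> A" and iso: "\<And>y. y \<in> A \<Longrightarrow> norm (y - x) < \<delta> \<Longrightarrow> y = x" and n: "norm (y - x) < \<delta>/2"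
  shows "edist y A = ereal (norm (y - x))"
  unfolding edist_def
proof (rule antisym)
  show "(INF a\<in>A. ereal (norm (a - y))) \<le> ereal (norm (y - x))"
    using x by (intro INF_lower2[of x]) (auto simp: norm_minus_commute)
  show "ereal (norm (y - x)) \<le> (INF a\<in>A. ereal (norm (a - y)))"
  proof (rule INF_greatest)
    fix a assume a: "a \<in> A"
    have "norm (y - x) \<le> norm (a - y)"
    proof (cases "norm (a - x) < \<delta>")
      case True then show ?thesis using iso[OF a] by (simp add: norm_minus_commute)
    next
      case False then show ?thesis using n norm_triangle_ineq[of "a - y" "y - x"] by simp
    qed
    then show "ereal (norm (y - x)) \<le> ereal (norm (a - y))" by simp
  qed
qed

text \<open>The estimate for \<open>S\<close> makes \<open>x\<close> isolated in the solution set of \<open>0 \<in> S\<close>, so a subregularity constant \<open>k\<close>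
  is precisely a constant with \<open>norm (y - x) \<le> k * norm v\<close> near \<open>x\<close>. Each such constant passes to the
  derivative, and therefore so does their infimum.\<close>

lemma subreg_of_nonsingular:
  fixes S :: "'a::euclidean_space \<Rightarrow> 'b::real_normed_vector set"
  assumes nonsing: "set_inv (graphical_deriv S x 0) 0 = {0}" and 0: "0 \<in> S x"
  shows "\<exists>\<sigma>\<ge>0. subreg S x 0 = ereal \<sigma> \<and> (\<forall>w z. z \<in> graphical_deriv S x 0 w \<longrightarrow> norm w \<le> \<sigma> * norm z)"
proof -
  obtain \<kappa> \<delta> where \<kappa>: "\<kappa> > 0" "\<delta> > 0"
    and est: "\<And>y v. norm (y - x) < \<delta> \<Longrightarrow> v \<in> S y \<Longrightarrow> norm (y - x) \<le> \<kappa> * norm v"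
    using nonsingular_imp_strong_subregular[OF nonsing] by blast
  let ?P = "\<lambda>\<kappa>. \<forall>\<^sub>F y in nhds x. edist y (set_inv S 0) \<le> ereal \<kappa> * edist 0 (S y)"
  have dist: "edist y (set_inv S 0) = ereal (norm (y - x))" if "norm (y - x) < \<delta>/2" for y
    by (rule edist_singleton_local[where \<delta>=\<delta>]) (use 0 est that in \<open>force simp: set_inv_def\<close>)+
  have near: "\<forall>\<^sub>F y in nhds x. norm (y - x) < \<delta>/2"
    unfolding eventually_nhds_metric dist_norm using \<kappa>(2) by (intro exI[of _ "\<delta>/2"]) auto
  have P: "?P k \<longleftrightarrow> (\<forall>\<^sub>F y in nhds x. \<forall>v\<in>S y. norm (y - x) \<le> k * norm v)" if "k > 0" for k
  proof -
    have *: "edist y (set_inv S 0) \<le> ereal k * edist 0 (S y) \<longleftrightarrow> (\<forall>v\<in>S y. norm (y - x) \<le> k * norm v)"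
      if "norm (y - x) < \<delta>/2" for y
    proof -
      have "ereal (norm (y - x)) \<le> ereal k * edist 0 (S y) \<longleftrightarrow> ereal (norm (y - x) / k) \<le> edist 0 (S y)"
        using \<open>k > 0\<close> by (cases "edist 0 (S y)") (auto simp: field_simps)
      then show ?thesis unfolding dist[OF that] edist_zero_ge_iff using \<open>k > 0\<close> by (simp add: field_simps)
    qed
    show ?thesis
    proof
      assume "?P k"
      with near show "\<forall>\<^sub>F y in nhds x. \<forall>v\<in>S y. norm (y - x) \<le> k * norm v"
        by eventually_elim (use * in blast)
    next
      assume "\<forall>\<^sub>F y in nhds x. \<forall>v\<in>S y. norm (y - x) \<le> k * norm v"
      with near show "?P k" by eventually_elim (use * in blast)
    qed
  qed
  have bound: "norm w \<le> k * norm z" if k: "k > 0" "?P k" and z: "z \<in> graphical_deriv S x 0 w" for k w z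
  proof -
    have "\<forall>\<^sub>F y in nhds x. \<forall>v\<in>S y. norm (y - x) \<le> k * norm v"
      using P[OF k(1)] k(2) by (rule iffD1)
    then obtain d where d: "d > 0" "\<And>y. dist y x < d \<Longrightarrow> \<forall>v\<in>S y. norm (y - x) \<le> k * norm v"
      by (auto simp: eventually_nhds_metric)
    show ?thesis by (rule graphical_deriv_bound[OF d(1) _ z]) (simp add: d(2) dist_norm)
  qed
  define K where "K = {ereal k | k. k > 0 \<and> ?P k}"
  have sub: "subreg S x 0 = Inf K" by (simp add: subreg_def K_def)
  have "?P \<kappa>" unfolding P[OF \<kappa>(1)] using near by eventually_elim (use est \<kappa>(2) in force)
  with \<kappa>(1) have "ereal \<kappa> \<in> K" unfolding K_def by (intro CollectI exI[of _ \<kappa>]) simp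
  then have "Inf K \<le> ereal \<kappa>" by (rule Inf_lower)
  moreover have "0 \<le> Inf K" unfolding K_def by (rule Inf_greatest) (auto simp: less_imp_le)
  ultimately obtain \<sigma> where \<sigma>: "Inf K = ereal \<sigma>" "\<sigma> \<ge> 0" by (cases "Inf K") auto
  have "norm w \<le> \<sigma> * norm z" if z: "z \<in> graphical_deriv S x 0 w" for w z
  proof (cases "z = 0")
    case True
    then show ?thesis using bound[OF \<kappa>(1) \<open>?P \<kappa>\<close> z] by simp
  next
    case False
    have "ereal (norm w / norm z) \<le> Inf K"
    proof (rule Inf_greatest)
      fix K' assume "K' \<in> K"
      then obtain k where k: "K' = ereal k" "k > 0" "?P k" unfolding K_def by blast
      show "ereal (norm w / norm z) \<le> K'" using bound[OF k(2,3) z] False k(1) by (simp add: field_simps)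
    qed
    then show ?thesis using False \<sigma> by (simp add: field_simps)
  qed
  then show ?thesis using sub \<sigma> by auto
qed

section \<open>The KL property with exponent 1/2\<close>

text \<open>For small \<open>v \<in> \<partial>f(x)\<close> the prox-regularity inequality tested at \<open>xbar\<close> bounds the gap \<open>s\<^sup>2\<close> by
  \<open>norm v * norm (x - xbar) + \<rho> / 2 * (norm (x - xbar))\<^sup>2\<close>, hence by \<open>(\<kappa> + \<rho> * \<kappa>\<^sup>2 / 2) * (norm v)\<^sup>2\<close>. Subgradients
  that are not small satisfy the KL inequality trivially once \<open>s\<close> is small.\<close>

lemma kl_half_of_strong_subregularity:
  fixes f :: "'a::euclidean_space \<Rightarrow> ereal"
  assumes c: "f xbar = ereal c" and lsc: "locally_lsc_at f xbar" and "\<epsilon> > 0" "\<rho> \<ge> 0"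
    and prox: "\<And>x v. v \<in> limiting_subdiff f x \<Longrightarrow> norm v < \<epsilon> \<Longrightarrow> norm (x - xbar) < \<epsilon> \<Longrightarrow> f x < ereal (c + \<epsilon>) \<Longrightarrow>
        f x + ereal (v \<bullet> (xbar - x) - \<rho> / 2 * (norm (xbar - x))\<^sup>2) \<le> f xbar"
    and "\<kappa> > 0" "\<delta> > 0"
    and est: "\<And>x v. norm (x - xbar) < \<delta> \<Longrightarrow> v \<in> limiting_subdiff f x \<Longrightarrow> norm (x - xbar) \<le> \<kappa> * norm v"
  shows "kl_property f xbar (1/2)"
proof -
  define B where "B = \<kappa> + \<rho> * \<kappa>\<^sup>2 / 2"
  have "B > 0" using \<open>\<kappa> > 0\<close> \<open>\<rho> \<ge> 0\<close> by (simp add: B_def add_pos_nonneg)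
  define \<mu> where "\<mu> = 1 / (2 * sqrt B)"
  have "\<mu> > 0" using \<open>B > 0\<close> by (simp add: \<mu>_def)
  define e where "e = min (min 1 (\<delta>/2)) (min (\<epsilon>/2) (\<epsilon> / (2 * \<mu>)))"
  have "e > 0" using \<open>\<delta> > 0\<close> \<open>\<epsilon> > 0\<close> \<open>\<mu> > 0\<close> by (simp add: e_def)
  moreover have "e \<le> 1" "e \<le> \<delta>/2" "e \<le> \<epsilon>/2" "e \<le> \<epsilon> / (2 * \<mu>)" by (simp_all add: e_def)
  ultimately have e: "e > 0" "e \<le> 1" "e < \<delta>" "e < \<epsilon>" "2 * \<mu> * e \<le> \<epsilon>"
    using \<open>\<delta> > 0\<close> \<open>\<epsilon> > 0\<close> \<open>\<mu> > 0\<close> by (auto simp: pos_le_divide_eq mult.commute)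
  have "2 * \<mu> * s \<le> norm v"
    if x: "norm (x - xbar) \<le> e" "0 < s" "s < e" "f x = ereal (c + s\<^sup>2)" "v \<in> limiting_subdiff f x" for x s v
  proof (cases "norm v < \<epsilon>")
    case False
    have "2 * \<mu> * s \<le> 2 * \<mu> * e" using x(3) \<open>\<mu> > 0\<close> by simp
    then show ?thesis using False e(5) by linarith
  next
    case True
    have "s\<^sup>2 \<le> 1 * s" unfolding power2_eq_square using x(2,3) e(2) by (intro mult_right_mono) auto
    then have "f x < ereal (c + \<epsilon>)" using x(3,4) e(4) by simp
    with True x e(4) have "f x + ereal (v \<bullet> (xbar - x) - \<rho> / 2 * (norm (xbar - x))\<^sup>2) \<le> f xbar"
      by (intro prox) auto
    then have 1: "s\<^sup>2 \<le> v \<bullet> (x - xbar) + \<rho> / 2 * (norm (x - xbar))\<^sup>2"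
      using x(4) c by (simp add: norm_minus_commute inner_diff_right)
    have n: "norm (x - xbar) \<le> \<kappa> * norm v" using est x e(3) by auto
    have "v \<bullet> (x - xbar) \<le> norm v * norm (x - xbar)" by (rule norm_cauchy_schwarz)
    also have "\<dots> \<le> norm v * (\<kappa> * norm v)" using n by (intro mult_left_mono) auto
    finally have 2: "v \<bullet> (x - xbar) \<le> \<kappa> * (norm v)\<^sup>2" by (simp add: power2_eq_square mult_ac)
    have "(norm (x - xbar))\<^sup>2 \<le> (\<kappa> * norm v)\<^sup>2" using n by (intro power_mono) auto
    then have "\<rho> / 2 * (norm (x - xbar))\<^sup>2 \<le> \<rho> / 2 * (\<kappa> * norm v)\<^sup>2" using \<open>\<rho> \<ge> 0\<close> by (intro mult_left_mono) auto
    with 1 2 have "s\<^sup>2 \<le> B * (norm v)\<^sup>2" unfolding B_def by (simp add: algebra_simps power_mult_distrib)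
    then have "sqrt (s\<^sup>2) \<le> sqrt (B * (norm v)\<^sup>2)" by (rule real_sqrt_le_mono)
    then have "s \<le> sqrt B * norm v" using x(2) by (simp add: real_sqrt_mult)
    then show ?thesis using \<open>B > 0\<close> by (simp add: \<mu>_def field_simps)
  qed
  then show ?thesis unfolding kl_property_def kl_half_iff[where \<phi> = f, OF c]
    using \<open>\<mu> > 0\<close> lsc e(1) by blast
qed

section \<open>Second-order epi-limits and sharpness\<close>

text \<open>The two halves of epi-convergence of the quotients \<open>(f (xbar + t *\<^sub>R w) - f xbar) / t\<^sup>2\<close> to \<open>h\<close> as
  \<open>t\<close> decreases to \<open>0\<close>, multiplied out so that no extended real is ever divided.\<close>

definition second_order_minorant :: "('a::real_normed_vector \<Rightarrow> ereal) \<Rightarrow> 'a \<Rightarrow> ('a \<Rightarrow> ereal) \<Rightarrow> bool" where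
  "second_order_minorant f xbar h \<longleftrightarrow> (\<forall>w b. ereal b < h w \<longrightarrow>
     (\<exists>\<delta>>0. \<forall>t w'. 0 < t \<and> t < \<delta> \<and> norm (w' - w) < \<delta> \<longrightarrow> f xbar + ereal (t\<^sup>2 * b) < f (xbar + t *\<^sub>R w')))"

definition second_order_recovery :: "('a::real_normed_vector \<Rightarrow> ereal) \<Rightarrow> 'a \<Rightarrow> ('a \<Rightarrow> ereal) \<Rightarrow> bool" where
  "second_order_recovery f xbar h \<longleftrightarrow> (\<forall>w t. (\<forall>k. 0 < t k) \<and> t \<longlonglongrightarrow> 0 \<longrightarrow>
     (\<exists>W. W \<longlonglongrightarrow> w \<and> (\<forall>b. h w < ereal b \<longrightarrow>
        (\<forall>\<^sub>F k in sequentially. f (xbar + t k *\<^sub>R W k) < f xbar + ereal ((t k)\<^sup>2 * b)))))"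

lemma half_ereal_less_iff:
  "ereal b < ereal (1/2) * x \<longleftrightarrow> ereal (2 * b) < x" "ereal (1/2) * x < ereal b \<longleftrightarrow> x < ereal (2 * b)"
  by (cases x; auto)+

lemma second_quot_less_iff:
  assumes c: "f xbar = ereal c" and t: "t > 0"
  shows "ereal (2 * b) < second_quot f xbar 0 t w \<longleftrightarrow> f xbar + ereal (t\<^sup>2 * b) < f (xbar + t *\<^sub>R w)"
    and "second_quot f xbar 0 t w < ereal (2 * b) \<longleftrightarrow> f (xbar + t *\<^sub>R w) < f xbar + ereal (t\<^sup>2 * b)"
proof -
  have t2: "t\<^sup>2 > 0" using t by simp
  have "(ereal (2 * b) < second_quot f xbar 0 t w \<longleftrightarrow> f xbar + ereal (t\<^sup>2 * b) < f (xbar + t *\<^sub>R w)) \<and>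
    (second_quot f xbar 0 t w < ereal (2 * b) \<longleftrightarrow> f (xbar + t *\<^sub>R w) < f xbar + ereal (t\<^sup>2 * b))"
  proof (cases "f (xbar + t *\<^sub>R w)")
    case (real a)
    then have "second_quot f xbar 0 t w = ereal ((a - c) / (t\<^sup>2/2))" using c t2 by (simp add: second_quot_def)
    then show ?thesis using real c t2 by (auto simp: field_simps)
  next
    case PInf
    then have "second_quot f xbar 0 t w = \<infinity>" using c t2 by (simp add: second_quot_def divide_ereal_def)
    then show ?thesis using PInf c by simp
  next
    case MInf
    then have "second_quot f xbar 0 t w = -\<infinity>" using c t2 by (simp add: second_quot_def divide_ereal_def)
    then show ?thesis using MInf c by simp
  qed
  then show "ereal (2 * b) < second_quot f xbar 0 t w \<longleftrightarrow> f xbar + ereal (t\<^sup>2 * b) < f (xbar + t *\<^sub>R w)"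
    and "second_quot f xbar 0 t w < ereal (2 * b) \<longleftrightarrow> f (xbar + t *\<^sub>R w) < f xbar + ereal (t\<^sup>2 * b)" by auto
qed

lemma eventually_at_right_prod_nhds:
  "(\<forall>\<^sub>F (t, w') in at_right (0::real) \<times>\<^sub>F nhds (w::'a::real_normed_vector). P t w') \<longleftrightarrow>
    (\<exists>\<delta>>0. \<forall>t w'. 0 < t \<and> t < \<delta> \<and> norm (w' - w) < \<delta> \<longrightarrow> P t w')" (is "?L \<longleftrightarrow> ?R")
proof
  assume ?L
  then obtain Pf Pg where F: "eventually Pf (at_right (0::real))" and G: "eventually Pg (nhds w)"
    and P: "\<And>t w'. Pf t \<Longrightarrow> Pg w' \<Longrightarrow> P t w'" by (auto simp: eventually_prod_filter)
  obtain d1 where "d1 > 0" "\<And>t. 0 < t \<Longrightarrow> t < d1 \<Longrightarrow> Pf t" using F by (auto simp: eventually_at_right_field)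
  moreover obtain d2 where "d2 > 0" "\<And>w'. norm (w' - w) < d2 \<Longrightarrow> Pg w'"
    using G by (auto simp: eventually_nhds_metric dist_norm)
  ultimately show ?R using P by (intro exI[of _ "min d1 d2"]) auto
next
  assume ?R
  then obtain \<delta> where d: "\<delta> > 0" "\<And>t w'. 0 < t \<Longrightarrow> t < \<delta> \<Longrightarrow> norm (w' - w) < \<delta> \<Longrightarrow> P t w'" by blast
  have "eventually (\<lambda>t. 0 < t \<and> t < \<delta>) (at_right (0::real))" using d(1) by (auto simp: eventually_at_right_field)
  moreover have "eventually (\<lambda>w'. norm (w' - w) < \<delta>) (nhds w)" using d(1) by (auto simp: eventually_nhds_metric dist_norm)
  ultimately show ?L unfolding eventually_prod_filter using d(2)
    by (intro exI[of _ "\<lambda>t. 0 < t \<and> t < \<delta>"] exI[of _ "\<lambda>w'. norm (w' - w) < \<delta>"]) auto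
qed

lemma second_order_minorant_second_subderiv:
  assumes c: "f xbar = ereal c"
  shows "second_order_minorant f xbar (\<lambda>w. ereal (1/2) * second_subderiv f xbar 0 w)"
  unfolding second_order_minorant_def
proof (intro allI impI)
  fix w b assume "ereal b < ereal (1/2) * second_subderiv f xbar 0 w"
  then have "ereal (2 * b) < second_subderiv f xbar 0 w" by (simp add: half_ereal_less_iff)
  then have "\<forall>\<^sub>F p in at_right 0 \<times>\<^sub>F nhds w. ereal (2 * b) < (case p of (t, w') \<Rightarrow> second_quot f xbar 0 t w')"
    unfolding second_subderiv_def by (rule less_LiminfD)
  then have "\<forall>\<^sub>F (t, w') in at_right 0 \<times>\<^sub>F nhds w. ereal (2 * b) < second_quot f xbar 0 t w'"
    by (simp add: case_prod_unfold)
  then show "\<exists>\<delta>>0. \<forall>t w'. 0 < t \<and> t < \<delta> \<and> norm (w' - w) < \<delta> \<longrightarrow> f xbar + ereal (t\<^sup>2 * b) < f (xbar + t *\<^sub>R w')"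
    unfolding eventually_at_right_prod_nhds using second_quot_less_iff(1)[where f = f, OF c] by blast
qed

lemma second_order_recovery_second_subderiv:
  assumes c: "f xbar = ereal c" and "twice_epi_diff f xbar 0"
  shows "second_order_recovery f xbar (\<lambda>w. ereal (1/2) * second_subderiv f xbar 0 w)"
  unfolding second_order_recovery_def
proof (intro allI impI, elim conjE)
  fix w and t :: "nat \<Rightarrow> real" assume t: "\<forall>k. 0 < t k" "t \<longlonglongrightarrow> 0"
  then obtain W where W: "W \<longlonglongrightarrow> w"
    and lim: "(\<lambda>k. second_quot f xbar 0 (t k) (W k)) \<longlonglongrightarrow> second_subderiv f xbar 0 w"
    using assms(2) unfolding twice_epi_diff_def by blast
  show "\<exists>W. W \<longlonglongrightarrow> w \<and> (\<forall>b. ereal (1/2) * second_subderiv f xbar 0 w < ereal b \<longrightarrow>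
        (\<forall>\<^sub>F k in sequentially. f (xbar + t k *\<^sub>R W k) < f xbar + ereal ((t k)\<^sup>2 * b)))"
  proof (intro exI[of _ W] conjI W allI impI)
    fix b assume "ereal (1/2) * second_subderiv f xbar 0 w < ereal b"
    then have "second_subderiv f xbar 0 w < ereal (2 * b)" by (simp add: half_ereal_less_iff)
    from order_tendstoD(2)[OF lim this]
    show "\<forall>\<^sub>F k in sequentially. f (xbar + t k *\<^sub>R W k) < f xbar + ereal ((t k)\<^sup>2 * b)"
      by eventually_elim (use second_quot_less_iff(2)[where f = f, OF c] t(1) in blast)
  qed
qed

lemma second_subderiv_upper:
  assumes c: "f xbar = ereal c" and b: "ereal (1/2) * second_subderiv f xbar 0 w < ereal b" and "\<eta> > 0"
  shows "\<exists>t w'. 0 < t \<and> t < \<eta> \<and> norm (w' - w) < \<eta> \<and> f (xbar + t *\<^sub>R w') \<le> ereal (c + t\<^sup>2 * b)"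
proof (rule ccontr)
  assume neg: "\<not> ?thesis"
  have "\<forall>\<^sub>F (t, w') in at_right 0 \<times>\<^sub>F nhds w. ereal (2 * b) \<le> second_quot f xbar 0 t w'"
    unfolding eventually_at_right_prod_nhds
  proof (intro exI[of _ \<eta>] conjI allI impI)
    fix t w' assume "0 < t \<and> t < \<eta> \<and> norm (w' - w) < \<eta>"
    moreover from this have "\<not> f (xbar + t *\<^sub>R w') \<le> ereal (c + t\<^sup>2 * b)" using neg by blast
    ultimately have "ereal (2 * b) < second_quot f xbar 0 t w'"
      using second_quot_less_iff(1)[where f = f, OF c] c by (simp add: not_le)
    then show "ereal (2 * b) \<le> second_quot f xbar 0 t w'" by simp
  qed fact
  then have "ereal (2 * b) \<le> second_subderiv f xbar 0 w"
    unfolding second_subderiv_def by (intro Liminf_bounded) (simp add: case_prod_unfold)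
  then show False using b by (simp add: half_ereal_less_iff(2))
qed

text \<open>Near the ray of \<open>w\<close> the gap of \<open>f\<close> is at least \<open>b1 * t\<^sup>2\<close>, and at suitable points \<open>xbar + t *\<^sub>R w'\<close> it is at
  most \<open>b2 * t\<^sup>2\<close>. Minimising the quotient with a penalty that is strong enough to keep the minimiser near
  \<open>w'\<close> produces a point with a gap between these bounds and a subgradient of norm at most \<open>L * t\<close>. A KL
  inequality with exponent \<open>\<theta>\<close> would give \<open>K * t powr (2 * \<theta>) \<le> L * t\<close>, which fails for small \<open>t\<close> if
  \<open>2 * \<theta> < 1\<close>.\<close>

lemma no_kl_below_half_of_quadratic_growth:
  fixes f :: "'a::euclidean_space \<Rightarrow> ereal"
  assumes c: "f xbar = ereal c" and "r > 0" and lsc: "lsc_upto f (cball xbar r) (ereal (c + r))"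
    and "\<delta> > 0" "b1 > 0" "b2 > 0"
    and low: "\<And>t w'. 0 < t \<Longrightarrow> t < \<delta> \<Longrightarrow> norm (w' - w) < \<delta> \<Longrightarrow> ereal (c + t\<^sup>2 * b1) < f (xbar + t *\<^sub>R w')"
    and up: "\<And>\<eta>. \<eta> > 0 \<Longrightarrow> \<exists>t w'. 0 < t \<and> t < \<eta> \<and> norm (w' - w) < \<eta> \<and> f (xbar + t *\<^sub>R w') \<le> ereal (c + t\<^sup>2 * b2)"
    and "\<theta> < 1/2" "0 \<le> \<theta>"
  shows "\<not> kl_property f xbar \<theta>"
proof
  assume "kl_property f xbar \<theta>"
  then obtain \<mu> \<epsilon> \<nu> where "\<mu> > 0" "\<epsilon> > 0" "(0::ereal) < \<nu>"
    and KL: "\<And>x. norm (x - xbar) \<le> \<epsilon> \<Longrightarrow> f xbar < f x \<Longrightarrow> f x < f xbar + \<nu> \<Longrightarrow>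
      ereal (\<mu> / (1 - \<theta>) * real_of_ereal (f x - f xbar) powr \<theta>) \<le> edist 0 (limiting_subdiff f x)"
    unfolding kl_property_def kl_with_modulus_def by blast
  obtain n where n: "n > 0" "ereal n \<le> \<nu>"
  proof -
    obtain q where "0 < ereal q" "ereal q < \<nu>" using ereal_dense2[OF \<open>0 < \<nu>\<close>] by blast
    then show ?thesis using that[of q] by (simp add: less_imp_le)
  qed
  define L where "L = 8 * b2 / \<delta>"
  define K where "K = \<mu> / (1 - \<theta>) * b1 powr \<theta>"
  have "L > 0" "K > 0" using \<open>\<delta> > 0\<close> \<open>b1 > 0\<close> \<open>b2 > 0\<close> \<open>\<mu> > 0\<close> \<open>\<theta> < 1/2\<close> by (auto simp: L_def K_def)
  \<comment> \<open>below this \<open>t\<close> the inequality \<open>K * t powr (2 * \<theta>) \<le> L * t\<close> is violated\<close>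
  define e0 where "e0 = (K / (L + 1)) powr (1 / (1 - 2 * \<theta>))"
  have "e0 > 0" using \<open>L > 0\<close> \<open>K > 0\<close> by (simp add: e0_def)
  \<comment> \<open>small enough for the growth bound, for the level of lower semicontinuity, for the KL threshold, for
    the contradiction, and for the ball and the KL neighbourhood around \<open>xbar\<close>, in this order\<close>
  define \<eta> where "\<eta> = min (min (min 1 (\<delta>/2)) (min (r / (b2 + 1)) (n / (b2 + 1))))
     (min e0 (min (r / (norm w + \<delta> + 1)) (\<epsilon> / (norm w + \<delta> + 1))))"
  have w1: "norm w + \<delta> + 1 > 0" using \<open>\<delta> > 0\<close> by (simp add: add_nonneg_pos)
  have "\<eta> > 0" using \<open>\<delta> > 0\<close> \<open>r > 0\<close> \<open>b2 > 0\<close> n \<open>e0 > 0\<close> w1 \<open>\<epsilon> > 0\<close> by (auto simp: \<eta>_def)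
  from up[OF this] obtain t w' where t: "0 < t" "t < \<eta>" and w': "norm (w' - w) < \<eta>"
    and ft: "f (xbar + t *\<^sub>R w') \<le> ereal (c + t\<^sup>2 * b2)" by blast
  have t1: "t < 1" "t < \<delta>/2" "t < e0" using t by (auto simp: \<eta>_def)
  have "t * (b2 + 1) < r" "t * (b2 + 1) < n" "t * (norm w + \<delta> + 1) < r" "t * (norm w + \<delta> + 1) < \<epsilon>"
    using t w1 \<open>b2 > 0\<close> by (auto simp: \<eta>_def pos_less_divide_eq add_pos_pos)
  then have t2: "t * b2 < r" "t * b2 < n" "t * (norm w + \<delta>) < r" "t * (norm w + \<delta>) < \<epsilon>"
    using t(1) by (auto simp: algebra_simps)
  have "t\<^sup>2 \<le> t" using t(1) t1(1) by (simp add: power2_eq_square mult_left_le)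
  then have "t\<^sup>2 * b2 \<le> t * b2" using \<open>b2 > 0\<close> by simp
  with t2 have t3: "t\<^sup>2 * b2 < r" "t\<^sup>2 * b2 < n" by linarith+
  have w2: "norm (w' - w) < \<delta>/2" using w' by (auto simp: \<eta>_def)
  have K: "ereal (c + t\<^sup>2 * b1) < f (xbar + t *\<^sub>R u)" "norm (t *\<^sub>R u) \<le> t * (norm w + \<delta>)"
    if "norm (u - w') \<le> \<delta> / 2" for u
  proof -
    have u: "norm (u - w) < \<delta>" using that w2 norm_triangle_ineq[of "u - w'" "w' - w"] by simp
    show "ereal (c + t\<^sup>2 * b1) < f (xbar + t *\<^sub>R u)" by (rule low) (use t t1 u in auto)
    have "norm u \<le> norm w + \<delta>" using norm_triangle_ineq[of "u - w" w] u by simp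
    then show "norm (t *\<^sub>R u) \<le> t * (norm w + \<delta>)" using t(1) by simp
  qed
  \<comment> \<open>the penalty at distance \<open>\<delta> / 4\<close> equals \<open>b2\<close>, so the minimiser lies in the inner half of the ball\<close>
  define a where "a = 16 * b2 / \<delta>\<^sup>2"
  have "a > 0" using \<open>\<delta> > 0\<close> \<open>b2 > 0\<close> by (simp add: a_def)
  have "\<exists>u b. norm (u - w') \<le> \<delta> / 2 \<and> f (xbar + t *\<^sub>R u) = ereal (c + t\<^sup>2 * b) \<and>
    (\<forall>u' b'. norm (u' - w') \<le> \<delta> / 2 \<and> f (xbar + t *\<^sub>R u') \<le> ereal (c + t\<^sup>2 * b') \<longrightarrow>
      b - 0 \<bullet> (u - w') + a * (norm (u - w'))\<^sup>2 \<le> b' - 0 \<bullet> (u' - w') + a * (norm (u' - w'))\<^sup>2) \<and>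
    (norm (u - w') \<le> \<delta> / 2 / 2 \<longrightarrow> t *\<^sub>R (0 - (2 * a) *\<^sub>R (u - w')) \<in> limiting_subdiff f (xbar + t *\<^sub>R u))"
  proof (rule scaled_quadratic_minimizer[where f = f and xbar = xbar, OF lsc t(1)])
    show "xbar + t *\<^sub>R u \<in> cball xbar r" if "norm (u - w') \<le> \<delta> / 2" for u
      using K(2)[OF that] t2(3) by (simp add: dist_norm)
    show "ereal (c + t\<^sup>2 * b1) \<le> f (xbar + t *\<^sub>R u)" if "norm (u - w') \<le> \<delta> / 2" for u using K(1)[OF that] by simp
    show "f (xbar + t *\<^sub>R w') \<le> ereal (c + t\<^sup>2 * b2)" by (rule ft)
    show "ereal (c + t\<^sup>2 * (b2 - 0 \<bullet> (w' - w') + a * (norm (w' - w'))\<^sup>2 + norm (0::'a) * (\<delta> / 2))) < ereal (c + r)"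
      using t3(1) by simp
  qed (use \<open>\<delta> > 0\<close> \<open>a > 0\<close> in auto)
  then obtain u b where u: "norm (u - w') \<le> \<delta> / 2" "f (xbar + t *\<^sub>R u) = ereal (c + t\<^sup>2 * b)"
    and min: "b - 0 \<bullet> (u - w') + a * (norm (u - w'))\<^sup>2 \<le> b2 - 0 \<bullet> (w' - w') + a * (norm (w' - w'))\<^sup>2"
    and sub: "norm (u - w') \<le> \<delta> / 2 / 2 \<Longrightarrow> t *\<^sub>R (0 - (2 * a) *\<^sub>R (u - w')) \<in> limiting_subdiff f (xbar + t *\<^sub>R u)"
    using ft \<open>\<delta> > 0\<close> by (metis diff_self half_gt_zero less_imp_le norm_zero)
  have "t\<^sup>2 * b1 < t\<^sup>2 * b" using K(1)[OF u(1)] u(2) by simp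
  then have b: "b1 < b" using t(1) by (simp add: mult_less_cancel_left_pos)
  have "0 \<le> a * (norm (u - w'))\<^sup>2" using \<open>a > 0\<close> by simp
  with min b \<open>b1 > 0\<close> have b2: "b \<le> b2" "a * (norm (u - w'))\<^sup>2 \<le> b2" by auto
  have "(norm (u - w'))\<^sup>2 \<le> (\<delta> / 4)\<^sup>2" using b2(2) \<open>\<delta> > 0\<close> \<open>b2 > 0\<close>
    by (simp add: a_def field_simps power2_eq_square)
  then have uw: "norm (u - w') \<le> \<delta> / 4" by (rule power2_le_imp_le) (use \<open>\<delta> > 0\<close> in simp)
  define y v where "y = xbar + t *\<^sub>R u" and "v = t *\<^sub>R (0 - (2 * a) *\<^sub>R (u - w'))"
  have v: "v \<in> limiting_subdiff f y" unfolding v_def y_def by (rule sub) (use uw in simp)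
  have y: "f y = ereal (c + t\<^sup>2 * b)" using u(2) by (simp add: y_def)
  have "norm v = t * (2 * a * norm (u - w'))" using \<open>a > 0\<close> t(1) by (simp add: v_def)
  also have "\<dots> \<le> t * (2 * a * (\<delta> / 4))" using uw \<open>a > 0\<close> t(1) by (intro mult_left_mono) auto
  also have "\<dots> = L * t" using \<open>\<delta> > 0\<close> by (simp add: a_def L_def field_simps power2_eq_square)
  finally have vL: "norm v \<le> L * t" .
  have "ereal (\<mu> / (1 - \<theta>) * real_of_ereal (f y - f xbar) powr \<theta>) \<le> edist 0 (limiting_subdiff f y)"
  proof (rule KL)
    show "norm (y - xbar) \<le> \<epsilon>" using K(2)[OF u(1)] t2(4) by (simp add: y_def)
    show "f xbar < f y" using b \<open>b1 > 0\<close> y c t(1) by simp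
    have "t\<^sup>2 * b \<le> t\<^sup>2 * b2" using b2(1) by (rule mult_left_mono) simp
    then have "f y < ereal (c + n)" using y t3(2) by simp
    also have "\<dots> \<le> f xbar + \<nu>" using add_left_mono[OF n(2), of "ereal c"] c by simp
    finally show "f y < f xbar + \<nu>" .
  qed
  then have "\<mu> / (1 - \<theta>) * (t\<^sup>2 * b) powr \<theta> \<le> norm v" using v y c by (simp add: edist_zero_ge_iff)
  also have "(t\<^sup>2 * b1) powr \<theta> \<le> (t\<^sup>2 * b) powr \<theta>" using b \<open>b1 > 0\<close> \<open>0 \<le> \<theta>\<close> by (intro powr_mono2 mult_left_mono) auto
  then have "\<mu> / (1 - \<theta>) * (t\<^sup>2 * b1) powr \<theta> \<le> \<mu> / (1 - \<theta>) * (t\<^sup>2 * b) powr \<theta>"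
    using \<open>\<mu> > 0\<close> \<open>\<theta> < 1/2\<close> by (intro mult_left_mono) auto
  finally have "\<mu> / (1 - \<theta>) * (t\<^sup>2 * b1) powr \<theta> \<le> L * t" using vL by linarith
  moreover have "(t\<^sup>2 * b1) powr \<theta> = t powr (2 * \<theta>) * b1 powr \<theta>"
    using t(1) \<open>b1 > 0\<close> by (simp add: powr_mult powr_powr[symmetric])
  ultimately have "K * t powr (2 * \<theta>) \<le> L * t" by (simp add: K_def mult_ac)
  moreover have "t = t powr (1 - 2 * \<theta>) * t powr (2 * \<theta>)" using t(1) by (simp flip: powr_add)
  ultimately have "K * t powr (2 * \<theta>) \<le> L * t powr (1 - 2 * \<theta>) * t powr (2 * \<theta>)" by (simp add: mult.assoc)
  then have "K \<le> L * t powr (1 - 2 * \<theta>)" using t(1) by simp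
  moreover have "t powr (1 - 2 * \<theta>) < e0 powr (1 - 2 * \<theta>)" using t(1) t1(3) \<open>\<theta> < 1/2\<close> by (intro powr_less_mono2) auto
  moreover have "e0 powr (1 - 2 * \<theta>) = K / (L + 1)" using \<open>\<theta> < 1/2\<close> \<open>K > 0\<close> \<open>L > 0\<close> by (simp add: e0_def powr_powr)
  ultimately have "K \<le> L * (K / (L + 1))" using \<open>L > 0\<close> by (smt (verit) mult_left_mono)
  then show False using \<open>L > 0\<close> \<open>K > 0\<close> by (simp add: field_simps)
qed

lemma kl_sharp_of_second_order_minorant:
  fixes f :: "'a::euclidean_space \<Rightarrow> ereal"
  assumes c: "f xbar = ereal c" and r: "r > 0" "lsc_upto f (cball xbar r) (ereal (c + r))"
    and kl: "kl_property f xbar (1/2)" and minor: "second_order_minorant f xbar h" and w: "0 < h w"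
    and up: "b > 0" "\<And>\<eta>. \<eta> > 0 \<Longrightarrow> \<exists>t w'. 0 < t \<and> t < \<eta> \<and> norm (w' - w) < \<eta> \<and> f (xbar + t *\<^sub>R w') \<le> ereal (c + t\<^sup>2 * b)"
  shows "kl_sharp f xbar (1/2)"
proof -
  obtain b1 where b1: "0 < ereal b1" "ereal b1 < h w" using ereal_dense2[OF w] by blast
  then obtain \<delta> where d: "\<delta> > 0" "\<And>t w'. 0 < t \<Longrightarrow> t < \<delta> \<Longrightarrow> norm (w' - w) < \<delta> \<Longrightarrow> ereal (c + t\<^sup>2 * b1) < f (xbar + t *\<^sub>R w')"
    using minor c unfolding second_order_minorant_def by (metis plus_ereal.simps(1))
  have "\<not> kl_property f xbar \<theta>" if "0 \<le> \<theta>" "\<theta> < 1/2" for \<theta>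
    by (rule no_kl_below_half_of_quadratic_growth[where f = f, OF c r d(1) _ up(1) d(2) up(2) that(2,1)]) (use b1 in auto)
  then show ?thesis using kl by (auto simp: kl_sharp_def)
qed

section \<open>Prox-regular functions with a second-order epi-limit\<close>

text \<open>What the hypotheses on \<open>f\<close> amount to once twice epi-differentiability and subdifferential continuity are
  used: the latter removes the restriction to points with nearby function values from the prox-regularity
  inequality. Isolating these properties pays off because the Moreau envelope of \<open>f\<close> has them again, with
  the envelope of \<open>h\<close> in place of \<open>h\<close>.\<close>

locale epi_quadratic =
  fixes f :: "'a::euclidean_space \<Rightarrow> ereal" and xbar :: 'a and c \<epsilon> \<rho> :: real and h :: "'a \<Rightarrow> ereal"
  assumes fin: "f xbar = ereal c"
    and loc_lsc: "locally_lsc_at f xbar"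
    and zero_sub: "0 \<in> limiting_subdiff f xbar"
    and eps: "\<epsilon> > 0" and rho: "\<rho> \<ge> 0"
    and prox: "\<And>x v x'. v \<in> limiting_subdiff f x \<Longrightarrow> norm (x - xbar) < \<epsilon> \<Longrightarrow> norm v < \<epsilon> \<Longrightarrow>
        x' \<in> cball xbar \<epsilon> \<Longrightarrow> f x + ereal (v \<bullet> (x' - x) - \<rho> / 2 * (norm (x' - x))\<^sup>2) \<le> f x'"
    and minorant: "second_order_minorant f xbar h"
    and recovery: "second_order_recovery f xbar h"
    and nonsing: "set_inv (graphical_deriv (limiting_subdiff f) xbar 0) 0 = {0}"
begin

abbreviation D :: "'a \<Rightarrow> 'a set" where
  "D \<equiv> graphical_deriv (limiting_subdiff f) xbar 0"

lemma growth:
  assumes "x' \<in> cball xbar \<epsilon>"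
  shows "ereal (c - \<rho> / 2 * (norm (x' - xbar))\<^sup>2) \<le> f x'"
  using prox[OF zero_sub _ _ assms] eps fin by simp

lemma lsc_near: "\<exists>r>0. r \<le> \<epsilon> \<and> lsc_upto f (cball xbar r) (ereal (c + r))"
  by (rule lsc_upto_of_quadratic_lower_bound[OF fin loc_lsc eps growth])

lemma minorantD:
  assumes "ereal b < h w"
  obtains \<delta> where "\<delta> > 0" "\<And>t w'. 0 < t \<Longrightarrow> t < \<delta> \<Longrightarrow> norm (w' - w) < \<delta> \<Longrightarrow> ereal (c + t\<^sup>2 * b) < f (xbar + t *\<^sub>R w')"
  using minorant assms fin unfolding second_order_minorant_def by (metis plus_ereal.simps(1))

lemma minorant_seq:
  assumes "ereal b < h w" "\<And>k. t k > 0" "t \<longlonglongrightarrow> 0" "W \<longlonglongrightarrow> w"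
  shows "\<forall>\<^sub>F k in sequentially. ereal (c + (t k)\<^sup>2 * b) < f (xbar + t k *\<^sub>R W k)"
proof -
  obtain \<delta> where d: "\<delta> > 0" "\<And>t w'. 0 < t \<Longrightarrow> t < \<delta> \<Longrightarrow> norm (w' - w) < \<delta> \<Longrightarrow> ereal (c + t\<^sup>2 * b) < f (xbar + t *\<^sub>R w')"
    using minorantD[OF assms(1)] by blast
  show ?thesis using order_tendstoD(2)[OF assms(3) d(1)] tendstoD[OF assms(4) d(1)]
    by eventually_elim (use assms(2) d(2) in \<open>auto simp: dist_norm\<close>)
qed

lemma recoveryE:
  assumes "\<And>k. t k > 0" "t \<longlonglongrightarrow> 0"
  obtains W where "W \<longlonglongrightarrow> w"
    "\<And>b. h w < ereal b \<Longrightarrow> \<forall>\<^sub>F k in sequentially. f (xbar + t k *\<^sub>R W k) < ereal (c + (t k)\<^sup>2 * b)"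
proof -
  have "\<exists>W. W \<longlonglongrightarrow> w \<and> (\<forall>b. h w < ereal b \<longrightarrow>
        (\<forall>\<^sub>F k in sequentially. f (xbar + t k *\<^sub>R W k) < f xbar + ereal ((t k)\<^sup>2 * b)))"
    using recovery assms unfolding second_order_recovery_def by blast
  then show ?thesis using that fin by auto
qed

lemma tends_to_xbar:
  assumes "t \<longlonglongrightarrow> (0::real)" "W \<longlonglongrightarrow> w"
  shows "(\<lambda>k. xbar + t k *\<^sub>R W k) \<longlonglongrightarrow> xbar"
proof -
  have "(\<lambda>k. xbar + t k *\<^sub>R W k) \<longlonglongrightarrow> xbar + 0 *\<^sub>R w" by (intro tendsto_intros assms)
  then show ?thesis by simp
qed

lemma eventually_near_xbar:
  fixes W :: "nat \<Rightarrow> 'a"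
  assumes "t \<longlonglongrightarrow> (0::real)" "W \<longlonglongrightarrow> w" "\<delta> > 0"
  shows "\<forall>\<^sub>F k in sequentially. norm (t k *\<^sub>R W k) < \<delta>"
  using tendstoD[OF tends_to_xbar[OF assms(1,2)] assms(3)] by (simp add: dist_norm)

lemma h_growth: "ereal (- \<rho> / 2 * (norm w)\<^sup>2) \<le> h w"
proof (rule ereal_le_real, rule ccontr)
  fix b assume "h w \<le> ereal b" and neg: "\<not> ereal (- \<rho> / 2 * (norm w)\<^sup>2) \<le> ereal b"
  let ?g = "- \<rho> / 2 * (norm w)\<^sup>2"
  let ?t = "\<lambda>k. inverse (real (Suc k))"
  have b: "b < ?g" using neg by simp
  then obtain b' where b': "b < b'" "b' < ?g" using dense by blast
  then have "h w < ereal b'" using \<open>h w \<le> ereal b\<close> by (meson ereal_less(2) le_less_trans less_ereal.simps(1))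
  obtain W where W: "W \<longlonglongrightarrow> w" "\<forall>\<^sub>F k in sequentially. f (xbar + ?t k *\<^sub>R W k) < ereal (c + (?t k)\<^sup>2 * b')"
    using recoveryE[of ?t w] null_seq_Suc \<open>h w < ereal b'\<close> by blast
  have "(\<lambda>k. - \<rho> / 2 * (norm (W k))\<^sup>2) \<longlonglongrightarrow> ?g" by (intro tendsto_intros W)
  then have "\<forall>\<^sub>F k in sequentially. b' < - \<rho> / 2 * (norm (W k))\<^sup>2" using b'(2) by (rule order_tendstoD)
  moreover have "\<forall>\<^sub>F k in sequentially. norm (?t k *\<^sub>R W k) < \<epsilon>"
    using null_seq_Suc W(1) eps by (intro eventually_near_xbar) auto
  ultimately have "\<forall>\<^sub>F k in sequentially. False" using W(2)
  proof eventually_elim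
    case (elim k)
    have t: "?t k > 0" by simp
    have "ereal (c - \<rho> / 2 * (norm (xbar + ?t k *\<^sub>R W k - xbar))\<^sup>2) \<le> f (xbar + ?t k *\<^sub>R W k)"
      by (rule growth) (use elim in \<open>simp add: dist_norm\<close>)
    also note elim(3)
    finally have "- (\<rho> / 2 * (norm (?t k *\<^sub>R W k))\<^sup>2) < (?t k)\<^sup>2 * b'" by simp
    also have "norm (?t k *\<^sub>R W k) = ?t k * norm (W k)" by simp
    finally have "(?t k)\<^sup>2 * (- \<rho> / 2 * (norm (W k))\<^sup>2) < (?t k)\<^sup>2 * b'" by (simp only: power_mult_distrib) (simp add: mult_ac)
    then show False using elim(1) t by (simp only: mult_less_cancel_left_pos zero_less_power)
  qed
  then show False by simp
qed

lemma h_zero: "h 0 = 0"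
proof (rule antisym)
  show "h 0 \<le> 0"
  proof (rule ccontr)
    assume "\<not> h 0 \<le> 0"
    then obtain b where b: "0 < ereal b" "ereal b < h 0" using ereal_dense2[of 0 "h 0"] by (auto simp: not_le)
    obtain \<delta> where d: "\<delta> > 0" "\<And>t w'. 0 < t \<Longrightarrow> t < \<delta> \<Longrightarrow> norm (w' - 0) < \<delta> \<Longrightarrow> ereal (c + t\<^sup>2 * b) < f (xbar + t *\<^sub>R w')"
      using minorantD[OF b(2)] by blast
    from d(2)[of "\<delta>/2" 0] have "(\<delta>/2)\<^sup>2 * b < 0" using d(1) fin by simp
    then show False using b(1) by (simp add: mult_less_0_iff)
  qed
  show "0 \<le> h 0" using h_growth[of 0] by (simp add: zero_ereal_def)
qed

lemma h_not_minf: "h w \<noteq> -\<infinity>" using h_growth[of w] by auto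

text \<open>If \<open>h\<close> were below \<open>b1\<close> at points close to \<open>x\<close>, recovery sequences there would enter the region in which
  the quotients exceed \<open>b1\<close>.\<close>

lemma h_lsc: "lsc_upto h K M"
  unfolding lsc_upto_def
proof (intro allI impI, elim conjE)
  fix X a x b assume *: "\<forall>k. X k \<in> K \<and> h (X k) \<le> ereal (a k)" "X \<longlonglongrightarrow> x" "a \<longlonglongrightarrow> b"
  show "h x \<le> ereal b"
  proof (rule ccontr)
    assume "\<not> ?thesis"
    then obtain b1 where b1: "b < b1" "ereal b1 < h x" using ereal_dense2[of "ereal b" "h x"] by (auto simp: not_le)
    obtain \<delta> where d: "\<delta> > 0" "\<And>t w'. 0 < t \<Longrightarrow> t < \<delta> \<Longrightarrow> norm (w' - x) < \<delta> \<Longrightarrow> ereal (c + t\<^sup>2 * b1) < f (xbar + t *\<^sub>R w')"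
      using minorantD[OF b1(2)] by blast
    have "\<forall>\<^sub>F k in sequentially. a k < b1 \<and> norm (X k - x) < \<delta>"
      using order_tendstoD(2)[OF *(3) b1(1)] tendstoD[OF *(2) d(1)] by eventually_elim (simp add: dist_norm)
    then obtain k where k: "a k < b1" "norm (X k - x) < \<delta>" using eventually_happens by fastforce
    have hk: "h (X k) < ereal b1" using *(1) k(1) by (meson le_less_trans less_ereal.simps(1))
    let ?t = "\<lambda>k. inverse (real (Suc k))"
    obtain W where W: "W \<longlonglongrightarrow> X k" "\<forall>\<^sub>F j in sequentially. f (xbar + ?t j *\<^sub>R W j) < ereal (c + (?t j)\<^sup>2 * b1)"
      using recoveryE[of ?t "X k"] null_seq_Suc hk by blast
    have "(\<lambda>j. norm (W j - x)) \<longlonglongrightarrow> norm (X k - x)" by (intro tendsto_intros W)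
    then have 1: "\<forall>\<^sub>F j in sequentially. norm (W j - x) < \<delta>" using k(2) by (rule order_tendstoD)
    have 2: "\<forall>\<^sub>F j in sequentially. ?t j < \<delta>" by (rule order_tendstoD(2)[OF conjunct2[OF null_seq_Suc] d(1)])
    have "\<forall>\<^sub>F j in sequentially. False" using 1 2 W(2)
    proof eventually_elim
      case (elim j)
      have "ereal (c + (?t j)\<^sup>2 * b1) < f (xbar + ?t j *\<^sub>R W j)" by (rule d(2)) (use elim in auto)
      then show False using elim(3) by simp
    qed
    then show False by simp
  qed
qed

lemma h_locally_lsc: "locally_lsc_at h 0"
  by (rule lsc_upto_imp_locally_lsc_at[of h 0 0 1]) (auto simp: h_zero zero_ereal_def intro: h_lsc)

text \<open>Replacing the scale \<open>t\<close> by \<open>s * t\<close> multiplies the quotients by \<open>s\<^sup>2\<close> and leaves the points unchanged.\<close>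

lemma h_homogeneous_le:
  assumes "h w = ereal a" "s > 0"
  shows "h (s *\<^sub>R w) \<le> ereal (s\<^sup>2 * a)"
proof (rule ccontr)
  assume "\<not> ?thesis"
  then obtain b where b: "s\<^sup>2 * a < b" "ereal b < h (s *\<^sub>R w)"
    using ereal_dense2[of "ereal (s\<^sup>2 * a)" "h (s *\<^sub>R w)"] by (auto simp: not_le)
  then have "a < b / s\<^sup>2" using assms(2) by (simp add: field_simps)
  then have a: "h w < ereal (b / s\<^sup>2)" using assms(1) by simp
  let ?t = "\<lambda>k. inverse (real (Suc k))"
  have st: "s * ?t k > 0" for k using assms(2) by simp
  have "(\<lambda>k. s * ?t k) \<longlonglongrightarrow> s * 0" by (intro tendsto_intros conjunct2[OF null_seq_Suc])
  then have slim: "(\<lambda>k. s * ?t k) \<longlonglongrightarrow> 0" by simp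
  obtain W where W: "W \<longlonglongrightarrow> w" "\<And>b. h w < ereal b \<Longrightarrow> \<forall>\<^sub>F k in sequentially. f (xbar + (s * ?t k) *\<^sub>R W k) < ereal (c + (s * ?t k)\<^sup>2 * b)"
    using recoveryE[of "\<lambda>k. s * ?t k" w, OF st slim] by blast
  have "(\<lambda>k. s *\<^sub>R W k) \<longlonglongrightarrow> s *\<^sub>R w" by (intro tendsto_intros W)
  then have "\<forall>\<^sub>F k in sequentially. ereal (c + (?t k)\<^sup>2 * b) < f (xbar + ?t k *\<^sub>R (s *\<^sub>R W k))"
    by (intro minorant_seq[OF b(2)]) (use null_seq_Suc in auto)
  with W(2)[OF a] have "\<forall>\<^sub>F k in sequentially. False"
  proof eventually_elim
    case (elim k)
    have "(s * ?t k)\<^sup>2 * (b / s\<^sup>2) = (?t k)\<^sup>2 * b" using assms(2) by (simp add: power_mult_distrib)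
    then show ?case using elim by (simp add: mult.commute)
  qed
  then show False by simp
qed

text \<open>Along points of the graph of the subdifferential, the epi-limit is a limit. The minorant property bounds
  the quotients \<open>A k\<close> asymptotically from below by \<open>h w\<close>. For the upper bound, the prox-regularity inequality
  at \<open>xbar + t k *\<^sub>R W k\<close> compares \<open>A k\<close> with the quotient at any other point; a recovery sequence for \<open>w\<close>
  yields \<open>h w\<close> as upper limit, and one for an arbitrary \<open>w'\<close> yields the inequality that makes \<open>z\<close> a
  proximal subgradient of \<open>h\<close> with the global constant \<open>\<rho> / 2\<close>.\<close>

lemma graph_limit:
  assumes t: "\<And>k. t k > 0" and tl: "t \<longlonglongrightarrow> 0" and W: "W \<longlonglongrightarrow> w" and Z: "Z \<longlonglongrightarrow> z"
    and sub: "\<And>k. t k *\<^sub>R Z k \<in> limiting_subdiff f (xbar + t k *\<^sub>R W k)"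
  shows "\<exists>a A. h w = ereal a \<and> A \<longlonglongrightarrow> a \<and> (\<forall>k. f (xbar + t k *\<^sub>R W k) = ereal (c + (t k)\<^sup>2 * A k)) \<and>
    (\<forall>w' b. h w' \<le> ereal b \<longrightarrow> a + z \<bullet> (w' - w) - \<rho> / 2 * (norm (w' - w))\<^sup>2 \<le> b)"
proof -
  define A where "A k = (real_of_ereal (f (xbar + t k *\<^sub>R W k)) - c) / (t k)\<^sup>2" for k
  have fA: "f (xbar + t k *\<^sub>R W k) = ereal (c + (t k)\<^sup>2 * A k)" for k
    using limiting_subdiff_finite[OF sub[of k]] t[of k] by (auto simp: A_def)
  have low: "\<forall>\<^sub>F k in sequentially. b < A k" if "ereal b < h w" for b
    using minorant_seq[OF that t tl W]
  proof eventually_elim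
    case (elim k)
    then show ?case using t[of k] by (simp add: fA mult_less_cancel_left_pos)
  qed
  \<comment> \<open>\<open>E k\<close> is the increment that the prox-regularity inequality predicts, divided by \<open>(t k)\<^sup>2\<close>\<close>
  have up: "\<exists>E. E \<longlonglongrightarrow> z \<bullet> (w' - w) - \<rho> / 2 * (norm (w' - w))\<^sup>2 \<and>
      (\<forall>b. h w' < ereal b \<longrightarrow> (\<forall>\<^sub>F k in sequentially. A k + E k < b))" for w'
  proof -
    obtain W' where W': "W' \<longlonglongrightarrow> w'"
      "\<And>b. h w' < ereal b \<Longrightarrow> \<forall>\<^sub>F k in sequentially. f (xbar + t k *\<^sub>R W' k) < ereal (c + (t k)\<^sup>2 * b)"
      using recoveryE[of t w', OF t tl] by blast
    define E where "E k = Z k \<bullet> (W' k - W k) - \<rho> / 2 * (norm (W' k - W k))\<^sup>2" for k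
    have "E \<longlonglongrightarrow> z \<bullet> (w' - w) - \<rho> / 2 * (norm (w' - w))\<^sup>2"
      unfolding E_def by (intro tendsto_intros Z W W')
    moreover have "\<forall>\<^sub>F k in sequentially. A k + E k < b" if "h w' < ereal b" for b
      using W'(2)[OF that] eventually_near_xbar[OF tl W eps] eventually_near_xbar[OF tl W'(1) eps] eventually_near_xbar[OF tl Z eps]
    proof eventually_elim
      case (elim k)
      have d: "xbar + t k *\<^sub>R W' k - (xbar + t k *\<^sub>R W k) = t k *\<^sub>R (W' k - W k)" by (simp add: algebra_simps)
      have n: "(norm (t k *\<^sub>R (W' k - W k)))\<^sup>2 = (t k)\<^sup>2 * (norm (W' k - W k))\<^sup>2" by (simp add: power_mult_distrib)
      have "f (xbar + t k *\<^sub>R W k) + ereal ((t k *\<^sub>R Z k) \<bullet> (t k *\<^sub>R (W' k - W k)) - \<rho> / 2 * (norm (t k *\<^sub>R (W' k - W k)))\<^sup>2)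
          \<le> f (xbar + t k *\<^sub>R W' k)"
        using prox[OF sub[of k], of "xbar + t k *\<^sub>R W' k"] elim unfolding d by (simp add: dist_norm)
      also note elim(1)
      finally have "c + (t k)\<^sup>2 * A k + ((t k)\<^sup>2 * (Z k \<bullet> (W' k - W k)) - \<rho> / 2 * ((t k)\<^sup>2 * (norm (W' k - W k))\<^sup>2)) < c + (t k)\<^sup>2 * b"
        unfolding fA n by (simp add: power2_eq_square mult.assoc)
      then have "(t k)\<^sup>2 * (A k + E k) < (t k)\<^sup>2 * b" unfolding E_def by (simp add: algebra_simps)
      then show ?case using t[of k] by (simp add: mult_less_cancel_left_pos)
    qed
    ultimately show ?thesis by blast
  qed
  \<comment> \<open>a recovery sequence for \<open>0\<close>, where \<open>h\<close> vanishes, keeps the quotients bounded\<close>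
  have "h w \<noteq> \<infinity>"
  proof
    assume inf: "h w = \<infinity>"
    obtain E where E: "E \<longlonglongrightarrow> z \<bullet> (0 - w) - \<rho> / 2 * (norm (0 - w))\<^sup>2" "\<forall>\<^sub>F k in sequentially. A k + E k < 1"
      using up[of 0] h_zero by auto
    let ?l = "z \<bullet> (0 - w) - \<rho> / 2 * (norm (0 - w))\<^sup>2"
    have "\<forall>\<^sub>F k in sequentially. ?l - 1 < E k" using E(1) by (rule order_tendstoD) simp
    moreover have "\<forall>\<^sub>F k in sequentially. 2 - ?l < A k" by (rule low) (simp add: inf)
    ultimately have "\<forall>\<^sub>F k in sequentially. False" using E(2) by eventually_elim simp
    then show False by simp
  qed
  then obtain a where a: "h w = ereal a" using h_not_minf by (cases "h w") auto
  have "A \<longlonglongrightarrow> a"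
  proof (rule order_tendstoI)
    fix b assume "b < a" then show "\<forall>\<^sub>F k in sequentially. b < A k" by (intro low) (simp add: a)
  next
    fix b assume "a < b"
    obtain E where E: "E \<longlonglongrightarrow> z \<bullet> (w - w) - \<rho> / 2 * (norm (w - w))\<^sup>2"
      "\<And>b. h w < ereal b \<Longrightarrow> \<forall>\<^sub>F k in sequentially. A k + E k < b" using up[of w] by blast
    have "\<forall>\<^sub>F k in sequentially. (a - b) / 2 < E k"
      by (rule order_tendstoD(1)[OF E(1)]) (use \<open>a < b\<close> in simp)
    moreover have "\<forall>\<^sub>F k in sequentially. A k + E k < (a + b) / 2" by (rule E(2)) (use \<open>a < b\<close> in \<open>simp add: a\<close>)
    ultimately show "\<forall>\<^sub>F k in sequentially. A k < b" by eventually_elim (simp add: field_simps)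
  qed
  moreover have "a + z \<bullet> (w' - w) - \<rho> / 2 * (norm (w' - w))\<^sup>2 \<le> b" if b: "h w' \<le> ereal b" for w' b
  proof (rule field_le_epsilon)
    fix e :: real assume "e > 0"
    then have e: "h w' < ereal (b + e)" using b by (meson le_less_trans less_add_same_cancel1 less_ereal.simps(1))
    obtain E where E: "E \<longlonglongrightarrow> z \<bullet> (w' - w) - \<rho> / 2 * (norm (w' - w))\<^sup>2"
      "\<forall>\<^sub>F k in sequentially. A k + E k < b + e" using up[of w'] e by blast
    from tendsto_add[OF \<open>A \<longlonglongrightarrow> a\<close> E(1)]
    have "(\<lambda>k. A k + E k) \<longlonglongrightarrow> a + z \<bullet> (w' - w) - \<rho> / 2 * (norm (w' - w))\<^sup>2" by (simp add: add_diff_eq)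
    then show "a + z \<bullet> (w' - w) - \<rho> / 2 * (norm (w' - w))\<^sup>2 \<le> b + e"
      by (rule tendsto_upperbound) (use E(2) in \<open>auto elim: eventually_mono\<close>)
  qed
  ultimately show ?thesis using a fA by blast
qed

lemma D_seq:
  assumes "z \<in> D w"
  obtains t W Z where "\<And>k. t k > 0" "t \<longlonglongrightarrow> 0" "W \<longlonglongrightarrow> w" "Z \<longlonglongrightarrow> z"
    "\<And>k. t k *\<^sub>R Z k \<in> limiting_subdiff f (xbar + t k *\<^sub>R W k)"
  using assms unfolding graphical_deriv_seq by auto

lemma D_prox_ineq:
  assumes "z \<in> D w"
  shows "\<exists>a. h w = ereal a \<and> (\<forall>w' b. h w' \<le> ereal b \<longrightarrow> a + z \<bullet> (w' - w) - \<rho> / 2 * (norm (w' - w))\<^sup>2 \<le> b)"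
  using D_seq[OF assms] graph_limit by metis

lemma D_subset_regular: "D w \<subseteq> regular_subdiff h w"
proof
  fix z assume "z \<in> D w"
  then obtain a where a: "h w = ereal a"
    and P: "\<And>w' b. h w' \<le> ereal b \<Longrightarrow> a + z \<bullet> (w' - w) - \<rho> / 2 * (norm (w' - w))\<^sup>2 \<le> b"
    using D_prox_ineq by blast
  show "z \<in> regular_subdiff h w"
  proof (rule proximal_subgradient[where \<phi> = h, OF a])
    show "ereal (a + z \<bullet> (y - w) - \<rho> / 2 * (norm (y - w))\<^sup>2) \<le> h y" for y
    proof (rule ereal_le_real)
      fix b assume "h y \<le> ereal b"
      from P[OF this] show "ereal (a + z \<bullet> (y - w) - \<rho> / 2 * (norm (y - w))\<^sup>2) \<le> ereal b" by simp
    qed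
  qed (rule zero_less_one)
qed

text \<open>Along the ray \<open>(1 + e) *\<^sub>R w\<close> homogeneity and the proximal inequality give
  \<open>e * (z \<bullet> w - 2 * h w) \<le> e\<^sup>2 * K\<close> for small \<open>e\<close> of either sign.\<close>

lemma euler:
  assumes "z \<in> D w"
  shows "h w = ereal (z \<bullet> w / 2)"
proof -
  obtain a where a: "h w = ereal a"
    and P: "\<And>w' b. h w' \<le> ereal b \<Longrightarrow> a + z \<bullet> (w' - w) - \<rho> / 2 * (norm (w' - w))\<^sup>2 \<le> b"
    using D_prox_ineq[OF assms] by blast
  define q where "q = z \<bullet> w - 2 * a"
  define K where "K = a + \<rho> / 2 * (norm w)\<^sup>2"
  have ineq: "e * q \<le> e * (e * K)" if "e > -1" for e
  proof -
    have "h ((1 + e) *\<^sub>R w) \<le> ereal ((1 + e)\<^sup>2 * a)" by (rule h_homogeneous_le[OF a]) (use that in simp)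
    from P[OF this] have "a + z \<bullet> (e *\<^sub>R w) - \<rho> / 2 * (norm (e *\<^sub>R w))\<^sup>2 \<le> (1 + e)\<^sup>2 * a" by (simp add: algebra_simps)
    then show ?thesis by (simp add: q_def K_def power_mult_distrib power2_eq_square algebra_simps)
  qed
  have "q \<le> 0"
  proof (rule tendsto_lowerbound)
    show "((\<lambda>e. e * K) \<longlongrightarrow> 0) (at_right 0)" by (auto intro!: tendsto_eq_intros)
    have "q \<le> e * K" if "0 < e" for e using ineq[of e] that by (simp add: mult_le_cancel_left)
    then show "\<forall>\<^sub>F e in at_right 0. q \<le> e * K"
      unfolding eventually_at_right_field by (intro exI[of _ 1]) auto
  qed simp
  moreover have "q \<ge> 0"
  proof (rule tendsto_upperbound)
    show "((\<lambda>e. e * K) \<longlongrightarrow> 0) (at_left 0)" by (auto intro!: tendsto_eq_intros)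
    have "e * K \<le> q" if "-1 < e" "e < 0" for e using ineq[of e] that by (simp add: mult_le_cancel_left)
    then show "\<forall>\<^sub>F e in at_left 0. e * K \<le> q"
      unfolding eventually_at_left_field by (intro exI[of _ "-1"]) auto
  qed simp
  ultimately show ?thesis using a by (simp add: q_def)
qed

text \<open>With the penalty \<open>(\<alpha> + 1) * (norm (w' - w))\<^sup>2\<close> instead of \<open>\<alpha> * (norm (w' - w))\<^sup>2\<close> the point \<open>w\<close> becomes the only
  minimiser of \<open>h - \<langle>z, \<cdot>\<rangle>\<close> plus penalty on the ball. Minimisers of the correspondingly penalised quotients
  therefore accumulate only at \<open>w\<close>, and the subgradients of \<open>f\<close> they carry, divided by \<open>t\<close>, tend to
  \<open>z\<close>.\<close>

lemma proximal_subgradient_in_D: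
  assumes a: "h w = ereal a" and "r > 0" "\<alpha> \<ge> 0"
    and P: "\<And>w' b. norm (w' - w) \<le> r \<Longrightarrow> h w' \<le> ereal b \<Longrightarrow> a + z \<bullet> (w' - w) - \<alpha> * (norm (w' - w))\<^sup>2 \<le> b"
  shows "z \<in> D w"
proof -
  obtain t :: "nat \<Rightarrow> real" where tl: "t \<longlonglongrightarrow> 0" and tp: "\<And>k. t k > 0" using null_seq_Suc by blast
  obtain R where R: "R > 0" "R \<le> \<epsilon>" "lsc_upto f (cball xbar R) (ereal (c + R))" using lsc_near by blast
  obtain V where V: "V \<longlonglongrightarrow> w"
    "\<And>b. h w < ereal b \<Longrightarrow> \<forall>\<^sub>F k in sequentially. f (xbar + t k *\<^sub>R V k) < ereal (c + (t k)\<^sup>2 * b)"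
    using recoveryE[of t w, OF tp tl] by blast
  define q where "q b u = b - z \<bullet> (u - w) + (\<alpha> + 1) * (norm (u - w))\<^sup>2" for b u
  have "\<forall>\<^sub>F k in sequentially. \<exists>u b. norm (u - w) \<le> r \<and> f (xbar + t k *\<^sub>R u) = ereal (c + (t k)\<^sup>2 * b) \<and>
    (\<forall>u' b'. norm (u' - w) \<le> r \<and> f (xbar + t k *\<^sub>R u') \<le> ereal (c + (t k)\<^sup>2 * b') \<longrightarrow> q b u \<le> q b' u') \<and>
    (norm (u - w) \<le> r / 2 \<longrightarrow> t k *\<^sub>R (z - (2 * (\<alpha> + 1)) *\<^sub>R (u - w)) \<in> limiting_subdiff f (xbar + t k *\<^sub>R u))"
  proof -
    have "(\<lambda>k. t k * (norm w + r)) \<longlonglongrightarrow> 0 * (norm w + r)" by (intro tendsto_intros tl)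
    then have 1: "\<forall>\<^sub>F k in sequentially. t k * (norm w + r) < R" by (rule order_tendstoD) (use R in simp)
    have "(\<lambda>k. (t k)\<^sup>2 * (q (a + 1) (V k) + norm z * r)) \<longlonglongrightarrow> 0\<^sup>2 * (q (a + 1) w + norm z * r)"
      unfolding q_def by (intro tendsto_intros tl V)
    then have 2: "\<forall>\<^sub>F k in sequentially. (t k)\<^sup>2 * (q (a + 1) (V k) + norm z * r) < R"
      by (rule order_tendstoD) (use R in simp)
    have 3: "\<forall>\<^sub>F k in sequentially. f (xbar + t k *\<^sub>R V k) < ereal (c + (t k)\<^sup>2 * (a + 1))" by (rule V(2)) (simp add: a)
    have 4: "\<forall>\<^sub>F k in sequentially. norm (V k - w) < r" using tendstoD[OF V(1) \<open>r > 0\<close>] by (simp add: dist_norm)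
    show ?thesis using 1 2 3 4
    proof eventually_elim
      case (elim k)
      have near: "norm (t k *\<^sub>R u) \<le> R" if "norm (u - w) \<le> r" for u
      proof -
        have "norm u \<le> norm w + r" using that norm_triangle_ineq[of "u - w" w] by simp
        then have "t k * norm u \<le> t k * (norm w + r)" using tp[of k] by (intro mult_left_mono) auto
        then have "t k * norm u \<le> R" using elim(1) by linarith
        then show ?thesis using tp[of k] by simp
      qed
      show ?case unfolding q_def
      proof (rule scaled_quadratic_minimizer[where f = f and xbar = xbar, OF R(3) tp \<open>r > 0\<close>])
        show "0 \<le> \<alpha> + 1" using \<open>\<alpha> \<ge> 0\<close> by simp
        show "xbar + t k *\<^sub>R u \<in> cball xbar R" if "norm (u - w) \<le> r" for u using near[OF that] by (simp add: dist_norm)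
        show "ereal (c - \<rho> / 2 * R\<^sup>2) \<le> f (xbar + t k *\<^sub>R u)" if u: "norm (u - w) \<le> r" for u
        proof -
          have "(norm (t k *\<^sub>R u))\<^sup>2 \<le> R\<^sup>2" using near[OF u] by (intro power_mono) auto
          then have "\<rho> / 2 * (norm (t k *\<^sub>R u))\<^sup>2 \<le> \<rho> / 2 * R\<^sup>2" using rho by (intro mult_left_mono) auto
          then have "ereal (c - \<rho> / 2 * R\<^sup>2) \<le> ereal (c - \<rho> / 2 * (norm (xbar + t k *\<^sub>R u - xbar))\<^sup>2)" by simp
          also have "\<dots> \<le> f (xbar + t k *\<^sub>R u)" by (rule growth) (use near[OF u] R in \<open>simp add: dist_norm\<close>)
          finally show ?thesis .
        qed
        show "norm (V k - w) \<le> r" using elim(4) by simp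
        show "f (xbar + t k *\<^sub>R V k) \<le> ereal (c + (t k)\<^sup>2 * (a + 1))" using elim(3) by simp
        show "ereal (c + (t k)\<^sup>2 * (a + 1 - z \<bullet> (V k - w) + (\<alpha> + 1) * (norm (V k - w))\<^sup>2 + norm z * r)) < ereal (c + R)"
          using elim(2) by (simp add: q_def)
      qed
    qed
  qed
  then obtain N where N: "\<And>k. k \<ge> N \<Longrightarrow> \<exists>u b. norm (u - w) \<le> r \<and> f (xbar + t k *\<^sub>R u) = ereal (c + (t k)\<^sup>2 * b) \<and>
    (\<forall>u' b'. norm (u' - w) \<le> r \<and> f (xbar + t k *\<^sub>R u') \<le> ereal (c + (t k)\<^sup>2 * b') \<longrightarrow> q b u \<le> q b' u') \<and>
    (norm (u - w) \<le> r / 2 \<longrightarrow> t k *\<^sub>R (z - (2 * (\<alpha> + 1)) *\<^sub>R (u - w)) \<in> limiting_subdiff f (xbar + t k *\<^sub>R u))"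
    unfolding eventually_sequentially by blast
  obtain U B where U: "\<And>k. norm (U k - w) \<le> r" and B: "\<And>k. f (xbar + t (k + N) *\<^sub>R U k) = ereal (c + (t (k + N))\<^sup>2 * B k)"
    and min: "\<And>k u' b'. norm (u' - w) \<le> r \<Longrightarrow> f (xbar + t (k + N) *\<^sub>R u') \<le> ereal (c + (t (k + N))\<^sup>2 * b') \<Longrightarrow> q (B k) (U k) \<le> q b' u'"
    and sub: "\<And>k. norm (U k - w) \<le> r / 2 \<Longrightarrow>
      t (k + N) *\<^sub>R (z - (2 * (\<alpha> + 1)) *\<^sub>R (U k - w)) \<in> limiting_subdiff f (xbar + t (k + N) *\<^sub>R U k)"
    using N[OF le_add2] by metis
  have "norm (U k) \<le> r + norm w" for k using U[of k] norm_triangle_ineq[of "U k - w" w] by simp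
  then obtain u \<sigma> where \<sigma>: "strict_mono \<sigma>" and Ul: "(U \<circ> \<sigma>) \<longlonglongrightarrow> u" using bounded_subseq[of U "r + norm w"] by blast
  define s where "s k = t (\<sigma> k + N)" for k
  have sp: "s k > 0" for k using tp by (simp add: s_def)
  have sl: "s \<longlonglongrightarrow> 0"
    using LIMSEQ_subseq_LIMSEQ[OF LIMSEQ_ignore_initial_segment[OF tl, of N] \<sigma>] unfolding s_def o_def .
  have Ul': "(\<lambda>k. U (\<sigma> k)) \<longlonglongrightarrow> u" using Ul by (simp add: o_def)
  have "norm (u - w) \<le> r"
    by (rule tendsto_upperbound[OF tendsto_norm[OF tendsto_diff[OF Ul' tendsto_const]]]) (use U in auto)
  have Vs: "(\<lambda>k. V (\<sigma> k + N)) \<longlonglongrightarrow> w"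
    using LIMSEQ_subseq_LIMSEQ[OF LIMSEQ_ignore_initial_segment[OF V(1), of N] \<sigma>] by (simp add: o_def)
  \<comment> \<open>minimality against the recovery sequence \<open>V\<close> of \<open>w\<close> bounds \<open>h\<close> at the cluster point \<open>u\<close>\<close>
  have hu: "h u \<le> ereal (a + z \<bullet> (u - w) - (\<alpha> + 1) * (norm (u - w))\<^sup>2)" (is "_ \<le> ereal ?a")
  proof (rule ccontr)
    assume "\<not> ?thesis"
    then obtain b where b: "?a < b" "ereal b < h u" using ereal_dense2[of "ereal ?a" "h u"] by (auto simp: not_le)
    define e where "e = (b - ?a) / 2"
    have "e > 0" using b(1) by (simp add: e_def)
    have 1: "\<forall>\<^sub>F k in sequentially. ereal (c + (s k)\<^sup>2 * b) < f (xbar + s k *\<^sub>R U (\<sigma> k))"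
      by (rule minorant_seq[OF b(2) sp sl Ul'])
    have "\<forall>\<^sub>F k in sequentially. f (xbar + t k *\<^sub>R V k) < ereal (c + (t k)\<^sup>2 * (a + e))"
      by (rule V(2)) (simp add: a \<open>e > 0\<close>)
    then have "\<forall>\<^sub>F k in sequentially. f (xbar + t (k + N) *\<^sub>R V (k + N)) < ereal (c + (t (k + N))\<^sup>2 * (a + e))"
      by (rule sequentially_offset)
    from eventually_subseq[OF \<sigma> this]
    have 2: "\<forall>\<^sub>F k in sequentially. f (xbar + s k *\<^sub>R V (\<sigma> k + N)) < ereal (c + (s k)\<^sup>2 * (a + e))" by (simp add: s_def)
    have 3: "\<forall>\<^sub>F k in sequentially. norm (V (\<sigma> k + N) - w) < r" using tendstoD[OF Vs \<open>r > 0\<close>] by (simp add: dist_norm)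
    have "(\<lambda>k. q 0 (V (\<sigma> k + N)) - q 0 (U (\<sigma> k))) \<longlonglongrightarrow> q 0 w - q 0 u" unfolding q_def by (intro tendsto_intros Ul' Vs)
    then have 4: "\<forall>\<^sub>F k in sequentially. q 0 (V (\<sigma> k + N)) - q 0 (U (\<sigma> k)) < q 0 w - q 0 u + e"
      by (rule order_tendstoD) (use \<open>e > 0\<close> in simp)
    have "\<forall>\<^sub>F k in sequentially. False" using 1 2 3 4
    proof eventually_elim
      case (elim k)
      have "q (B (\<sigma> k)) (U (\<sigma> k)) \<le> q (a + e) (V (\<sigma> k + N))"
        by (rule min) (use elim(2,3) in \<open>simp_all add: s_def less_imp_le\<close>)
      moreover have "(s k)\<^sup>2 * b < (s k)\<^sup>2 * B (\<sigma> k)" using elim(1) B[of "\<sigma> k"] by (simp add: s_def)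
      then have "b < B (\<sigma> k)" using sp[of k] by (simp add: mult_less_cancel_left_pos)
      moreover have "2 * e = b - ?a" by (simp add: e_def)
      ultimately show False using elim(4) unfolding q_def by simp
    qed
    then show False by simp
  qed
  have "a + z \<bullet> (u - w) - \<alpha> * (norm (u - w))\<^sup>2 \<le> a + z \<bullet> (u - w) - (\<alpha> + 1) * (norm (u - w))\<^sup>2"
    by (rule P[OF \<open>norm (u - w) \<le> r\<close> hu])
  then have "(norm (u - w))\<^sup>2 \<le> 0" by (simp add: algebra_simps)
  then have "u = w" by simp
  have "(\<lambda>k. z - (2 * (\<alpha> + 1)) *\<^sub>R (U (\<sigma> k) - w)) \<longlonglongrightarrow> z - (2 * (\<alpha> + 1)) *\<^sub>R (u - w)" by (intro tendsto_intros Ul')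
  then have Yl: "(\<lambda>k. z - (2 * (\<alpha> + 1)) *\<^sub>R (U (\<sigma> k) - w)) \<longlonglongrightarrow> z" using \<open>u = w\<close> by simp
  show ?thesis
  proof (rule graphical_deriv_eventuallyI[OF sp sl _ Yl])
    show "(\<lambda>k. U (\<sigma> k)) \<longlonglongrightarrow> w" using Ul' \<open>u = w\<close> by simp
    have "\<forall>\<^sub>F k in sequentially. norm (U (\<sigma> k) - w) < r / 2"
      using tendstoD[OF Ul', of "r/2"] \<open>r > 0\<close> \<open>u = w\<close> by (simp add: dist_norm)
    then show "\<forall>\<^sub>F k in sequentially. 0 + s k *\<^sub>R (z - (2 * (\<alpha> + 1)) *\<^sub>R (U (\<sigma> k) - w)) \<in> limiting_subdiff f (xbar + s k *\<^sub>R U (\<sigma> k))"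
      by eventually_elim (use sub in \<open>simp add: s_def\<close>)
  qed
qed

end

section \<open>The normalised slopes of a cone-valued map\<close>

text \<open>For the graphical derivative \<open>D\<close> of \<open>\<partial>f\<close>, the slopes at the base point of the root of the gap of \<open>f\<close>
  (\<open>lam = 0\<close>) and of its Moreau envelope (\<open>lam > 0\<close>).\<close>

definition root_slopes :: "('a::real_inner \<Rightarrow> 'a set) \<Rightarrow> real \<Rightarrow> 'a set" where
  "root_slopes D lam = {v /\<^sub>R sqrt (2 * (v \<bullet> w) + 2 * lam * (norm v)\<^sup>2) | v w.
     v \<in> D w \<and> v \<bullet> w + lam * (norm v)\<^sup>2 > 0}"

locale closed_cone_map =
  fixes D :: "'a::euclidean_space \<Rightarrow> 'a set" and \<sigma> :: real
  assumes cone: "\<And>v w s. v \<in> D w \<Longrightarrow> s > 0 \<Longrightarrow> s *\<^sub>R v \<in> D (s *\<^sub>R w)"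
    and closed_graph: "\<And>V W v w. (\<And>k::nat. V k \<in> D (W k)) \<Longrightarrow> W \<longlonglongrightarrow> w \<Longrightarrow> V \<longlonglongrightarrow> v \<Longrightarrow> v \<in> D w"
    and bound: "\<And>v w. v \<in> D w \<Longrightarrow> norm w \<le> \<sigma> * norm v" and \<sigma>_nonneg: "\<sigma> \<ge> 0"
begin

text \<open>A slope does not change when \<open>(w, v)\<close> is multiplied by a positive factor, so the square root can be
  normalised to \<open>1\<close>.\<close>

lemma root_slopes_iff:
  "u \<in> root_slopes D lam \<longleftrightarrow> (\<exists>w. u \<in> D w \<and> 2 * (u \<bullet> w) + 2 * lam * (norm u)\<^sup>2 = 1)" (is "?L \<longleftrightarrow> ?R")
proof
  assume ?L
  then obtain v w where u: "u = v /\<^sub>R sqrt (2 * (v \<bullet> w) + 2 * lam * (norm v)\<^sup>2)" and v: "v \<in> D w"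
    and pos: "v \<bullet> w + lam * (norm v)\<^sup>2 > 0" unfolding root_slopes_def by blast
  define N where "N = sqrt (2 * (v \<bullet> w) + 2 * lam * (norm v)\<^sup>2)"
  have N2: "N\<^sup>2 = 2 * (v \<bullet> w) + 2 * lam * (norm v)\<^sup>2" and N: "N > 0" using pos by (auto simp: N_def)
  have u': "u = (1 / N) *\<^sub>R v" by (simp add: u N_def inverse_eq_divide)
  have "u \<in> D ((1 / N) *\<^sub>R w)" unfolding u' by (rule cone[OF v]) (use N in simp)
  moreover have "2 * (u \<bullet> ((1 / N) *\<^sub>R w)) + 2 * lam * (norm u)\<^sup>2 = (2 * (v \<bullet> w) + 2 * lam * (norm v)\<^sup>2) / N\<^sup>2"
    unfolding u' using N by (simp add: power2_eq_square add_divide_distrib)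
  ultimately show ?R using N N2 by (metis divide_self less_irrefl zero_less_power)
next
  assume ?R
  then obtain w where w: "u \<in> D w" "2 * (u \<bullet> w) + 2 * lam * (norm u)\<^sup>2 = 1" by blast
  then have "u = u /\<^sub>R sqrt (2 * (u \<bullet> w) + 2 * lam * (norm u)\<^sup>2)" "u \<bullet> w + lam * (norm u)\<^sup>2 > 0" by auto
  then show ?L unfolding root_slopes_def using w(1) by blast
qed

text \<open>In the normalised form the points \<open>w\<close> belonging to a bounded sequence of slopes are bounded by the
  estimate \<open>norm w \<le> \<sigma> * norm u\<close>, so they have a cluster point, and the graph of \<open>D\<close> is closed.\<close>

lemma root_slopes_limit:
  assumes u: "\<And>k. U k \<in> root_slopes D (L k)" and L: "L \<longlonglongrightarrow> 0" and ul: "U \<longlonglongrightarrow> u"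
  shows "u \<in> root_slopes D 0"
proof -
  obtain W where W: "\<And>k. U k \<in> D (W k)" and eq: "\<And>k. 2 * (U k \<bullet> W k) + 2 * L k * (norm (U k))\<^sup>2 = 1"
    using u unfolding root_slopes_iff by metis
  obtain B where B: "\<And>k. norm (U k) \<le> B" using convergent_imp_bounded[OF ul] by (auto simp: bounded_iff)
  have "norm (W k) \<le> \<sigma> * B" for k
    using bound[OF W[of k]] mult_left_mono[OF B[of k] \<sigma>_nonneg] by linarith
  then obtain w r where r: "strict_mono r" and Wl: "(W \<circ> r) \<longlonglongrightarrow> w" using bounded_subseq[of W] by blast
  have Wl': "(\<lambda>k. W (r k)) \<longlonglongrightarrow> w" using Wl by (simp add: o_def)
  have Ur: "(\<lambda>k. U (r k)) \<longlonglongrightarrow> u" using LIMSEQ_subseq_LIMSEQ[OF ul r] by (simp add: o_def)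
  have Lr: "(\<lambda>k. L (r k)) \<longlonglongrightarrow> 0" using LIMSEQ_subseq_LIMSEQ[OF L r] by (simp add: o_def)
  have "u \<in> D w" using W by (intro closed_graph[OF _ Wl' Ur])
  moreover have "(\<lambda>k. 2 * (U (r k) \<bullet> W (r k)) + 2 * L (r k) * (norm (U (r k)))\<^sup>2) \<longlonglongrightarrow> 2 * (u \<bullet> w) + 2 * 0 * (norm u)\<^sup>2"
    by (intro tendsto_intros Ur Lr Wl')
  then have "2 * (u \<bullet> w) + 2 * 0 * (norm u)\<^sup>2 = 1" unfolding eq using LIMSEQ_const_iff by metis
  ultimately show ?thesis unfolding root_slopes_iff by blast
qed

text \<open>For a normalised slope, \<open>1 = 2 * (u \<bullet> w) + 2 * lam * (norm u)\<^sup>2 \<le> (2 * \<sigma> + 2 * lam) * (norm u)\<^sup>2\<close>. If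
  \<open>\<sigma> = lam = 0\<close>, there is no slope at all, and both sides are infinite.\<close>

lemma edist_root_slopes_bound:
  assumes "lam \<ge> 0"
  shows "esqrt (1 / (ereal (2 * lam) + 2 * ereal \<sigma>)) \<le> edist 0 (root_slopes D lam)"
    and "0 < esqrt (1 / (ereal (2 * lam) + 2 * ereal \<sigma>))"
proof -
  have le: "1 \<le> (2 * lam + 2 * \<sigma>) * (norm u)\<^sup>2" if "u \<in> root_slopes D lam" for u
  proof -
    obtain w where w: "u \<in> D w" "2 * (u \<bullet> w) + 2 * lam * (norm u)\<^sup>2 = 1" using root_slopes_iff \<open>u \<in> _\<close> by blast
    have "u \<bullet> w \<le> norm u * norm w" by (rule norm_cauchy_schwarz)
    also have "\<dots> \<le> norm u * (\<sigma> * norm u)" using bound[OF w(1)] by (intro mult_left_mono) auto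
    finally show ?thesis using w(2) by (simp add: power2_eq_square algebra_simps)
  qed
  have e: "ereal (2 * lam) + 2 * ereal \<sigma> = ereal (2 * lam + 2 * \<sigma>)" by simp
  have "esqrt (1 / ereal (2 * lam + 2 * \<sigma>)) \<le> edist 0 (root_slopes D lam) \<and> 0 < esqrt (1 / ereal (2 * lam + 2 * \<sigma>))"
  proof (cases "2 * lam + 2 * \<sigma> = 0")
    case True
    have "root_slopes D lam = {}"
    proof (rule ccontr)
      assume "root_slopes D lam \<noteq> {}"
      then obtain u where "u \<in> root_slopes D lam" by blast
      from le[OF this] show False unfolding True by simp
    qed
    then have "edist 0 (root_slopes D lam) = \<infinity>" by (simp add: edist_def top_ereal_def)
    moreover have "esqrt (1 / ereal (2 * lam + 2 * \<sigma>)) = \<infinity>"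
      unfolding True by (simp add: esqrt_def divide_ereal_def zero_ereal_def[symmetric])
    ultimately show ?thesis by simp
  next
    case False
    then have q: "2 * lam + 2 * \<sigma> > 0" using assms \<sigma>_nonneg by linarith
    then have v: "esqrt (1 / ereal (2 * lam + 2 * \<sigma>)) = ereal (sqrt (1 / (2 * lam + 2 * \<sigma>)))"
      by (simp add: esqrt_def one_ereal_def)
    have "sqrt (1 / (2 * lam + 2 * \<sigma>)) \<le> norm u" if "u \<in> root_slopes D lam" for u
      by (rule real_le_lsqrt) (use le[OF that] q in \<open>auto simp: field_simps\<close>)
    then show ?thesis unfolding v edist_zero_ge_iff using q by simp
  qed
  then show "esqrt (1 / (ereal (2 * lam) + 2 * ereal \<sigma>)) \<le> edist 0 (root_slopes D lam)"
    and "0 < esqrt (1 / (ereal (2 * lam) + 2 * ereal \<sigma>))" unfolding e by auto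
qed

text \<open>Increasing \<open>lam\<close> increases the denominator belonging to a fixed pair \<open>(w, v)\<close> and admits more pairs.\<close>

lemma edist_root_slopes_antimono:
  assumes "lam1 \<le> lam2"
  shows "edist 0 (root_slopes D lam2) \<le> edist 0 (root_slopes D lam1)"
proof -
  have "\<exists>u'\<in>root_slopes D lam2. norm u' \<le> norm u" if u: "u \<in> root_slopes D lam1" for u
  proof -
    obtain w where w: "u \<in> D w" "2 * (u \<bullet> w) + 2 * lam1 * (norm u)\<^sup>2 = 1" using u root_slopes_iff by blast
    have mono: "lam1 * (norm u)\<^sup>2 \<le> lam2 * (norm u)\<^sup>2" using assms by (intro mult_right_mono) auto
    define q where "q = 2 * (u \<bullet> w) + 2 * lam2 * (norm u)\<^sup>2"
    have q: "q \<ge> 1" using w(2) mono by (simp add: q_def)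
    have "u /\<^sub>R sqrt q \<in> root_slopes D lam2" unfolding root_slopes_def q_def
      using w(1) q by (intro CollectI exI[of _ u] exI[of _ w]) (auto simp: q_def)
    moreover have "norm (u /\<^sub>R sqrt q) \<le> norm u"
      using q by (simp add: inverse_eq_divide divide_le_eq mult_le_cancel_left1)
    ultimately show ?thesis by blast
  qed
  then show ?thesis unfolding edist_def by (intro INF_mono) auto
qed

text \<open>Outer limits are slopes for \<open>lam = 0\<close> by compactness. For the inner limit, keep the pair \<open>(w, u)\<close> of a given
  slope fixed and let only \<open>lam\<close> vary in the denominator.\<close>

lemma pk_root_slopes:
  assumes "Lam > 0" and eq: "\<And>lam. 0 < lam \<Longrightarrow> lam < Lam \<Longrightarrow> C lam = root_slopes D lam"
  shows "pk_converges0 C (root_slopes D 0)"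
proof -
  have outer: "outer_lim0 C \<subseteq> root_slopes D 0"
  proof
    fix v assume "v \<in> outer_lim0 C"
    then obtain l V where l: "\<And>k::nat. l k > 0" "l \<longlonglongrightarrow> 0" and V: "V \<longlonglongrightarrow> v" "\<And>k. V k \<in> C (l k)"
      unfolding outer_lim0_def by blast
    obtain N where N: "\<And>k. k \<ge> N \<Longrightarrow> l k < Lam"
      using order_tendstoD(2)[OF l(2) \<open>Lam > 0\<close>] unfolding eventually_sequentially by blast
    show "v \<in> root_slopes D 0"
    proof (rule root_slopes_limit)
      show "V (k + N) \<in> root_slopes D (l (k + N))" for k using V(2)[of "k + N"] eq[OF l(1) N[of "k + N"]] by simp
      show "(\<lambda>k. l (k + N)) \<longlonglongrightarrow> 0" by (rule LIMSEQ_ignore_initial_segment[OF l(2)])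
      show "(\<lambda>k. V (k + N)) \<longlonglongrightarrow> v" by (rule LIMSEQ_ignore_initial_segment[OF V(1)])
    qed
  qed
  have inner: "root_slopes D 0 \<subseteq> inner_lim0 C"
  proof
    fix u assume "u \<in> root_slopes D 0"
    then obtain w where w: "u \<in> D w" "2 * (u \<bullet> w) = 1" unfolding root_slopes_iff by auto
    show "u \<in> inner_lim0 C" unfolding inner_lim0_def
    proof (intro CollectI allI impI, elim conjE)
      fix l :: "nat \<Rightarrow> real" assume l: "\<forall>k. l k > 0" "l \<longlonglongrightarrow> 0"
      let ?V = "\<lambda>k. u /\<^sub>R sqrt (2 * (u \<bullet> w) + 2 * l k * (norm u)\<^sup>2)"
      have "?V \<longlonglongrightarrow> u /\<^sub>R sqrt (2 * (u \<bullet> w) + 2 * 0 * (norm u)\<^sup>2)"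
        by (intro tendsto_intros l) (use w in simp)
      then have "?V \<longlonglongrightarrow> u" using w(2) by simp
      moreover have "\<forall>\<^sub>F k in sequentially. ?V k \<in> C (l k)"
        using order_tendstoD(2)[OF l(2) \<open>Lam > 0\<close>]
      proof eventually_elim
        case (elim k)
        have "l k * (norm u)\<^sup>2 \<ge> 0" using l(1) by (simp add: less_imp_le)
        then have "u \<bullet> w + l k * (norm u)\<^sup>2 > 0" using w(2) by simp
        then have "?V k \<in> root_slopes D (l k)" unfolding root_slopes_def using w(1) by blast
        then show ?case using eq l(1) elim by simp
      qed
      ultimately show "\<exists>V. V \<longlonglongrightarrow> u \<and> (\<forall>\<^sub>F k in sequentially. V k \<in> C (l k))" by blast
    qed
  qed
  have "inner_lim0 C \<subseteq> outer_lim0 C"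
  proof
    fix v assume v: "v \<in> inner_lim0 C"
    let ?l = "\<lambda>k. inverse (real (Suc k))"
    obtain V where V: "V \<longlonglongrightarrow> v" "\<forall>\<^sub>F k in sequentially. V k \<in> C (?l k)"
      using spec[OF v[unfolded inner_lim0_def mem_Collect_eq], of ?l] null_seq_Suc by blast
    obtain N where N: "\<And>k. k \<ge> N \<Longrightarrow> V k \<in> C (?l k)" using V(2) unfolding eventually_sequentially by blast
    show "v \<in> outer_lim0 C" unfolding outer_lim0_def
    proof (intro CollectI exI[of _ "\<lambda>k. ?l (k + N)"] exI[of _ "\<lambda>k. V (k + N)"] conjI allI)
      show "(\<lambda>k. ?l (k + N)) \<longlonglongrightarrow> 0" by (rule LIMSEQ_ignore_initial_segment[OF LIMSEQ_inverse_real_of_nat])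
      show "(\<lambda>k. V (k + N)) \<longlonglongrightarrow> v" by (rule LIMSEQ_ignore_initial_segment[OF V(1)])
      show "V (k + N) \<in> C (?l (k + N))" for k by (rule N) simp
    qed simp
  qed
  with outer inner show ?thesis unfolding pk_converges0_def by blast
qed

text \<open>By monotonicity the distances for \<open>lam > 0\<close> do not exceed the one for \<open>lam = 0\<close>. If they stayed below a
  smaller bound, a bounded sequence of slopes would have a limit contradicting the distance for \<open>lam = 0\<close>.\<close>

lemma tendsto_edist_root_slopes:
  "((\<lambda>lam. edist 0 (root_slopes D lam)) \<longlongrightarrow> edist 0 (root_slopes D 0)) (at_right 0)"
proof (rule order_tendstoI)
  fix a assume "edist 0 (root_slopes D 0) < a"
  moreover have "\<forall>\<^sub>F lam in at_right 0. 0 < (lam::real)" by (auto simp: eventually_at_right_field intro: exI[of _ 1])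
  ultimately show "\<forall>\<^sub>F lam in at_right 0. edist 0 (root_slopes D lam) < a"
    by (auto elim!: eventually_mono intro: le_less_trans edist_root_slopes_antimono less_imp_le)
next
  fix a assume a: "a < edist 0 (root_slopes D 0)"
  show "\<forall>\<^sub>F lam in at_right 0. a < edist 0 (root_slopes D lam)"
  proof (rule ccontr)
    assume neg: "\<not> ?thesis"
    obtain m where m: "a < ereal m" "ereal m < edist 0 (root_slopes D 0)" using ereal_dense2[OF a] by blast
    have ex: "\<exists>lam u. 0 < lam \<and> lam < d \<and> u \<in> root_slopes D lam \<and> norm u < m" if "d > 0" for d
    proof -
      obtain lam where lam: "0 < lam" "lam < d" "\<not> a < edist 0 (root_slopes D lam)"
        using neg \<open>d > 0\<close> unfolding eventually_at_right_field by blast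
      then have "\<not> ereal m \<le> edist 0 (root_slopes D lam)" using m(1) by (meson less_le_trans)
      then show ?thesis using lam unfolding edist_zero_ge_iff by (auto simp: not_le)
    qed
    obtain L U where L: "\<And>k. 0 < L k" "\<And>k. L k < inverse (real (Suc k))"
      and U: "\<And>k. U k \<in> root_slopes D (L k)" "\<And>k. norm (U k) < m"
      using null_seq_choice[of "\<lambda>d lam u. 0 < lam \<and> lam < d \<and> u \<in> root_slopes D lam \<and> norm u < m", OF ex] by blast
    have Ll: "L \<longlonglongrightarrow> 0" by (rule tendsto_of_inverse_Suc) (use L in \<open>simp add: abs_of_pos\<close>)
    obtain u r where r: "norm u \<le> m" "strict_mono r" "(U \<circ> r) \<longlonglongrightarrow> u"
      using bounded_subseq[of U m] U(2) by (meson less_imp_le)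
    have "u \<in> root_slopes D 0"
    proof (rule root_slopes_limit)
      show "(U \<circ> r) k \<in> root_slopes D ((L \<circ> r) k)" for k using U(1) by simp
      show "(L \<circ> r) \<longlonglongrightarrow> 0" by (rule LIMSEQ_subseq_LIMSEQ[OF Ll r(2)])
      show "(U \<circ> r) \<longlonglongrightarrow> u" by (rule r(3))
    qed
    then have "edist 0 (root_slopes D 0) \<le> ereal (norm u)" unfolding edist_def by (intro INF_lower2) auto
    also have "\<dots> \<le> ereal m" using r(1) by simp
    finally show False using m(2) by simp
  qed
qed

end

section \<open>Outer subdifferentials of the root of the gap\<close>

context epi_quadratic
begin

text \<open>Proximal subgradients of \<open>h\<close> occur arbitrarily close to any point where \<open>h\<close> is finite.\<close>

lemma penalised_minimizer:
  assumes a: "h w = ereal a" and "r > 0" "\<alpha> > 0"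
  shows "\<exists>y b. norm (y - w) \<le> r \<and> h y = ereal b \<and> b - z \<bullet> (y - w) + \<alpha> * (norm (y - w))\<^sup>2 \<le> a \<and>
    (norm (y - w) \<le> r / 2 \<longrightarrow> z - (2 * \<alpha>) *\<^sub>R (y - w) \<in> D y)"
proof -
  have "\<exists>y b. y \<in> cball w r \<and> h y = ereal b \<and> (\<forall>y' b'. y' \<in> cball w r \<and> h y' \<le> ereal b' \<longrightarrow>
    b - z \<bullet> (y - w) + \<alpha> * (norm (y - w))\<^sup>2 \<le> b' - z \<bullet> (y' - w) + \<alpha> * (norm (y' - w))\<^sup>2)"
  proof (rule quadratic_minimizer_exists[OF h_lsc[of _ \<infinity>]])
    show "w \<in> cball w r" using \<open>r > 0\<close> by simp
    show "h w \<le> ereal a" by (simp add: a)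
    show "ereal (- \<rho> / 2 * (norm w + r)\<^sup>2) \<le> h y" if "y \<in> cball w r" for y
    proof -
      have "norm y \<le> norm w + r" using that norm_triangle_ineq[of "y - w" w] by (simp add: dist_norm norm_minus_commute)
      then have "(norm y)\<^sup>2 \<le> (norm w + r)\<^sup>2" by (intro power_mono) auto
      then have "\<rho> / 2 * (norm y)\<^sup>2 \<le> \<rho> / 2 * (norm w + r)\<^sup>2" using rho by (intro mult_left_mono) auto
      then have "ereal (- \<rho> / 2 * (norm w + r)\<^sup>2) \<le> ereal (- \<rho> / 2 * (norm y)\<^sup>2)" by simp
      also have "\<dots> \<le> h y" by (rule h_growth)
      finally show ?thesis .
    qed
  qed (use \<open>\<alpha> > 0\<close> in auto)
  then obtain y b where y: "y \<in> cball w r" "h y = ereal b" and min: "\<And>y' b'. y' \<in> cball w r \<Longrightarrow> h y' \<le> ereal b' \<Longrightarrow>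
    b - z \<bullet> (y - w) + \<alpha> * (norm (y - w))\<^sup>2 \<le> b' - z \<bullet> (y' - w) + \<alpha> * (norm (y' - w))\<^sup>2" by blast
  have "z - (2 * \<alpha>) *\<^sub>R (y - w) \<in> D y" if "norm (y - w) \<le> r / 2"
  proof (rule proximal_subgradient_in_D[OF y(2)])
    fix w' b' assume w': "norm (w' - y) \<le> r / 2" and b': "h w' \<le> ereal b'"
    have "w' \<in> cball w r" using that w' norm_triangle_ineq[of "w' - y" "y - w"] by (simp add: dist_norm norm_minus_commute)
    then have "ereal (b + (z - (2 * \<alpha>) *\<^sub>R (y - w)) \<bullet> (w' - y) - \<alpha> * (norm (w' - y))\<^sup>2) \<le> h w'"
      by (intro quadratic_minimizer_ineq min)
    also note b'
    finally show "b + (z - (2 * \<alpha>) *\<^sub>R (y - w)) \<bullet> (w' - y) - \<alpha> * (norm (w' - y))\<^sup>2 \<le> b'" by simp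
  qed (use \<open>r > 0\<close> \<open>\<alpha> > 0\<close> in auto)
  then show ?thesis using y min[of w a] a \<open>r > 0\<close> by (intro exI[of _ y] exI[of _ b]) (auto simp: dist_norm norm_minus_commute)
qed

text \<open>A regular subgradient \<open>z\<close> at \<open>w\<close> is a limit of proximal ones: if \<open>h\<close> loses at most \<open>e * norm (y - w)\<close> against
  its linearisation, a penalised minimiser \<open>y\<close> satisfies \<open>\<alpha> * norm (y - w) \<le> e\<close>, which bounds both its
  distance to \<open>w\<close> and the deviation of the subgradient from \<open>z\<close>.\<close>

lemma regular_subset_D: "regular_subdiff h w \<subseteq> D w"
proof
  fix z assume z: "z \<in> regular_subdiff h w"
  then obtain a where a: "h w = ereal a" by (auto simp: regular_subdiff_def finite_at_ereal)
  have approx: "\<exists>y z'. norm (y - w) \<le> e \<and> norm (z' - z) \<le> 2 * e \<and> z' \<in> D y" if "e > 0" for e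
  proof -
    have "\<forall>\<^sub>F y in nhds w. h y \<ge> h w + ereal (z \<bullet> (y - w) - e * norm (y - w))"
      using z that by (simp add: regular_subdiff_def)
    then obtain d where "d > 0" and d': "\<And>y. dist y w < d \<Longrightarrow> h w + ereal (z \<bullet> (y - w) - e * norm (y - w)) \<le> h y"
      unfolding eventually_nhds_metric by blast
    have d: "d > 0" "\<And>y. norm (y - w) < d \<Longrightarrow> ereal (a + (z \<bullet> (y - w) - e * norm (y - w))) \<le> h y"
      using \<open>d > 0\<close> d' by (simp_all add: a dist_norm)
    define r where "r = min e (d/2)"
    have r: "r > 0" "r \<le> e" "r < d" using d \<open>e > 0\<close> by (auto simp: r_def)
    \<comment> \<open>turns \<open>\<alpha> * norm (y - w) \<le> e\<close> into \<open>norm (y - w) \<le> r / 2\<close>\<close>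
    define \<alpha> where "\<alpha> = 2 * e / r"
    have "\<alpha> > 0" using \<open>e > 0\<close> r by (simp add: \<alpha>_def)
    obtain y b where y: "norm (y - w) \<le> r" "h y = ereal b" "b - z \<bullet> (y - w) + \<alpha> * (norm (y - w))\<^sup>2 \<le> a"
      and D: "norm (y - w) \<le> r / 2 \<Longrightarrow> z - (2 * \<alpha>) *\<^sub>R (y - w) \<in> D y"
      using penalised_minimizer[OF a r(1) \<open>\<alpha> > 0\<close>, of z] by blast
    have "a + (z \<bullet> (y - w) - e * norm (y - w)) \<le> b" using d(2)[of y] y r by simp
    then have "\<alpha> * norm (y - w) * norm (y - w) \<le> e * norm (y - w)" using y(3) by (simp add: power2_eq_square)
    then have n: "\<alpha> * norm (y - w) \<le> e" using \<open>e > 0\<close> by (cases "y = w") auto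
    then have "norm (y - w) \<le> r / 2" using \<open>e > 0\<close> r by (simp add: \<alpha>_def field_simps)
    moreover have "norm (z - (2 * \<alpha>) *\<^sub>R (y - w) - z) \<le> 2 * e" using n \<open>\<alpha> > 0\<close> by simp
    ultimately show ?thesis using D r(1,2) by (intro exI[of _ y] exI[of _ "z - (2 * \<alpha>) *\<^sub>R (y - w)"]) auto
  qed
  have ex: "\<exists>y z'. norm (y - w) < e \<and> norm (z' - z) < e \<and> z' \<in> D y" if "e > 0" for e
  proof -
    obtain y z' where "norm (y - w) \<le> e / 3" "norm (z' - z) \<le> 2 * (e / 3)" "z' \<in> D y"
      using approx[of "e / 3"] \<open>e > 0\<close> by auto
    then show ?thesis using \<open>e > 0\<close> by (intro exI[of _ y] exI[of _ z']) auto
  qed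
  obtain Y Z where YZ: "\<And>k. norm (Y k - w) < inverse (real (Suc k)) \<and> norm (Z k - z) < inverse (real (Suc k)) \<and> Z k \<in> D (Y k)"
    using null_seq_choice[of "\<lambda>e y z'. norm (y - w) < e \<and> norm (z' - z) < e \<and> z' \<in> D y", OF ex] by blast
  then have D: "Z k \<in> D (Y k)" for k by blast
  have "Y \<longlonglongrightarrow> w" by (rule tendsto_of_inverse_Suc) (use YZ in blast)
  moreover have "Z \<longlonglongrightarrow> z" by (rule tendsto_of_inverse_Suc) (use YZ in blast)
  ultimately show "z \<in> D w" by (rule graphical_deriv_closed[OF D])
qed

theorem D_eq_limiting_subdiff: "D w = limiting_subdiff h w"
proof
  show "D w \<subseteq> limiting_subdiff h w" using D_subset_regular regular_subdiff_subset_limiting by blast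
  show "limiting_subdiff h w \<subseteq> D w"
  proof
    fix v assume "v \<in> limiting_subdiff h w"
    then obtain X V where lim: "X \<longlonglongrightarrow> w" "V \<longlonglongrightarrow> v" and "\<And>k. V k \<in> regular_subdiff h (X k)"
      unfolding limiting_subdiff_def by blast
    then have "V k \<in> D (X k)" for k using regular_subset_D by blast
    then show "v \<in> D w" using lim by (rule graphical_deriv_closed)
  qed
qed

text \<open>By Euler's identity \<open>v \<in> D w\<close> with \<open>v \<bullet> w > 0\<close> forces \<open>h w > 0\<close>. Conversely \<open>h\<close> stays positive near a point
  with a positive value, and a penalised minimiser provides a subgradient at such a point.\<close>

lemma positive_value_iff: "(\<exists>w. 0 < h w \<and> h w < \<infinity>) \<longleftrightarrow> (\<exists>w v. v \<in> D w \<and> v \<bullet> w > 0)"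
proof
  assume "\<exists>w v. v \<in> D w \<and> v \<bullet> w > 0"
  then obtain w v where "v \<in> D w" "v \<bullet> w > 0" by blast
  then show "\<exists>w. 0 < h w \<and> h w < \<infinity>" using euler[of v w] by (intro exI[of _ w]) simp
next
  assume "\<exists>w. 0 < h w \<and> h w < \<infinity>"
  then obtain w where w: "0 < h w" "h w < \<infinity>" by blast
  then obtain a where a: "h w = ereal a" "a > 0" by (cases "h w") auto
  have "\<exists>r>0. \<forall>y. norm (y - w) \<le> r \<longrightarrow> 0 < h y"
  proof (rule ccontr)
    assume neg: "\<not> ?thesis"
    have ex: "\<exists>y u. norm (y - w) < r \<and> h y \<le> ereal u \<and> u = 0" if "r > 0" for r
    proof -
      obtain y where "norm (y - w) \<le> r / 2" "\<not> 0 < h y" using neg half_gt_zero[OF \<open>r > 0\<close>] by blast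
      then show ?thesis using \<open>r > 0\<close> by (intro exI[of _ y] exI[of _ 0]) (simp add: zero_ereal_def[symmetric] not_less)
    qed
    obtain Y u where Yu: "\<And>k. norm (Y k - w) < inverse (real (Suc k)) \<and> h (Y k) \<le> ereal (u k) \<and> u k = 0"
      using null_seq_choice[of "\<lambda>r y u. norm (y - w) < r \<and> h y \<le> ereal u \<and> u = 0", OF ex] by blast
    then have Y: "h (Y k) \<le> ereal 0" for k by metis
    have "Y \<longlonglongrightarrow> w" by (rule tendsto_of_inverse_Suc) (use Yu in blast)
    then have "h w \<le> ereal 0"
      using lsc_uptoD[OF h_lsc[of UNIV \<infinity>], of Y "\<lambda>_. 0" w 0] Y by simp
    then show False using w(1) by (simp add: zero_ereal_def[symmetric])
  qed
  then obtain r where r: "r > 0" "\<And>y. norm (y - w) \<le> r \<Longrightarrow> 0 < h y" by blast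
  \<comment> \<open>the penalty at distance \<open>r / 2\<close> equals \<open>a = h w\<close>\<close>
  define \<alpha> where "\<alpha> = 4 * a / r\<^sup>2"
  have "\<alpha> > 0" using a r by (simp add: \<alpha>_def)
  obtain y b where y: "norm (y - w) \<le> r" "h y = ereal b" "b - 0 \<bullet> (y - w) + \<alpha> * (norm (y - w))\<^sup>2 \<le> a"
    and D: "norm (y - w) \<le> r / 2 \<Longrightarrow> 0 - (2 * \<alpha>) *\<^sub>R (y - w) \<in> D y"
    using penalised_minimizer[OF a(1) r(1) \<open>\<alpha> > 0\<close>, of 0] by blast
  have b: "b > 0" using r(2)[OF y(1)] y(2) by simp
  then have "\<alpha> * (norm (y - w))\<^sup>2 \<le> a" using y(3) by simp
  then have "(norm (y - w))\<^sup>2 \<le> (r / 2)\<^sup>2" using a(2) r(1) by (simp add: \<alpha>_def field_simps)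
  then have "norm (y - w) \<le> r / 2" by (rule power2_le_imp_le) (use r(1) in simp)
  from D[OF this] have "0 - (2 * \<alpha>) *\<^sub>R (y - w) \<in> D y" .
  moreover from euler[OF this] y(2) b have "(0 - (2 * \<alpha>) *\<^sub>R (y - w)) \<bullet> y > 0" by simp
  ultimately show "\<exists>w v. v \<in> D w \<and> v \<bullet> w > 0" by blast
qed

lemma kl_half: "kl_property f xbar (1/2)"
proof -
  obtain \<kappa> \<delta> where \<kappa>: "\<kappa> > 0" "\<delta> > 0"
    and est: "\<And>y v. norm (y - xbar) < \<delta> \<Longrightarrow> v \<in> limiting_subdiff f y \<Longrightarrow> norm (y - xbar) \<le> \<kappa> * norm v"
    using nonsingular_imp_strong_subregular[OF nonsing] by blast
  show ?thesis
  proof (rule kl_half_of_strong_subregularity[OF fin loc_lsc eps rho _ \<kappa> est])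
    fix x v assume "v \<in> limiting_subdiff f x" "norm v < \<epsilon>" "norm (x - xbar) < \<epsilon>"
    then show "f x + ereal (v \<bullet> (xbar - x) - \<rho> / 2 * (norm (xbar - x))\<^sup>2) \<le> f xbar"
      using eps by (intro prox) auto
  qed
qed

lemma sharp:
  assumes "0 < h w" "h w < \<infinity>"
  shows "kl_sharp f xbar (1/2)"
proof -
  obtain a where a: "h w = ereal a" "a > 0" using assms by (cases "h w") auto
  obtain r where r: "r > 0" "lsc_upto f (cball xbar r) (ereal (c + r))" using lsc_near by blast
  have up: "\<exists>t w'. 0 < t \<and> t < \<eta> \<and> norm (w' - w) < \<eta> \<and> f (xbar + t *\<^sub>R w') \<le> ereal (c + t\<^sup>2 * (a + 1))" if "\<eta> > 0" for \<eta>
  proof -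
    let ?t = "\<lambda>k. inverse (real (Suc k))"
    obtain W where W: "W \<longlonglongrightarrow> w" "\<And>b. h w < ereal b \<Longrightarrow> \<forall>\<^sub>F k in sequentially. f (xbar + ?t k *\<^sub>R W k) < ereal (c + (?t k)\<^sup>2 * b)"
      using recoveryE[of ?t w] null_seq_Suc by blast
    have "h w < ereal (a + 1)" using a by simp
    from W(2)[OF this] order_tendstoD(2)[OF conjunct2[OF null_seq_Suc] that] tendstoD[OF W(1) that]
    have "\<forall>\<^sub>F k in sequentially. ?t k < \<eta> \<and> norm (W k - w) < \<eta> \<and> f (xbar + ?t k *\<^sub>R W k) \<le> ereal (c + (?t k)\<^sup>2 * (a + 1))"
      by eventually_elim (auto simp: dist_norm less_imp_le)
    then obtain k where "?t k < \<eta>" "norm (W k - w) < \<eta>" "f (xbar + ?t k *\<^sub>R W k) \<le> ereal (c + (?t k)\<^sup>2 * (a + 1))"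
      using eventually_happens by fastforce
    moreover have "0 < ?t k" by simp
    ultimately show ?thesis by blast
  qed
  show ?thesis
    by (rule kl_sharp_of_second_order_minorant[where f = f, OF fin r kl_half minorant assms(1) _ up]) (use a in auto)
qed

lemma subreg_bound:
  "\<exists>\<sigma>. subreg (limiting_subdiff f) xbar 0 = ereal \<sigma> \<and> closed_cone_map D \<sigma>"
proof -
  obtain \<sigma> where "\<sigma> \<ge> 0" "subreg (limiting_subdiff f) xbar 0 = ereal \<sigma>"
    "\<And>w z. z \<in> D w \<Longrightarrow> norm w \<le> \<sigma> * norm z" using subreg_of_nonsingular[OF nonsing zero_sub] by blast
  then show ?thesis
    by (intro exI[of _ \<sigma>] conjI closed_cone_map.intro) (use graphical_deriv_cone graphical_deriv_closed in \<open>blast+\<close>)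
qed

lemma root_slopes_iff:
  "u \<in> root_slopes D lam \<longleftrightarrow> (\<exists>w. u \<in> D w \<and> 2 * (u \<bullet> w) + 2 * lam * (norm u)\<^sup>2 = 1)"
  using subreg_bound closed_cone_map.root_slopes_iff by blast

text \<open>For \<open>\<subseteq>\<close>, let \<open>V k /\<^sub>R (2 * s k)\<close> tend to \<open>u\<close> at points \<open>X k\<close> where the gap is \<open>(s k)\<^sup>2\<close>. Rescale by
  \<open>t = s k\<close>: the subgradients become \<open>V k /\<^sub>R s k\<close> and tend to \<open>2 *\<^sub>R u\<close>, the points stay bounded by strong
  subregularity, and the second-order quotients are all \<open>1\<close>. Hence \<open>2 *\<^sub>R u \<in> D w\<close> and \<open>h w = 1\<close> for a cluster
  point \<open>w\<close>, so Euler's identity gives \<open>u \<bullet> w = 1\<close>. For \<open>\<supseteq>\<close>, the quotients along a sequence that defines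
  \<open>u \<in> D w\<close> converge to \<open>h w = u \<bullet> w / 2 = 1/4\<close>, which determines the roots \<open>s k\<close> up to first order.\<close>

lemma outer_subdiff_root: "outer_subdiff (sqrt_gap f xbar) xbar = root_slopes D 0"
proof (rule set_eqI, rule iffI)
  fix u assume "u \<in> outer_subdiff (sqrt_gap f xbar) xbar"
  then obtain X V s where X: "X \<longlonglongrightarrow> xbar" and sl: "s \<longlonglongrightarrow> 0" and Vl: "(\<lambda>k. V k /\<^sub>R (2 * s k)) \<longlonglongrightarrow> u"
    and sp: "\<And>k. s k > 0" and fX: "\<And>k. f (X k) = ereal (c + (s k)\<^sup>2)" and V: "\<And>k. V k \<in> limiting_subdiff f (X k)"
    unfolding outer_subdiff_sqrt_gap_iff[where \<phi> = f, OF fin] by blast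
  obtain \<kappa> \<delta> where \<kappa>: "\<kappa> > 0" "\<delta> > 0"
    and est: "\<And>y v. norm (y - xbar) < \<delta> \<Longrightarrow> v \<in> limiting_subdiff f y \<Longrightarrow> norm (y - xbar) \<le> \<kappa> * norm v"
    using nonsingular_imp_strong_subregular[OF nonsing] by blast
  obtain N where N: "\<And>k. k \<ge> N \<Longrightarrow> norm (X k - xbar) < \<delta>"
    using tendstoD[OF X \<kappa>(2)] unfolding eventually_sequentially dist_norm by blast
  define S where "S k = s (k + N)" for k
  define W where "W k = (X (k + N) - xbar) /\<^sub>R S k" for k
  define Z where "Z k = V (k + N) /\<^sub>R S k" for k
  have Sp: "S k > 0" for k using sp by (simp add: S_def)
  have Sl: "S \<longlonglongrightarrow> 0" unfolding S_def by (rule LIMSEQ_ignore_initial_segment[OF sl])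
  have "(\<lambda>k. 2 *\<^sub>R (V (k + N) /\<^sub>R (2 * s (k + N)))) \<longlonglongrightarrow> 2 *\<^sub>R u"
    by (intro tendsto_intros LIMSEQ_ignore_initial_segment[OF Vl])
  moreover have "2 *\<^sub>R (V (k + N) /\<^sub>R (2 * s (k + N))) = Z k" for k by (simp add: Z_def S_def)
  ultimately have Zl: "Z \<longlonglongrightarrow> 2 *\<^sub>R u" by simp
  obtain B where B: "\<And>k. norm (Z k) \<le> B" using convergent_imp_bounded[OF Zl] by (auto simp: bounded_iff)
  have "norm (W k) \<le> \<kappa> * B" for k
  proof -
    have "norm (X (k + N) - xbar) \<le> \<kappa> * norm (V (k + N))" by (rule est[OF N V]) simp
    then have "norm (W k) \<le> \<kappa> * norm (Z k)" using Sp[of k] by (simp add: W_def Z_def divide_simps)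
    also have "\<dots> \<le> \<kappa> * B" using B \<kappa>(1) by simp
    finally show ?thesis .
  qed
  then obtain w r where r: "strict_mono r" and Wl: "(W \<circ> r) \<longlonglongrightarrow> w" using bounded_subseq[of W] by blast
  have XW: "xbar + S k *\<^sub>R W k = X (k + N)" and VZ: "S k *\<^sub>R Z k = V (k + N)" for k
    using Sp[of k] by (auto simp: W_def Z_def)
  have lims: "(\<lambda>k. S (r k)) \<longlonglongrightarrow> 0" "(\<lambda>k. W (r k)) \<longlonglongrightarrow> w" "(\<lambda>k. Z (r k)) \<longlonglongrightarrow> 2 *\<^sub>R u"
    using LIMSEQ_subseq_LIMSEQ[OF Sl r] LIMSEQ_subseq_LIMSEQ[OF Zl r] Wl by (auto simp: o_def)
  have sub: "S (r k) *\<^sub>R Z (r k) \<in> limiting_subdiff f (xbar + S (r k) *\<^sub>R W (r k))" for k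
    unfolding XW VZ by (rule V)
  obtain a A where a: "h w = ereal a" and Al: "A \<longlonglongrightarrow> a"
    and A: "\<And>k. f (xbar + S (r k) *\<^sub>R W (r k)) = ereal (c + (S (r k))\<^sup>2 * A k)"
    using graph_limit[of "\<lambda>k. S (r k)" "\<lambda>k. W (r k)" w "\<lambda>k. Z (r k)" "2 *\<^sub>R u", OF Sp lims sub] by blast
  have "A k = 1" for k
  proof -
    have "(S (r k))\<^sup>2 * A k = (S (r k))\<^sup>2" using A[of k] fX[of "r k + N"] unfolding XW by (simp add: S_def)
    then show ?thesis using Sp[of "r k"] by simp
  qed
  then have "A = (\<lambda>_. 1)" by auto
  then have "a = 1" using Al by (simp add: LIMSEQ_const_iff)
  have "2 *\<^sub>R u \<in> D w" unfolding graphical_deriv_seq using Sp lims sub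
    by (intro exI[of _ "\<lambda>k. S (r k)"] exI[of _ "\<lambda>k. W (r k)"] exI[of _ "\<lambda>k. Z (r k)"]) auto
  then have e: "u \<bullet> w = 1" using euler a \<open>a = 1\<close> by fastforce
  from graphical_deriv_cone[OF \<open>2 *\<^sub>R u \<in> D w\<close>, of "1/2"] have "u \<in> D ((1/2) *\<^sub>R w)" by simp
  then show "u \<in> root_slopes D 0" unfolding root_slopes_iff using e by (intro exI[of _ "(1/2) *\<^sub>R w"]) simp
next
  fix u assume "u \<in> root_slopes D 0"
  then obtain w where u: "u \<in> D w" "2 * (u \<bullet> w) = 1" unfolding root_slopes_iff by auto
  obtain t W Z where t: "\<And>k. t k > 0" "t \<longlonglongrightarrow> 0" and W: "W \<longlonglongrightarrow> w" and Z: "Z \<longlonglongrightarrow> u"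
    and sub: "\<And>k. t k *\<^sub>R Z k \<in> limiting_subdiff f (xbar + t k *\<^sub>R W k)" using D_seq[OF u(1)] by blast
  obtain a A where a: "h w = ereal a" and Al: "A \<longlonglongrightarrow> a"
    and A: "\<And>k. f (xbar + t k *\<^sub>R W k) = ereal (c + (t k)\<^sup>2 * A k)" using graph_limit[OF t W Z sub] by blast
  have "a = 1/4" using a euler[OF u(1)] u(2) by simp
  with Al have "\<forall>\<^sub>F k in sequentially. A k > 0" by (intro order_tendstoD(1)) auto
  then obtain N where N: "\<And>k. k \<ge> N \<Longrightarrow> A k > 0" unfolding eventually_sequentially by blast
  define s where "s k = t k * sqrt (A k)" for k
  have "(\<lambda>k. sqrt (A k)) \<longlonglongrightarrow> sqrt a" by (intro tendsto_intros Al)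
  then have sA: "(\<lambda>k. sqrt (A k)) \<longlonglongrightarrow> 1/2" using \<open>a = 1/4\<close> by (simp add: real_sqrt_divide)
  show "u \<in> outer_subdiff (sqrt_gap f xbar) xbar"
    unfolding outer_subdiff_sqrt_gap_iff[where \<phi> = f, OF fin]
  proof (rule exI[of _ "\<lambda>k. xbar + t (k + N) *\<^sub>R W (k + N)"], rule exI[of _ "\<lambda>k. t (k + N) *\<^sub>R Z (k + N)"],
      rule exI[of _ "\<lambda>k. s (k + N)"], intro conjI allI)
    show "(\<lambda>k. xbar + t (k + N) *\<^sub>R W (k + N)) \<longlonglongrightarrow> xbar"
      using LIMSEQ_ignore_initial_segment[OF tends_to_xbar[OF t(2) W], of N] .
    have "s \<longlonglongrightarrow> 0 * (1/2)" unfolding s_def by (intro tendsto_intros t sA)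
    then show "(\<lambda>k. s (k + N)) \<longlonglongrightarrow> 0" using LIMSEQ_ignore_initial_segment[of s 0 N] by simp
    have "(\<lambda>k. Z (k + N) /\<^sub>R (2 * sqrt (A (k + N)))) \<longlonglongrightarrow> u /\<^sub>R (2 * (1/2))"
      by (intro tendsto_intros LIMSEQ_ignore_initial_segment[OF Z] LIMSEQ_ignore_initial_segment[OF sA]) auto
    then have "(\<lambda>k. Z (k + N) /\<^sub>R (2 * sqrt (A (k + N)))) \<longlonglongrightarrow> u" by simp
    moreover have eq: "(t (k + N) *\<^sub>R Z (k + N)) /\<^sub>R (2 * s (k + N)) = Z (k + N) /\<^sub>R (2 * sqrt (A (k + N)))" for k
      using t(1)[of "k + N"] by (simp add: s_def)
    ultimately show "(\<lambda>k. (t (k + N) *\<^sub>R Z (k + N)) /\<^sub>R (2 * s (k + N))) \<longlonglongrightarrow> u" unfolding eq by blast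
    fix k
    have Ak: "A (k + N) > 0" by (rule N) simp
    show "0 < s (k + N)" using t(1) Ak by (simp add: s_def)
    show "f (xbar + t (k + N) *\<^sub>R W (k + N)) = ereal (c + (s (k + N))\<^sup>2)"
      using A[of "k + N"] Ak by (simp add: s_def power_mult_distrib)
  qed (rule sub)
qed

text \<open>The graph of \<open>\<partial>h = D\<close> is a cone and \<open>h\<close> is given on it by Euler's identity, so all subgradients of the
  root of \<open>h\<close> at points with \<open>h > 0\<close> are themselves slopes of \<open>D\<close>, and these form a closed set.\<close>

lemma outer_subdiff_root_epi_limit: "outer_subdiff (sqrt_gap h 0) 0 = root_slopes D 0"
proof (rule set_eqI, rule iffI)
  have h0: "h 0 = ereal 0" by (simp add: h_zero zero_ereal_def)
  fix u
  show "u \<in> root_slopes D 0" if u: "u \<in> outer_subdiff (sqrt_gap h 0) 0"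
  proof -
    obtain X V s where Vl: "(\<lambda>k. V k /\<^sub>R (2 * s k)) \<longlonglongrightarrow> u"
      and sp: "\<And>k. s k > 0" and hX: "\<And>k. h (X k) = ereal (0 + (s k)\<^sup>2)" and V: "\<And>k. V k \<in> limiting_subdiff h (X k)"
      using u unfolding outer_subdiff_sqrt_gap_iff[where \<phi> = h, OF h0] by blast
    have "V k /\<^sub>R (2 * s k) \<in> root_slopes D 0" for k
    proof -
      have VD: "V k \<in> D (X k)" using V D_eq_limiting_subdiff by blast
      have "V k \<bullet> X k = 2 * (s k)\<^sup>2" using euler[OF VD] hX[of k] by simp
      moreover have "(1 / (2 * s k)) *\<^sub>R V k \<in> D ((1 / (2 * s k)) *\<^sub>R X k)"
        by (rule graphical_deriv_cone[OF VD]) (use sp in simp)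
      ultimately show ?thesis unfolding root_slopes_iff using sp[of k]
        by (intro exI[of _ "(1 / (2 * s k)) *\<^sub>R X k"]) (simp add: power2_eq_square inverse_eq_divide)
    qed
    moreover obtain \<sigma> where "closed_cone_map D \<sigma>" using subreg_bound by blast
    ultimately show ?thesis using closed_cone_map.root_slopes_limit[OF _ _ tendsto_const Vl] by blast
  qed
  show "u \<in> outer_subdiff (sqrt_gap h 0) 0" if "u \<in> root_slopes D 0"
  proof -
    obtain w where u: "u \<in> D w" "2 * (u \<bullet> w) = 1" using \<open>u \<in> _\<close> unfolding root_slopes_iff by auto
    let ?t = "\<lambda>k. inverse (real (Suc k))"
    have tl: "?t \<longlonglongrightarrow> 0" by (rule LIMSEQ_inverse_real_of_nat)
    have D: "?t k *\<^sub>R u \<in> D (?t k *\<^sub>R w)" for k by (rule graphical_deriv_cone[OF u(1)]) simp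
    have hk: "h (?t k *\<^sub>R w) = ereal (0 + (?t k / 2)\<^sup>2)" for k
    proof -
      have "(?t k *\<^sub>R u) \<bullet> (?t k *\<^sub>R w) / 2 = (?t k)\<^sup>2 * (u \<bullet> w) / 2" by (simp only: inner_scaleR_left inner_scaleR_right power2_eq_square mult.assoc)
      also have "\<dots> = 0 + (?t k / 2)\<^sup>2" using u(2) by (simp add: power2_eq_square)
      finally show ?thesis using euler[OF D] by metis
    qed
    show ?thesis unfolding outer_subdiff_sqrt_gap_iff[where \<phi> = h, OF h0]
    proof (rule exI[of _ "\<lambda>k. ?t k *\<^sub>R w"], rule exI[of _ "\<lambda>k. ?t k *\<^sub>R u"], rule exI[of _ "\<lambda>k. ?t k / 2"], intro conjI allI)
      show "(\<lambda>k. ?t k *\<^sub>R w) \<longlonglongrightarrow> 0" using tendsto_scaleR[OF tl tendsto_const[of w]] by simp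
      show "(\<lambda>k. ?t k / 2) \<longlonglongrightarrow> 0" using tendsto_divide[OF tl tendsto_const[of 2]] by simp
      show "(\<lambda>k. (?t k *\<^sub>R u) /\<^sub>R (2 * (?t k / 2))) \<longlonglongrightarrow> u" by simp
    qed (use D hk D_eq_limiting_subdiff in \<open>simp_all del: of_nat_Suc\<close>)
  qed
qed

lemma KL_eq: "KL f xbar (1/2) = edist 0 (root_slopes D 0)"
  using KL_half_eq_edist_outer_subdiff[where \<phi> = f, OF fin loc_lsc] outer_subdiff_root by simp

lemma KL_epi_limit_eq: "KL h 0 (1/2) = edist 0 (root_slopes D 0)"
  using KL_half_eq_edist_outer_subdiff[where \<phi> = h, of 0 0, OF _ h_locally_lsc] outer_subdiff_root_epi_limit
  by (simp add: h_zero zero_ereal_def)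

lemma root_slopes_union:
  "(\<Union>w\<in>{w. 0 < h w \<and> h w < \<infinity>}. (\<lambda>v. ((1/2) *\<^sub>R v) /\<^sub>R sqrt (real_of_ereal (h w))) ` limiting_subdiff h w) = root_slopes D 0"
proof -
  have eq: "((1/2) *\<^sub>R v) /\<^sub>R sqrt (real_of_ereal (h w)) = v /\<^sub>R sqrt (2 * (v \<bullet> w) + 2 * 0 * (norm v)\<^sup>2)"
    and pos: "0 < h w \<and> h w < \<infinity> \<longleftrightarrow> v \<bullet> w + 0 * (norm v)\<^sup>2 > 0" if v: "v \<in> D w" for v w
  proof -
    have "sqrt (2 * (v \<bullet> w)) = sqrt (4 * (v \<bullet> w / 2))" by simp
    also have "\<dots> = 2 * sqrt (v \<bullet> w / 2)" by (subst real_sqrt_mult) simp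
    finally show "((1/2) *\<^sub>R v) /\<^sub>R sqrt (real_of_ereal (h w)) = v /\<^sub>R sqrt (2 * (v \<bullet> w) + 2 * 0 * (norm v)\<^sup>2)"
      using euler[OF v] by simp
    show "0 < h w \<and> h w < \<infinity> \<longleftrightarrow> v \<bullet> w + 0 * (norm v)\<^sup>2 > 0" using euler[OF v] by simp
  qed
  show ?thesis unfolding root_slopes_def D_eq_limiting_subdiff[symmetric]
  proof (rule set_eqI, rule iffI)
    fix u assume "u \<in> (\<Union>w\<in>{w. 0 < h w \<and> h w < \<infinity>}. (\<lambda>v. ((1/2) *\<^sub>R v) /\<^sub>R sqrt (real_of_ereal (h w))) ` D w)"
    then obtain w v where w: "0 < h w \<and> h w < \<infinity>" and v: "v \<in> D w"
      and u: "u = ((1/2) *\<^sub>R v) /\<^sub>R sqrt (real_of_ereal (h w))" by blast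
    show "u \<in> {v /\<^sub>R sqrt (2 * (v \<bullet> w) + 2 * 0 * (norm v)\<^sup>2) | v w. v \<in> D w \<and> v \<bullet> w + 0 * (norm v)\<^sup>2 > 0}"
      using u v w unfolding eq[OF v] pos[OF v] by blast
  next
    fix u assume "u \<in> {v /\<^sub>R sqrt (2 * (v \<bullet> w) + 2 * 0 * (norm v)\<^sup>2) | v w. v \<in> D w \<and> v \<bullet> w + 0 * (norm v)\<^sup>2 > 0}"
    then obtain w v where v: "v \<in> D w" and w: "v \<bullet> w + 0 * (norm v)\<^sup>2 > 0"
      and u: "u = v /\<^sub>R sqrt (2 * (v \<bullet> w) + 2 * 0 * (norm v)\<^sup>2)" by blast
    have "w \<in> {w. 0 < h w \<and> h w < \<infinity>}" using w pos[OF v] by blast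
    moreover have "u \<in> (\<lambda>v. ((1/2) *\<^sub>R v) /\<^sub>R sqrt (real_of_ereal (h w))) ` D w"
      using v eq[OF v] u by (intro image_eqI) auto
    ultimately show "u \<in> (\<Union>w\<in>{w. 0 < h w \<and> h w < \<infinity>}. (\<lambda>v. ((1/2) *\<^sub>R v) /\<^sub>R sqrt (real_of_ereal (h w))) ` D w)"
      by (rule UN_I)
  qed
qed

end

section \<open>Functions with a two-sided quadratic expansion\<close>

text \<open>Both the envelope of \<open>f\<close> near \<open>xbar\<close> and the envelope of \<open>h\<close> on the whole space are of this kind. The uniform
  constant \<open>C\<close> makes the expansion stable under limits of base points.\<close>

locale quadratic_expansion =
  fixes \<phi> :: "'a::euclidean_space \<Rightarrow> ereal" and e :: "'a \<Rightarrow> real" and V :: "'a \<Rightarrow> 'a" and U :: "'a set" and C :: real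
  assumes open_U: "open U" and fin_U: "\<And>y. y \<in> U \<Longrightarrow> \<phi> y = ereal (e y)"
    and expansion: "\<And>x y. x \<in> U \<Longrightarrow> y \<in> U \<Longrightarrow> \<bar>e y - e x - V x \<bullet> (y - x)\<bar> \<le> C * (norm (y - x))\<^sup>2"
begin

lemma ball_in_U: assumes "x \<in> U" obtains r where "r > 0" "\<And>y. norm (y - x) < r \<Longrightarrow> y \<in> U"
  using open_U assms unfolding open_dist dist_norm by blast

lemma expansion_gradient_regular:
  assumes x: "x \<in> U" and v: "\<And>y. y \<in> U \<Longrightarrow> \<bar>e y - e x - v \<bullet> (y - x)\<bar> \<le> C * (norm (y - x))\<^sup>2"
  shows "v \<in> regular_subdiff \<phi> x"
proof -
  obtain r where r: "r > 0" "\<And>y. norm (y - x) < r \<Longrightarrow> y \<in> U" using ball_in_U[OF x] by blast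
  show ?thesis
  proof (rule proximal_subgradient[where \<phi> = \<phi>, OF fin_U[OF x] r(1)])
    fix y assume "norm (y - x) < r"
    then have y: "y \<in> U" by (rule r(2))
    have "e x + v \<bullet> (y - x) - C * (norm (y - x))\<^sup>2 \<le> e y" using v[OF y] by linarith
    then show "ereal (e x + v \<bullet> (y - x) - C * (norm (y - x))\<^sup>2) \<le> \<phi> y" using fin_U[OF y] by simp
  qed
qed

text \<open>A regular subgradient is at most the gradient in every direction up to first order; the direction
  \<open>v - V x\<close> then forces equality.\<close>

lemma regular_subdiff_expansion: assumes x: "x \<in> U" shows "regular_subdiff \<phi> x = {V x}"
proof (rule equalityI)
  show "{V x} \<subseteq> regular_subdiff \<phi> x" using expansion_gradient_regular[OF x expansion[OF x]] by blast
  show "regular_subdiff \<phi> x \<subseteq> {V x}"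
  proof
    fix v assume v: "v \<in> regular_subdiff \<phi> x"
    define d where "d = v - V x"
    have "d = 0"
    proof (rule ccontr)
      assume "d \<noteq> 0"
      then have d: "norm d > 0" by simp
      then have "norm d / 4 > 0" by simp
      then have "\<forall>\<^sub>F y in nhds x. \<phi> y \<ge> \<phi> x + ereal (v \<bullet> (y - x) - norm d / 4 * norm (y - x))"
        using v unfolding regular_subdiff_def by blast
      then obtain r1 where r1: "r1 > 0" "\<And>y. dist y x < r1 \<Longrightarrow> \<phi> y \<ge> \<phi> x + ereal (v \<bullet> (y - x) - norm d / 4 * norm (y - x))"
        unfolding eventually_nhds_metric by blast
      obtain r where r: "r > 0" "\<And>y. norm (y - x) < r \<Longrightarrow> y \<in> U" using ball_in_U[OF x] by blast
      \<comment> \<open>keeps \<open>x + t *\<^sub>R d\<close> in both neighbourhoods and the quadratic error below a quarter of \<open>t * (norm d)\<^sup>2\<close>\<close>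
      define t where "t = min (min r r1 / (2 * norm d)) (1 / (4 * (\<bar>C\<bar> + 1)))"
      have t: "t > 0" using d r(1) r1(1) by (simp add: t_def add_nonneg_pos)
      have "t * norm d \<le> min r r1 / (2 * norm d) * norm d" using d by (intro mult_right_mono) (auto simp: t_def)
      then have td: "t * norm d < r" "t * norm d < r1" using d r(1) r1(1) by auto
      have "t \<le> 1 / (4 * (\<bar>C\<bar> + 1))" by (simp add: t_def)
      then have tC: "t * (\<bar>C\<bar> + 1) \<le> 1/4" by (simp add: field_simps)
      define y where "y = x + t *\<^sub>R d"
      have yx: "y - x = t *\<^sub>R d" "norm (y - x) = t * norm d" using t by (auto simp: y_def)
      have yU: "y \<in> U" by (rule r(2)) (simp only: yx(2) td(1))
      have "\<phi> x + ereal (v \<bullet> (y - x) - norm d / 4 * norm (y - x)) \<le> \<phi> y"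
        using r1(2)[of y] td yx(2) by (simp add: dist_norm)
      then have 1: "e x + t * (v \<bullet> d) - t * (norm d * norm d / 4) \<le> e y"
        using fin_U[OF x] fin_U[OF yU] t unfolding yx by (simp add: algebra_simps)
      have 2: "e y \<le> e x + t * (V x \<bullet> d) + C * (t * norm d)\<^sup>2"
        using expansion[OF x yU] t unfolding yx by simp
      have "C * (t * norm d)\<^sup>2 = t * ((t * C) * (norm d * norm d))" by (simp add: power2_eq_square)
      also have "\<dots> \<le> t * (1/4 * (norm d * norm d))"
      proof (intro mult_left_mono mult_right_mono)
        have "t * C \<le> t * (\<bar>C\<bar> + 1)" using t by (intro mult_left_mono) auto
        then show "t * C \<le> 1/4" using tC by linarith
      qed (use t in auto)
      finally have 3: "C * (t * norm d)\<^sup>2 \<le> t * (1/4 * (norm d * norm d))" .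
      have "t * (d \<bullet> d) = t * (v \<bullet> d) - t * (V x \<bullet> d)" by (simp add: d_def inner_diff_left right_diff_distrib)
      also have "\<dots> \<le> t * (1/2 * (norm d * norm d))" using 1 2 3 by (simp add: algebra_simps)
      finally have "d \<bullet> d \<le> 1/2 * (norm d * norm d)" using t by simp
      then have "norm d * norm d \<le> 0" by (simp add: dot_square_norm power2_eq_square)
      then show False using d by (simp add: mult_le_0_iff)
    qed
    then show "v \<in> {V x}" by (simp add: d_def)
  qed
qed

text \<open>The expansions at the approximating points converge, so a limit of gradients is again a gradient in the
  sense of the expansion.\<close>

lemma limiting_subdiff_expansion: assumes x: "x \<in> U" shows "limiting_subdiff \<phi> x = {V x}"
proof (rule equalityI)
  show "{V x} \<subseteq> limiting_subdiff \<phi> x"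
    using regular_subdiff_subset_limiting[of \<phi> x] regular_subdiff_expansion[OF x] by simp
  show "limiting_subdiff \<phi> x \<subseteq> {V x}"
  proof
    fix v assume "v \<in> limiting_subdiff \<phi> x"
    then obtain X Z where X: "X \<longlonglongrightarrow> x" and Z: "Z \<longlonglongrightarrow> v" and lim: "(\<lambda>k. \<phi> (X k)) \<longlonglongrightarrow> \<phi> x"
      and reg: "\<And>k. Z k \<in> regular_subdiff \<phi> (X k)" unfolding limiting_subdiff_def by blast
    obtain N where N: "\<And>k. k \<ge> N \<Longrightarrow> X k \<in> U"
      using topological_tendstoD[OF X open_U x] unfolding eventually_sequentially by blast
    have XN: "X (k + N) \<in> U" for k by (rule N) simp
    have ZV: "Z (k + N) = V (X (k + N))" for k using reg[of "k + N"] regular_subdiff_expansion[OF XN] by blast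
    have "(\<lambda>k. \<phi> (X (k + N))) \<longlonglongrightarrow> \<phi> x" by (rule LIMSEQ_ignore_initial_segment[OF lim])
    then have eX: "(\<lambda>k. e (X (k + N))) \<longlonglongrightarrow> e x" using fin_U[OF XN] fin_U[OF x] by simp
    have XN': "(\<lambda>k. X (k + N)) \<longlonglongrightarrow> x" by (rule LIMSEQ_ignore_initial_segment[OF X])
    have ZN': "(\<lambda>k. Z (k + N)) \<longlonglongrightarrow> v" by (rule LIMSEQ_ignore_initial_segment[OF Z])
    have "\<bar>e y - e x - v \<bullet> (y - x)\<bar> \<le> C * (norm (y - x))\<^sup>2" if y: "y \<in> U" for y
    proof (rule LIMSEQ_le)
      show "(\<lambda>k. \<bar>e y - e (X (k + N)) - Z (k + N) \<bullet> (y - X (k + N))\<bar>) \<longlonglongrightarrow> \<bar>e y - e x - v \<bullet> (y - x)\<bar>"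
        by (intro tendsto_intros eX XN' ZN')
      show "(\<lambda>k. C * (norm (y - X (k + N)))\<^sup>2) \<longlonglongrightarrow> C * (norm (y - x))\<^sup>2" by (intro tendsto_intros XN')
      show "\<exists>M. \<forall>k\<ge>M. \<bar>e y - e (X (k + N)) - Z (k + N) \<bullet> (y - X (k + N))\<bar> \<le> C * (norm (y - X (k + N)))\<^sup>2"
        using expansion[OF XN y] unfolding ZV by blast
    qed
    then have "v \<in> regular_subdiff \<phi> x" by (rule expansion_gradient_regular[OF x])
    then show "v \<in> {V x}" using regular_subdiff_expansion[OF x] by simp
  qed
qed

lemma has_egradient_expansion: assumes x: "x \<in> U" shows "has_egradient \<phi> x (V x)"
proof -
  obtain r where r: "r > 0" "\<And>y. norm (y - x) < r \<Longrightarrow> y \<in> U" using ball_in_U[OF x] by blast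
  have "\<forall>\<^sub>F y in nhds x. finite_at \<phi> y"
    unfolding eventually_nhds_metric using r fin_U by (intro exI[of _ r]) (auto simp: dist_norm finite_at_def)
  moreover have "((\<lambda>y. real_of_ereal (\<phi> y)) has_derivative (\<lambda>k. k \<bullet> V x)) (at x)"
    unfolding has_derivative_at_alt
  proof (intro conjI allI impI)
    show "bounded_linear (\<lambda>k. k \<bullet> V x)" by (rule bounded_linear_inner_left)
    fix \<eta> :: real assume "\<eta> > 0"
    define d where "d = min r (\<eta> / (\<bar>C\<bar> + 1))"
    have "d > 0" using r(1) \<open>\<eta> > 0\<close> by (simp add: d_def add_nonneg_pos)
    moreover have "norm (real_of_ereal (\<phi> y) - real_of_ereal (\<phi> x) - (y - x) \<bullet> V x) \<le> \<eta> * norm (y - x)"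
      if "norm (y - x) < d" for y
    proof -
      have n: "norm (y - x) < r" "norm (y - x) < \<eta> / (\<bar>C\<bar> + 1)" using that by (auto simp: d_def)
      have "(\<bar>C\<bar> + 1) * norm (y - x) \<le> \<eta>" using n(2) by (simp add: field_simps)
      moreover have "C * norm (y - x) \<le> (\<bar>C\<bar> + 1) * norm (y - x)" by (rule mult_right_mono) auto
      ultimately have "C * norm (y - x) * norm (y - x) \<le> \<eta> * norm (y - x)" by (intro mult_right_mono) auto
      then show ?thesis using expansion[OF x r(2)[OF n(1)]] fin_U[OF x] fin_U[OF r(2)[OF n(1)]]
        by (simp add: inner_commute power2_eq_square mult.assoc)
    qed
    ultimately show "\<exists>d>0. \<forall>y. norm (y - x) < d \<longrightarrow>
       norm (real_of_ereal (\<phi> y) - real_of_ereal (\<phi> x) - (y - x) \<bullet> V x) \<le> \<eta> * norm (y - x)" by blast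
  qed
  ultimately show ?thesis unfolding has_egradient_def gderiv_def by blast
qed

lemma egradient_expansion: assumes x: "x \<in> U" shows "egradient \<phi> x = V x"
  unfolding egradient_def
proof (rule the_equality)
  show "has_egradient \<phi> x (V x)" by (rule has_egradient_expansion[OF x])
  fix G assume "has_egradient \<phi> x G"
  then have "((\<lambda>y. real_of_ereal (\<phi> y)) has_derivative (\<lambda>k. k \<bullet> G)) (at x)"
    by (simp add: has_egradient_def gderiv_def)
  moreover have "((\<lambda>y. real_of_ereal (\<phi> y)) has_derivative (\<lambda>k. k \<bullet> V x)) (at x)"
    using has_egradient_expansion[OF x] by (simp add: has_egradient_def gderiv_def)
  ultimately have eq: "(\<lambda>k. k \<bullet> G) = (\<lambda>k. k \<bullet> V x)" by (rule has_derivative_unique)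
  show "G = V x" by (rule vector_eq_rdot[THEN iffD1]) (use fun_cong[OF eq] in \<open>simp add: inner_commute\<close>)
qed

lemma locally_lsc_expansion: assumes x: "x \<in> U" shows "locally_lsc_at \<phi> x"
proof -
  obtain r where r: "r > 0" "\<And>y. norm (y - x) < r \<Longrightarrow> y \<in> U" using ball_in_U[OF x] by blast
  have K: "y \<in> U" if "y \<in> cball x (r/2)" for y
    using that r(1) by (intro r(2)) (simp add: dist_norm norm_minus_commute)
  have "lsc_upto \<phi> (cball x (r/2)) (ereal (e x + r/2))" unfolding lsc_upto_def
  proof (intro allI impI, elim conjE)
    fix X a y b assume *: "\<forall>k. X k \<in> cball x (r/2) \<and> \<phi> (X k) \<le> ereal (a k)" "X \<longlonglongrightarrow> y" "a \<longlonglongrightarrow> b"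
    have "y \<in> cball x (r/2)" using closed_sequentially[OF closed_cball _ *(2)] *(1) by blast
    then have y: "y \<in> U" by (rule K)
    have XU: "X k \<in> U" for k using *(1) K by blast
    have "e y + V y \<bullet> (y - y) - C * (norm (y - y))\<^sup>2 \<le> b"
    proof (rule LIMSEQ_le)
      show "(\<lambda>k. e y + V y \<bullet> (X k - y) - C * (norm (X k - y))\<^sup>2) \<longlonglongrightarrow> e y + V y \<bullet> (y - y) - C * (norm (y - y))\<^sup>2"
        by (intro tendsto_intros *(2))
      show "a \<longlonglongrightarrow> b" by fact
      have "e y + V y \<bullet> (X k - y) - C * (norm (X k - y))\<^sup>2 \<le> a k" for k
      proof -
        have "e (X k) \<le> a k" using *(1) fin_U[OF XU] by (metis ereal_less_eq(3))
        then show ?thesis using expansion[OF y XU[of k]] by linarith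
      qed
      then show "\<exists>N. \<forall>k\<ge>N. e y + V y \<bullet> (X k - y) - C * (norm (X k - y))\<^sup>2 \<le> a k" by blast
    qed
    then show "\<phi> y \<le> ereal b" using fin_U[OF y] by simp
  qed
  then show ?thesis by (intro lsc_upto_imp_locally_lsc_at[where \<phi> = \<phi> and r = "r/2", OF fin_U[OF x]]) (use r in auto)
qed

end

section \<open>The Moreau envelope\<close>

text \<open>Prox-boundedness is used in the form of one global quadratic minorant that touches \<open>f\<close> at \<open>xbar\<close>. The bound on
  \<open>lam\<close> makes the proximal penalty four times as steep, so that proximal points of \<open>x\<close> stay near \<open>xbar\<close> if
  \<open>x\<close> does, and the prox-regularity inequality applies at them.\<close>

locale moreau_setting = epi_quadratic +
  fixes R lam :: real
  assumes lsc_f: "lsc f" and global: "\<And>w. ereal (c - R / 2 * (norm (w - xbar))\<^sup>2) \<le> f w"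
    and R_ge: "\<rho> \<le> R" and lam: "lam > 0" "4 * (lam * R) \<le> 1"
begin

abbreviation E :: "'a \<Rightarrow> ereal" where "E \<equiv> moreau_env lam f"
abbreviation eh :: "'a \<Rightarrow> ereal" where "eh \<equiv> moreau_env lam h"
abbreviation a :: real where "a \<equiv> 1 / (2 * lam)"

text \<open>A competitor \<open>w\<close> that is at least as good as \<open>xbar\<close> satisfies
  \<open>(norm (w - x))\<^sup>2 \<le> (norm (x - xbar))\<^sup>2 + (norm (w - xbar))\<^sup>2 / 4\<close> by the minorant. If \<open>w\<close> were more than four times as
  far from \<open>xbar\<close> as \<open>x\<close> is, the triangle inequality would contradict this.\<close>

lemma minimizer_near:
  assumes fw: "f w \<le> ereal b" and b: "b + a * (norm (w - x))\<^sup>2 \<le> c + a * (norm (x - xbar))\<^sup>2"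
  shows "norm (w - xbar) \<le> 4 * norm (x - xbar)"
proof (rule ccontr)
  define d n where "d = norm (w - xbar)" and "n = norm (x - xbar)"
  assume "\<not> ?thesis"
  then have dn: "d > 4 * n" "n \<ge> 0" by (auto simp: d_def n_def)
  have "ereal (c - R / 2 * d\<^sup>2) \<le> ereal b" using global[of w] fw unfolding d_def by (rule order_trans)
  then have "a * (norm (w - x))\<^sup>2 \<le> a * n\<^sup>2 + R / 2 * d\<^sup>2" using b by (simp add: n_def)
  then have "(2 * lam) * (a * (norm (w - x))\<^sup>2) \<le> (2 * lam) * (a * n\<^sup>2 + R / 2 * d\<^sup>2)"
    using lam(1) by (intro mult_left_mono) auto
  moreover have "(2 * lam) * (a * (norm (w - x))\<^sup>2) = (norm (w - x))\<^sup>2" using lam(1) by simp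
  moreover have "(2 * lam) * (a * n\<^sup>2 + R / 2 * d\<^sup>2) = n\<^sup>2 + lam * R * d\<^sup>2" using lam(1) by (simp add: distrib_left)
  ultimately have "(norm (w - x))\<^sup>2 \<le> n\<^sup>2 + lam * R * d\<^sup>2" by linarith
  moreover have "lam * R * d\<^sup>2 \<le> 1/4 * d\<^sup>2" using lam(2) by (intro mult_right_mono) auto
  ultimately have 1: "(norm (w - x))\<^sup>2 \<le> n\<^sup>2 + 1/4 * d\<^sup>2" by linarith
  have "d - n \<le> norm (w - x)" using norm_triangle_ineq[of "w - x" "x - xbar"] by (simp add: d_def n_def)
  then have "(d - n)\<^sup>2 \<le> (norm (w - x))\<^sup>2" using dn by (intro power_mono) auto
  with 1 have "3/4 * (d * d) \<le> 2 * n * d" by (simp add: power2_eq_square algebra_simps)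
  then have "d * (3/4 * d) \<le> d * (2 * n)" by (simp add: mult_ac)
  then show False using dn by (simp add: mult_le_cancel_left)
qed

text \<open>Minimise over a ball of radius larger than \<open>5 * norm (x - xbar)\<close>; all competitors that matter lie in
  its interior, so the minimum is global and its subgradient is not affected by the boundary.\<close>

lemma prox_point_exists:
  "\<exists>p b. norm (p - xbar) \<le> 4 * norm (x - xbar) \<and> f p = ereal b \<and> E x = ereal (b + a * (norm (p - x))\<^sup>2) \<and>
     (1 / lam) *\<^sub>R (x - p) \<in> limiting_subdiff f p"
proof -
  define n where "n = norm (x - xbar)"
  define r where "r = 5 * n + 1"
  have n: "n \<ge> 0" by (simp add: n_def)
  have "a > 0" using lam by simp
  have "\<exists>y b. y \<in> cball x r \<and> f y = ereal b \<and> (\<forall>y' b'. y' \<in> cball x r \<and> f y' \<le> ereal b' \<longrightarrow>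
    b - 0 \<bullet> (y - x) + a * (norm (y - x))\<^sup>2 \<le> b' - 0 \<bullet> (y' - x) + a * (norm (y' - x))\<^sup>2)"
  proof (rule quadratic_minimizer_exists[OF lsc_imp_lsc_upto[OF lsc_f, of _ \<infinity>]])
    show "xbar \<in> cball x r" using n by (simp add: r_def n_def dist_norm)
    show "f xbar \<le> ereal c" by (simp add: fin)
    show "ereal (c - R / 2 * (n + r)\<^sup>2) \<le> f y" if "y \<in> cball x r" for y
    proof -
      have "norm (y - xbar) \<le> n + r"
        using that norm_triangle_ineq[of "y - x" "x - xbar"] by (simp add: dist_norm norm_minus_commute n_def)
      then have "(norm (y - xbar))\<^sup>2 \<le> (n + r)\<^sup>2" by (intro power_mono) auto
      then have "R / 2 * (norm (y - xbar))\<^sup>2 \<le> R / 2 * (n + r)\<^sup>2" using rho R_ge by (intro mult_left_mono) auto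
      then have "ereal (c - R / 2 * (n + r)\<^sup>2) \<le> ereal (c - R / 2 * (norm (y - xbar))\<^sup>2)" by simp
      also have "\<dots> \<le> f y" by (rule global)
      finally show ?thesis .
    qed
    show "0 \<le> a" using \<open>a > 0\<close> by simp
  qed simp
  then obtain p b where p: "p \<in> cball x r" "f p = ereal b" and min: "\<And>y' b'. y' \<in> cball x r \<Longrightarrow> f y' \<le> ereal b' \<Longrightarrow>
    b - 0 \<bullet> (p - x) + a * (norm (p - x))\<^sup>2 \<le> b' - 0 \<bullet> (y' - x) + a * (norm (y' - x))\<^sup>2" by blast
  have le: "b + a * (norm (p - x))\<^sup>2 \<le> c + a * (norm (x - xbar))\<^sup>2"
    using min[of xbar c] fin n by (simp add: r_def n_def dist_norm norm_minus_commute)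
  have near: "norm (p - xbar) \<le> 4 * n" unfolding n_def by (rule minimizer_near[OF _ le]) (simp add: p)
  have px: "norm (p - x) \<le> 5 * n" using near norm_triangle_ineq4[of "p - xbar" "x - xbar"] by (simp add: n_def)
  have "E x = ereal (b + a * (norm (p - x))\<^sup>2)" unfolding moreau_env_def
  proof (rule antisym)
    show "(INF w. f w + ereal (a * (norm (w - x))\<^sup>2)) \<le> ereal (b + a * (norm (p - x))\<^sup>2)"
      by (rule INF_lower2[of p]) (auto simp: p)
    show "ereal (b + a * (norm (p - x))\<^sup>2) \<le> (INF w. f w + ereal (a * (norm (w - x))\<^sup>2))"
    proof (rule INF_greatest)
      fix w
      show "ereal (b + a * (norm (p - x))\<^sup>2) \<le> f w + ereal (a * (norm (w - x))\<^sup>2)"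
      proof (cases "f w")
        case (real b')
        have "b + a * (norm (p - x))\<^sup>2 \<le> b' + a * (norm (w - x))\<^sup>2"
        proof (cases "w \<in> cball x r")
          case True then show ?thesis using min[OF True, of b'] real by simp
        next
          case False
          show ?thesis
          proof (rule ccontr)
            assume "\<not> ?thesis"
            then have "b' + a * (norm (w - x))\<^sup>2 \<le> c + a * (norm (x - xbar))\<^sup>2" using le by linarith
            then have "norm (w - xbar) \<le> 4 * n" unfolding n_def by (intro minimizer_near[of w b']) (auto simp: real)
            then have "norm (w - x) \<le> 5 * n" using norm_triangle_ineq4[of "w - xbar" "x - xbar"] by (simp add: n_def)
            then show False using False by (simp add: r_def dist_norm norm_minus_commute)
          qed
        qed
        then show ?thesis using real by simp
      next
        case MInf then show ?thesis using global[of w] by simp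
      qed simp
    qed
  qed
  moreover have "(1 / lam) *\<^sub>R (x - p) \<in> limiting_subdiff f p"
  proof -
    have "0 - (2 * a) *\<^sub>R (p - x) \<in> regular_subdiff f p"
    proof (rule proximal_subgradient[where \<phi> = f, OF p(2) zero_less_one])
      fix y assume "norm (y - p) < 1"
      then have "y \<in> cball x r"
        using px norm_triangle_ineq[of "y - p" "p - x"] by (simp add: r_def dist_norm norm_minus_commute)
      then show "ereal (b + (0 - (2 * a) *\<^sub>R (p - x)) \<bullet> (y - p) - a * (norm (y - p))\<^sup>2) \<le> f y"
        by (intro quadratic_minimizer_ineq min)
    qed
    moreover have "0 - (2 * a) *\<^sub>R (p - x) = (1 / lam) *\<^sub>R (x - p)" by (simp add: algebra_simps)
    ultimately show ?thesis using regular_subdiff_subset_limiting[of f p] by auto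
  qed
  ultimately show ?thesis using near p(2) unfolding n_def by blast
qed

text \<open>Choosing some minimiser suffices: near \<open>xbar\<close> it is unique, but only because of the expansion property of
  the shifted graph below.\<close>

definition prox_point :: "'a \<Rightarrow> 'a" where
  "prox_point x = (SOME p. \<exists>b. norm (p - xbar) \<le> 4 * norm (x - xbar) \<and> f p = ereal b \<and>
     E x = ereal (b + a * (norm (p - x))\<^sup>2) \<and> (1 / lam) *\<^sub>R (x - p) \<in> limiting_subdiff f p)"

definition env_grad :: "'a \<Rightarrow> 'a" where "env_grad x = (1 / lam) *\<^sub>R (x - prox_point x)"
definition env :: "'a \<Rightarrow> real" where "env x = real_of_ereal (E x)"

lemma prox_point_props:
  "norm (prox_point x - xbar) \<le> 4 * norm (x - xbar)" "E x = ereal (env x)"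
  "f (prox_point x) = ereal (env x - a * (norm (prox_point x - x))\<^sup>2)" "env_grad x \<in> limiting_subdiff f (prox_point x)"
proof -
  obtain b where b: "norm (prox_point x - xbar) \<le> 4 * norm (x - xbar)" "f (prox_point x) = ereal b"
     "E x = ereal (b + a * (norm (prox_point x - x))\<^sup>2)" "(1 / lam) *\<^sub>R (x - prox_point x) \<in> limiting_subdiff f (prox_point x)"
    using someI_ex[OF prox_point_exists[of x]] unfolding prox_point_def[symmetric] by blast
  show "norm (prox_point x - xbar) \<le> 4 * norm (x - xbar)" by (rule b(1))
  show "E x = ereal (env x)" using b(3) by (simp add: env_def)
  show "f (prox_point x) = ereal (env x - a * (norm (prox_point x - x))\<^sup>2)" using b(2,3) by (simp add: env_def)
  show "env_grad x \<in> limiting_subdiff f (prox_point x)" using b(4) by (simp add: env_grad_def)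
qed

lemma E_le: "f w \<le> ereal b \<Longrightarrow> env x \<le> b + a * (norm (w - x))\<^sup>2"
proof -
  assume "f w \<le> ereal b"
  then have "f w + ereal (a * (norm (w - x))\<^sup>2) \<le> ereal b + ereal (a * (norm (w - x))\<^sup>2)" by (rule add_right_mono)
  moreover have "E x \<le> f w + ereal (a * (norm (w - x))\<^sup>2)" unfolding moreau_env_def by (rule INF_lower) simp
  ultimately have "ereal (env x) \<le> ereal b + ereal (a * (norm (w - x))\<^sup>2)" unfolding prox_point_props(2) by (meson order_trans)
  then show ?thesis by simp
qed

lemma prox_point_eq: "prox_point x = x - lam *\<^sub>R env_grad x"
  using lam by (simp add: env_grad_def)

lemma prox_point_xbar: "prox_point xbar = xbar" using prox_point_props(1)[of xbar] by simp
lemma env_grad_xbar: "env_grad xbar = 0" by (simp add: env_grad_def prox_point_xbar)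
lemma env_xbar: "env xbar = c" using prox_point_props(3)[of xbar] fin by (simp add: prox_point_xbar)

lemma env_grad_bound: "norm (env_grad x) \<le> 5 / lam * norm (x - xbar)"
proof -
  have "norm (x - prox_point x) \<le> 5 * norm (x - xbar)"
    using prox_point_props(1)[of x] norm_triangle_ineq4[of "x - xbar" "prox_point x - xbar"] by simp
  moreover have "norm (env_grad x) = norm (x - prox_point x) / lam" unfolding env_grad_def using lam by simp
  ultimately show ?thesis using lam by (simp add: divide_right_mono)
qed

definition smooth_radius :: real where "smooth_radius = min (\<epsilon> / 4) (lam * \<epsilon> / 5)"

lemma smooth_radius_pos: "smooth_radius > 0" using eps lam by (simp add: smooth_radius_def)

lemma near_graph:
  assumes "norm (x - xbar) < smooth_radius"
  shows "norm (prox_point x - xbar) < \<epsilon>" "norm (env_grad x) < \<epsilon>"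
proof -
  have d: "norm (x - xbar) < \<epsilon> / 4" "norm (x - xbar) < lam * \<epsilon> / 5" using assms by (auto simp: smooth_radius_def)
  show "norm (prox_point x - xbar) < \<epsilon>" using prox_point_props(1)[of x] d(1) by simp
  have "5 / lam * norm (x - xbar) < 5 / lam * (lam * \<epsilon> / 5)" using d(2) lam by (intro mult_strict_left_mono) auto
  then show "norm (env_grad x) < \<epsilon>" using env_grad_bound[of x] lam by simp
qed

text \<open>Adding the prox-regularity inequalities at both points shows that \<open>\<partial>f + \<rho> I\<close> is locally monotone. As
  \<open>lam * \<rho> \<le> 1/4\<close>, the map \<open>(w, v) \<mapsto> w + lam *\<^sub>R v\<close> then cannot contract the first component by more than a
  constant, which makes the proximal map single-valued and Lipschitz.\<close>

lemma shifted_graph_expansive: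
  assumes v1: "v1 \<in> limiting_subdiff f w1" "norm (w1 - xbar) < \<epsilon>" "norm v1 < \<epsilon>"
    and v2: "v2 \<in> limiting_subdiff f w2" "norm (w2 - xbar) < \<epsilon>" "norm v2 < \<epsilon>"
  shows "norm (w1 - w2) \<le> 2 * norm (w1 + lam *\<^sub>R v1 - (w2 + lam *\<^sub>R v2))"
proof -
  define d where "d = norm (w1 - w2)"
  obtain f1 f2 where f: "f w1 = ereal f1" "f w2 = ereal f2" using limiting_subdiff_finite v1 v2 by metis
  have "f1 + (v1 \<bullet> (w2 - w1) - \<rho> / 2 * (norm (w2 - w1))\<^sup>2) \<le> f2"
    using prox[OF v1, of w2] v2(2) f by (simp add: dist_norm norm_minus_commute)
  moreover have "f2 + (v2 \<bullet> (w1 - w2) - \<rho> / 2 * (norm (w1 - w2))\<^sup>2) \<le> f1"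
    using prox[OF v2, of w1] v1(2) f by (simp add: dist_norm norm_minus_commute)
  ultimately have "- (\<rho> * d\<^sup>2) \<le> (v1 - v2) \<bullet> (w1 - w2)"
    by (simp add: d_def norm_minus_commute inner_diff_left inner_diff_right)
  then have "lam * - (\<rho> * d\<^sup>2) \<le> lam * ((v1 - v2) \<bullet> (w1 - w2))" using lam by (intro mult_left_mono) auto
  moreover have "lam * \<rho> * d\<^sup>2 \<le> 1/4 * d\<^sup>2"
  proof (rule mult_right_mono)
    have "lam * \<rho> \<le> lam * R" using R_ge lam by simp
    then show "lam * \<rho> \<le> 1/4" using lam(2) by linarith
  qed simp
  moreover have "(w1 + lam *\<^sub>R v1 - (w2 + lam *\<^sub>R v2)) \<bullet> (w1 - w2) = d\<^sup>2 + lam * ((v1 - v2) \<bullet> (w1 - w2))"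
    by (simp add: d_def power2_norm_eq_inner algebra_simps inner_commute)
  ultimately have "3/4 * d\<^sup>2 \<le> (w1 + lam *\<^sub>R v1 - (w2 + lam *\<^sub>R v2)) \<bullet> (w1 - w2)" by linarith
  also have "\<dots> \<le> norm (w1 + lam *\<^sub>R v1 - (w2 + lam *\<^sub>R v2)) * d" unfolding d_def by (rule norm_cauchy_schwarz)
  finally have "d * (3/4 * d) \<le> d * norm (w1 + lam *\<^sub>R v1 - (w2 + lam *\<^sub>R v2))" by (simp add: power2_eq_square mult_ac)
  moreover have "d \<ge> 0" by (simp add: d_def)
  ultimately have "3/4 * d \<le> norm (w1 + lam *\<^sub>R v1 - (w2 + lam *\<^sub>R v2))"
    by (cases "d = 0") (auto simp: mult_le_cancel_left)
  then show ?thesis using norm_ge_zero[of "w1 + lam *\<^sub>R v1 - (w2 + lam *\<^sub>R v2)"] unfolding d_def by linarith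
qed

lemma env_grad_lipschitz:
  assumes "norm (x - xbar) < smooth_radius" "norm (y - xbar) < smooth_radius"
  shows "norm (env_grad x - env_grad y) \<le> 3 / lam * norm (x - y)"
proof -
  have "norm (prox_point x - prox_point y) \<le> 2 * norm (prox_point x + lam *\<^sub>R env_grad x - (prox_point y + lam *\<^sub>R env_grad y))"
    by (rule shifted_graph_expansive) (use prox_point_props(4) near_graph assms in auto)
  then have "norm (prox_point x - prox_point y) \<le> 2 * norm (x - y)" by (simp add: prox_point_eq)
  moreover have "env_grad x - env_grad y = (1 / lam) *\<^sub>R ((x - y) - (prox_point x - prox_point y))" by (simp add: env_grad_def algebra_simps)
  then have "norm (env_grad x - env_grad y) = 1 / lam * norm ((x - y) - (prox_point x - prox_point y))" using lam by simp
  moreover have "norm ((x - y) - (prox_point x - prox_point y)) \<le> norm (x - y) + norm (prox_point x - prox_point y)" by (rule norm_triangle_ineq4)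
  ultimately have "norm (env_grad x - env_grad y) \<le> 1 / lam * (3 * norm (x - y))" using lam by (simp add: divide_right_mono)
  then show ?thesis by simp
qed

text \<open>Test the infimum that defines the envelope at \<open>y\<close> with the proximal point of \<open>x\<close>.\<close>

lemma env_upper: "env y \<le> env x + env_grad x \<bullet> (y - x) + a * (norm (y - x))\<^sup>2"
proof -
  have "env y \<le> env x - a * (norm (prox_point x - x))\<^sup>2 + a * (norm (prox_point x - y))\<^sup>2"
    by (rule E_le) (simp add: prox_point_props(3))
  also have "(norm (prox_point x - y))\<^sup>2 = (norm (prox_point x - x))\<^sup>2 + 2 * lam * (env_grad x \<bullet> (y - x)) + (norm (y - x))\<^sup>2"
    using lam unfolding env_grad_def by (simp add: power2_norm_eq_inner algebra_simps inner_commute)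
  finally have "env y \<le> env x - a * (norm (prox_point x - x))\<^sup>2
     + a * ((norm (prox_point x - x))\<^sup>2 + 2 * lam * (env_grad x \<bullet> (y - x)) + (norm (y - x))\<^sup>2)" .
  moreover have "a * (p + 2 * lam * q + r) = a * p + q + a * r" for p q r using lam by (simp add: distrib_left)
  ultimately show ?thesis by (simp only:)
qed

text \<open>The upper estimate with the roles of \<open>x\<close> and \<open>y\<close> exchanged is a lower estimate with the gradient at the
  wrong point; the Lipschitz estimate for the gradient corrects this.\<close>

lemma env_expansion:
  assumes x: "norm (x - xbar) < smooth_radius" and y: "norm (y - xbar) < smooth_radius"
  shows "\<bar>env y - env x - env_grad x \<bullet> (y - x)\<bar> \<le> 4 / lam * (norm (y - x))\<^sup>2"
proof -
  have la: "a \<le> 1 / lam" using lam by (intro divide_left_mono) auto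
  then have q: "a * (norm (y - x))\<^sup>2 \<le> 1 / lam * (norm (y - x))\<^sup>2" by (intro mult_right_mono) auto
  have q': "0 \<le> 1 / lam * (norm (y - x))\<^sup>2" using lam by simp
  have "(env_grad x - env_grad y) \<bullet> (y - x) \<le> norm (env_grad x - env_grad y) * norm (y - x)" by (rule norm_cauchy_schwarz)
  also have "\<dots> \<le> 3 / lam * norm (x - y) * norm (y - x)" using env_grad_lipschitz[OF x y] by (rule mult_right_mono) simp
  finally have m: "(env_grad x - env_grad y) \<bullet> (y - x) \<le> 3 * (1 / lam * (norm (y - x))\<^sup>2)"
    by (simp add: norm_minus_commute power2_eq_square)
  have u: "env y \<le> env x + env_grad x \<bullet> (y - x) + a * (norm (y - x))\<^sup>2" by (rule env_upper)
  have l: "env x \<le> env y + env_grad y \<bullet> (x - y) + a * (norm (y - x))\<^sup>2" using env_upper[of x y] by (simp add: norm_minus_commute)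
  have "env_grad y \<bullet> (x - y) = (env_grad x - env_grad y) \<bullet> (y - x) - env_grad x \<bullet> (y - x)" by (simp add: algebra_simps)
  then have "env x \<le> env y - env_grad x \<bullet> (y - x) + 4 * (1 / lam * (norm (y - x))\<^sup>2)" using l m q by linarith
  then show ?thesis using u q q' by (simp add: abs_le_iff)
qed

sublocale E_exp: quadratic_expansion E env env_grad "ball xbar smooth_radius" "4 / lam"
proof
  fix x y assume "x \<in> ball xbar smooth_radius" "y \<in> ball xbar smooth_radius"
  then show "\<bar>env y - env x - env_grad x \<bullet> (y - x)\<bar> \<le> 4 / lam * (norm (y - x))\<^sup>2"
    by (intro env_expansion) (auto simp: dist_norm norm_minus_commute)
qed (auto simp: prox_point_props(2))

lemma inverse_graph:
  assumes v: "v \<in> limiting_subdiff f w" "norm (w - xbar) < \<epsilon>" "norm v < \<epsilon>" and x: "norm (w + lam *\<^sub>R v - xbar) < smooth_radius"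
  shows "env_grad (w + lam *\<^sub>R v) = v"
proof -
  let ?x = "w + lam *\<^sub>R v"
  have px: "prox_point ?x + lam *\<^sub>R env_grad ?x = ?x" by (simp add: prox_point_eq)
  have "norm (w - prox_point ?x) \<le> 2 * norm (?x - (prox_point ?x + lam *\<^sub>R env_grad ?x))"
    by (rule shifted_graph_expansive[OF v prox_point_props(4) near_graph[OF x]])
  then have "w = prox_point ?x" unfolding px by simp
  with px have "w + lam *\<^sub>R env_grad ?x = w + lam *\<^sub>R v" by simp
  then have "lam *\<^sub>R env_grad ?x = lam *\<^sub>R v" by (rule add_left_imp_eq)
  then show ?thesis using lam by simp
qed

abbreviation DE :: "'a \<Rightarrow> 'a set" where
  "DE \<equiv> graphical_deriv (limiting_subdiff E) xbar 0"

text \<open>The graph of the gradient of the envelope near \<open>(xbar, 0)\<close> is the image of the graph of \<open>\<partial>f\<close> under the linear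
  bijection \<open>(w, v) \<mapsto> (w + lam *\<^sub>R v, v)\<close>, and tangent cones are transported by it.\<close>

lemma DE_iff: "v \<in> DE w \<longleftrightarrow> v \<in> D (w - lam *\<^sub>R v)"
proof
  assume "v \<in> DE w"
  then obtain t W Z where t: "\<And>k. t k > 0" "t \<longlonglongrightarrow> 0" and W: "W \<longlonglongrightarrow> w" and Z: "Z \<longlonglongrightarrow> v"
    and g: "\<And>k. 0 + t k *\<^sub>R Z k \<in> limiting_subdiff E (xbar + t k *\<^sub>R W k)" unfolding graphical_deriv_seq by blast
  show "v \<in> D (w - lam *\<^sub>R v)"
  proof (rule graphical_deriv_eventuallyI[OF t])
    show "(\<lambda>k. W k - lam *\<^sub>R Z k) \<longlonglongrightarrow> w - lam *\<^sub>R v" by (intro tendsto_intros W Z)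
    show "Z \<longlonglongrightarrow> v" by fact
    show "\<forall>\<^sub>F k in sequentially. 0 + t k *\<^sub>R Z k \<in> limiting_subdiff f (xbar + t k *\<^sub>R (W k - lam *\<^sub>R Z k))"
      using eventually_near_xbar[OF t(2) W smooth_radius_pos]
    proof eventually_elim
      case (elim k)
      let ?x = "xbar + t k *\<^sub>R W k"
      have "?x \<in> ball xbar smooth_radius" using elim by (simp add: dist_norm)
      then have Vx: "t k *\<^sub>R Z k = env_grad ?x" using g[of k] E_exp.limiting_subdiff_expansion by simp
      have "prox_point ?x = xbar + t k *\<^sub>R (W k - lam *\<^sub>R Z k)" unfolding prox_point_eq Vx[symmetric] by (simp add: algebra_simps)
      then show ?case using prox_point_props(4)[of ?x] Vx by simp
    qed
  qed
next
  assume "v \<in> D (w - lam *\<^sub>R v)"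
  then obtain t W Z where t: "\<And>k. t k > 0" "t \<longlonglongrightarrow> 0" and W: "W \<longlonglongrightarrow> w - lam *\<^sub>R v" and Z: "Z \<longlonglongrightarrow> v"
    and g: "\<And>k. t k *\<^sub>R Z k \<in> limiting_subdiff f (xbar + t k *\<^sub>R W k)" using D_seq by blast
  have "(\<lambda>k. W k + lam *\<^sub>R Z k) \<longlonglongrightarrow> w - lam *\<^sub>R v + lam *\<^sub>R v" by (intro tendsto_intros W Z)
  then have WZ: "(\<lambda>k. W k + lam *\<^sub>R Z k) \<longlonglongrightarrow> w" by simp
  show "v \<in> DE w"
  proof (rule graphical_deriv_eventuallyI[OF t WZ Z])
    show "\<forall>\<^sub>F k in sequentially. 0 + t k *\<^sub>R Z k \<in> limiting_subdiff E (xbar + t k *\<^sub>R (W k + lam *\<^sub>R Z k))"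
      using eventually_near_xbar[OF t(2) WZ smooth_radius_pos] eventually_near_xbar[OF t(2) W eps] eventually_near_xbar[OF t(2) Z eps]
    proof eventually_elim
      case (elim k)
      have x: "xbar + t k *\<^sub>R (W k + lam *\<^sub>R Z k) = (xbar + t k *\<^sub>R W k) + lam *\<^sub>R (t k *\<^sub>R Z k)" by (simp add: algebra_simps)
      have "env_grad (xbar + t k *\<^sub>R (W k + lam *\<^sub>R Z k)) = t k *\<^sub>R Z k" unfolding x
      proof (rule inverse_graph[OF g])
        show "norm (xbar + t k *\<^sub>R W k + lam *\<^sub>R (t k *\<^sub>R Z k) - xbar) < smooth_radius" unfolding x[symmetric] using elim by simp
      qed (use elim in simp_all)
      moreover have "xbar + t k *\<^sub>R (W k + lam *\<^sub>R Z k) \<in> ball xbar smooth_radius" using elim by (simp add: dist_norm)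
      ultimately show ?case using E_exp.limiting_subdiff_expansion by simp
    qed
  qed
qed

lemma eh_le: "h p \<le> ereal b \<Longrightarrow> eh w \<le> ereal (b + a * (norm (p - w))\<^sup>2)"
proof -
  assume "h p \<le> ereal b"
  have "eh w \<le> h p + ereal (a * (norm (p - w))\<^sup>2)" unfolding moreau_env_def by (rule INF_lower) simp
  also have "\<dots> \<le> ereal b + ereal (a * (norm (p - w))\<^sup>2)" using \<open>h p \<le> ereal b\<close> by (rule add_right_mono)
  finally show ?thesis by simp
qed

text \<open>If the envelope were too small along \<open>xbar + t *\<^sub>R w'\<close>, the proximal points \<open>xbar + t *\<^sub>R p\<close>, whose directions
  \<open>p\<close> are bounded, would accumulate at a direction \<open>q\<close> with \<open>h q + a * (norm (q - w))\<^sup>2 \<le> b\<close>, by the minorant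
  property of \<open>h\<close>.\<close>

lemma E_minorant: "second_order_minorant E xbar eh"
  unfolding second_order_minorant_def
proof (intro allI impI, rule ccontr)
  fix w b assume b: "ereal b < eh w"
    and neg: "\<not> (\<exists>\<delta>>0. \<forall>t w'. 0 < t \<and> t < \<delta> \<and> norm (w' - w) < \<delta> \<longrightarrow> E xbar + ereal (t\<^sup>2 * b) < E (xbar + t *\<^sub>R w'))"
  have ex: "\<exists>t w'. 0 < t \<and> t < \<delta> \<and> norm (w' - w) < \<delta> \<and> env (xbar + t *\<^sub>R w') \<le> c + t\<^sup>2 * b" if "\<delta> > 0" for \<delta>
  proof -
    obtain t w' where "0 < t" "t < \<delta>" "norm (w' - w) < \<delta>" "\<not> E xbar + ereal (t\<^sup>2 * b) < E (xbar + t *\<^sub>R w')"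
      using neg \<open>\<delta> > 0\<close> by blast
    then show ?thesis by (intro exI[of _ t] exI[of _ w']) (simp add: prox_point_props(2) env_xbar not_less)
  qed
  obtain t W where H: "\<And>k. 0 < t k \<and> t k < inverse (real (Suc k)) \<and> norm (W k - w) < inverse (real (Suc k)) \<and>
      env (xbar + t k *\<^sub>R W k) \<le> c + (t k)\<^sup>2 * b"
    using null_seq_choice[of "\<lambda>\<delta> t w'. 0 < t \<and> t < \<delta> \<and> norm (w' - w) < \<delta> \<and> env (xbar + t *\<^sub>R w') \<le> c + t\<^sup>2 * b", OF ex] by blast
  have tp: "t k > 0" for k using H by blast
  have tl: "t \<longlonglongrightarrow> 0" by (rule tendsto_of_inverse_Suc) (use H in \<open>simp add: abs_of_pos\<close>)
  have Wl: "W \<longlonglongrightarrow> w" by (rule tendsto_of_inverse_Suc) (use H in blast)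
  define p where "p k = (prox_point (xbar + t k *\<^sub>R W k) - xbar) /\<^sub>R t k" for k
  have Pp: "prox_point (xbar + t k *\<^sub>R W k) = xbar + t k *\<^sub>R p k" for k using tp[of k] by (simp add: p_def)
  have np: "norm (p k) \<le> 4 * norm (W k)" for k
  proof -
    have "norm (t k *\<^sub>R p k) \<le> 4 * norm (t k *\<^sub>R W k)" using prox_point_props(1)[of "xbar + t k *\<^sub>R W k"] unfolding Pp by simp
    then show ?thesis using tp[of k] by simp
  qed
  obtain B where B: "\<And>k. norm (W k) \<le> B" using convergent_imp_bounded[OF Wl] by (auto simp: bounded_iff)
  have "norm (p k) \<le> 4 * B" for k using np[of k] B[of k] by linarith
  then obtain q r where r: "strict_mono r" and pl: "(p \<circ> r) \<longlonglongrightarrow> q" using bounded_subseq[of p] by blast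
  have lims: "(\<lambda>k. t (r k)) \<longlonglongrightarrow> 0" "(\<lambda>k. W (r k)) \<longlonglongrightarrow> w" "(\<lambda>k. p (r k)) \<longlonglongrightarrow> q"
    using LIMSEQ_subseq_LIMSEQ[OF tl r] LIMSEQ_subseq_LIMSEQ[OF Wl r] pl by (auto simp: o_def)
  have fp: "f (xbar + t k *\<^sub>R p k) \<le> ereal (c + (t k)\<^sup>2 * (b - a * (norm (p k - W k))\<^sup>2))" for k
  proof -
    have "xbar + t k *\<^sub>R p k - (xbar + t k *\<^sub>R W k) = t k *\<^sub>R (p k - W k)" by (simp add: algebra_simps)
    then have n: "(norm (xbar + t k *\<^sub>R p k - (xbar + t k *\<^sub>R W k)))\<^sup>2 = (t k)\<^sup>2 * (norm (p k - W k))\<^sup>2"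
      by (simp add: power_mult_distrib)
    show ?thesis using prox_point_props(3)[of "xbar + t k *\<^sub>R W k"] H[of k] unfolding Pp n by (simp add: algebra_simps)
  qed
  have "h q \<le> ereal (b - a * (norm (q - w))\<^sup>2)"
  proof (rule ccontr)
    assume "\<not> ?thesis"
    then obtain b1 where b1: "b - a * (norm (q - w))\<^sup>2 < b1" "ereal b1 < h q"
      using ereal_dense2[of "ereal (b - a * (norm (q - w))\<^sup>2)" "h q"] by (auto simp: not_le)
    have "\<forall>\<^sub>F k in sequentially. ereal (c + (t (r k))\<^sup>2 * b1) < f (xbar + t (r k) *\<^sub>R p (r k))"
      by (rule minorant_seq[OF b1(2) tp lims(1,3)])
    moreover have "(\<lambda>k. b - a * (norm (p (r k) - W (r k)))\<^sup>2) \<longlonglongrightarrow> b - a * (norm (q - w))\<^sup>2" by (intro tendsto_intros lims)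
    then have "\<forall>\<^sub>F k in sequentially. b - a * (norm (p (r k) - W (r k)))\<^sup>2 < b1" using b1(1) by (rule order_tendstoD)
    ultimately have "\<forall>\<^sub>F k in sequentially. False"
    proof eventually_elim
      case (elim k)
      have "ereal (c + (t (r k))\<^sup>2 * b1) < ereal (c + (t (r k))\<^sup>2 * (b - a * (norm (p (r k) - W (r k)))\<^sup>2))"
        using elim(1) fp[of "r k"] by (rule less_le_trans)
      then have "(t (r k))\<^sup>2 * b1 < (t (r k))\<^sup>2 * (b - a * (norm (p (r k) - W (r k)))\<^sup>2)" by simp
      then have "b1 < b - a * (norm (p (r k) - W (r k)))\<^sup>2" using tp[of "r k"] by (simp only: mult_less_cancel_left_pos zero_less_power)
      then show False using elim(2) by simp
    qed
    then show False by simp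
  qed
  from eh_le[OF this, of w] b show False by simp
qed

text \<open>Constant directions recover the envelope: near-optimal \<open>p\<close> in the infimum for \<open>h\<close> have recovery sequences
  for \<open>f\<close>, and these are competitors in the infimum for the envelope of \<open>f\<close>.\<close>

lemma E_recovery: "second_order_recovery E xbar eh"
  unfolding second_order_recovery_def
proof (intro allI impI, elim conjE)
  fix w and t :: "nat \<Rightarrow> real" assume t: "\<forall>k. 0 < t k" "t \<longlonglongrightarrow> 0"
  have "\<forall>\<^sub>F k in sequentially. E (xbar + t k *\<^sub>R w) < E xbar + ereal ((t k)\<^sup>2 * b)" if b: "eh w < ereal b" for b
  proof -
    obtain p where "h p + ereal (a * (norm (p - w))\<^sup>2) < ereal b" using b unfolding moreau_env_def INF_less_iff by blast
    then have "h p < ereal (b - a * (norm (p - w))\<^sup>2)" by (cases "h p") auto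
    then obtain b1 where b1: "h p < ereal b1" "b1 < b - a * (norm (p - w))\<^sup>2"
      using ereal_dense2[of "h p" "ereal (b - a * (norm (p - w))\<^sup>2)"] by auto
    obtain Q where Q: "Q \<longlonglongrightarrow> p" "\<And>b. h p < ereal b \<Longrightarrow> \<forall>\<^sub>F k in sequentially. f (xbar + t k *\<^sub>R Q k) < ereal (c + (t k)\<^sup>2 * b)"
      using recoveryE[of t p] t by blast
    have "(\<lambda>k. a * (norm (Q k - w))\<^sup>2) \<longlonglongrightarrow> a * (norm (p - w))\<^sup>2" by (intro tendsto_intros Q)
    then have "\<forall>\<^sub>F k in sequentially. a * (norm (Q k - w))\<^sup>2 < b - b1" by (rule order_tendstoD) (use b1 in simp)
    with Q(2)[OF b1(1)] show ?thesis
    proof eventually_elim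
      case (elim k)
      have "xbar + t k *\<^sub>R Q k - (xbar + t k *\<^sub>R w) = t k *\<^sub>R (Q k - w)" by (simp add: algebra_simps)
      then have n: "(norm (xbar + t k *\<^sub>R Q k - (xbar + t k *\<^sub>R w)))\<^sup>2 = (t k)\<^sup>2 * (norm (Q k - w))\<^sup>2"
        by (simp add: power_mult_distrib)
      have "env (xbar + t k *\<^sub>R w) \<le> c + (t k)\<^sup>2 * b1 + a * ((t k)\<^sup>2 * (norm (Q k - w))\<^sup>2)"
        using E_le[OF less_imp_le[OF elim(1)], of "xbar + t k *\<^sub>R w"] unfolding n .
      also have "\<dots> = c + (t k)\<^sup>2 * (b1 + a * (norm (Q k - w))\<^sup>2)" by (simp add: algebra_simps)
      also have "\<dots> < c + (t k)\<^sup>2 * b"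
      proof -
        have "(t k)\<^sup>2 * (b1 + a * (norm (Q k - w))\<^sup>2) < (t k)\<^sup>2 * b"
          using elim(2) t(1)[rule_format, of k] by (intro mult_strict_left_mono) auto
        then show ?thesis by simp
      qed
      finally show ?case by (simp add: prox_point_props(2) env_xbar)
    qed
  qed
  then show "\<exists>W. W \<longlonglongrightarrow> w \<and> (\<forall>b. eh w < ereal b \<longrightarrow>
     (\<forall>\<^sub>F k in sequentially. E (xbar + t k *\<^sub>R W k) < E xbar + ereal ((t k)\<^sup>2 * b)))"
    by (intro exI[of _ "\<lambda>_. w"]) auto
qed

text \<open>The constant \<open>8 / lam\<close> is twice that of the quadratic expansion, since prox-regularity carries a factor
  \<open>1/2\<close>; halving the radius keeps the closed ball inside the region of smoothness.\<close>

sublocale En: epi_quadratic E xbar c "smooth_radius / 2" "8 / lam" eh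
proof
  show "E xbar = ereal c" by (simp add: prox_point_props(2) env_xbar)
  show "locally_lsc_at E xbar" by (rule E_exp.locally_lsc_expansion) (simp add: smooth_radius_pos)
  show "0 \<in> limiting_subdiff E xbar" using E_exp.limiting_subdiff_expansion[of xbar] smooth_radius_pos env_grad_xbar by simp
  show "0 < smooth_radius / 2" using smooth_radius_pos by simp
  show "0 \<le> 8 / lam" using lam by simp
  show "second_order_minorant E xbar eh" by (rule E_minorant)
  show "second_order_recovery E xbar eh" by (rule E_recovery)
  show "set_inv DE 0 = {0}" using nonsing unfolding set_inv_def by (simp add: DE_iff)
  fix x v x' assume v: "v \<in> limiting_subdiff E x" and x: "norm (x - xbar) < smooth_radius / 2" and x': "x' \<in> cball xbar (smooth_radius / 2)"
  have "norm (x - xbar) < smooth_radius" "norm (x' - xbar) < smooth_radius" using x x' smooth_radius_pos by (auto simp: dist_norm norm_minus_commute)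
  moreover from this have "v = env_grad x" using v E_exp.limiting_subdiff_expansion[of x] by (simp add: dist_norm norm_minus_commute)
  ultimately have "env x + v \<bullet> (x' - x) - 4 / lam * (norm (x' - x))\<^sup>2 \<le> env x'" using env_expansion[of x x'] by (simp add: abs_le_iff)
  then show "E x + ereal (v \<bullet> (x' - x) - 8 / lam / 2 * (norm (x' - x))\<^sup>2) \<le> E x'" by (simp add: prox_point_props(2))
qed

text \<open>The gradients of the envelope at \<open>xbar + t *\<^sub>R w\<close>, divided by \<open>t\<close>, are bounded and have a cluster point
  \<open>v\<close>. The two halves of the quadratic expansion of the envelope of \<open>f\<close> pass to the limit along it: the
  lower one by the limit along the graph, the upper one by the minorant property.\<close>

lemma eh_expansion:
  "\<exists>b v. eh w = ereal b \<and> (\<forall>w' b'. eh w' = ereal b' \<longrightarrow> \<bar>b' - b - v \<bullet> (w' - w)\<bar> \<le> 4 / lam * (norm (w' - w))\<^sup>2)"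
proof -
  let ?t = "\<lambda>k. inverse (real (Suc k))"
  have tl: "?t \<longlonglongrightarrow> 0" and tp: "\<And>k. ?t k > 0" using null_seq_Suc by auto
  define Z where "Z k = env_grad (xbar + ?t k *\<^sub>R w) /\<^sub>R ?t k" for k
  have VZ: "env_grad (xbar + ?t k *\<^sub>R w) = ?t k *\<^sub>R Z k" for k using tp[of k] by (simp add: Z_def)
  have "norm (Z k) \<le> 5 / lam * norm w" for k
  proof -
    have "norm (?t k *\<^sub>R Z k) \<le> 5 / lam * norm (?t k *\<^sub>R w)" using env_grad_bound[of "xbar + ?t k *\<^sub>R w"] unfolding VZ by simp
    then have "?t k * norm (Z k) \<le> ?t k * (5 / lam * norm w)" by (simp add: mult_ac)
    then show ?thesis using tp[of k] by (simp only: mult_le_cancel_left_pos)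
  qed
  then obtain v r where r: "strict_mono r" and Zl: "(Z \<circ> r) \<longlonglongrightarrow> v" using bounded_subseq[of Z] by blast
  obtain N where N: "\<And>k. k \<ge> N \<Longrightarrow> norm (?t k *\<^sub>R w) < smooth_radius"
    using eventually_near_xbar[OF tl tendsto_const smooth_radius_pos, of w] unfolding eventually_sequentially by blast
  define s where "s k = ?t (r (k + N))" for k
  define Y where "Y k = Z (r (k + N))" for k
  have rN: "r (k + N) \<ge> N" for k using seq_suble[OF r, of "k + N"] by simp
  have sp: "s k > 0" for k unfolding s_def by (rule tp)
  have sl: "s \<longlonglongrightarrow> 0" using LIMSEQ_ignore_initial_segment[OF LIMSEQ_subseq_LIMSEQ[OF tl r], of N] unfolding s_def o_def .
  have Yl: "Y \<longlonglongrightarrow> v" using LIMSEQ_ignore_initial_segment[OF Zl, of N] unfolding Y_def o_def .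
  have VY: "env_grad (xbar + s k *\<^sub>R w) = s k *\<^sub>R Y k" for k unfolding s_def Y_def by (rule VZ)
  have sub: "s k *\<^sub>R Y k \<in> limiting_subdiff E (xbar + s k *\<^sub>R w)" for k
    using E_exp.limiting_subdiff_expansion[of "xbar + s k *\<^sub>R w"] N[OF rN[of k]] VY[of k] unfolding s_def by (simp add: dist_norm)
  obtain b A where b: "eh w = ereal b" and Al: "A \<longlonglongrightarrow> b" and A: "\<And>k. E (xbar + s k *\<^sub>R w) = ereal (c + (s k)\<^sup>2 * A k)"
    and low: "\<And>w' b'. eh w' \<le> ereal b' \<Longrightarrow> b + v \<bullet> (w' - w) - 8 / lam / 2 * (norm (w' - w))\<^sup>2 \<le> b'"
    using En.graph_limit[OF sp sl tendsto_const[of w] Yl sub] by blast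
  have up: "b' \<le> b + v \<bullet> (w' - w) + 4 / lam * (norm (w' - w))\<^sup>2" if b': "eh w' = ereal b'" for w' b'
  proof (rule dense_le)
    fix b1 assume "b1 < b'"
    then have "ereal b1 < eh w'" using b' by simp
    then have "\<forall>\<^sub>F k in sequentially. ereal (c + (s k)\<^sup>2 * b1) < E (xbar + s k *\<^sub>R w')"
      by (rule En.minorant_seq[OF _ sp sl tendsto_const])
    then have ev: "\<forall>\<^sub>F k in sequentially. b1 \<le> A k + Y k \<bullet> (w' - w) + 4 / lam * (norm (w' - w))\<^sup>2"
    proof eventually_elim
      case (elim k)
      have d: "xbar + s k *\<^sub>R w' - (xbar + s k *\<^sub>R w) = s k *\<^sub>R (w' - w)" by (simp add: algebra_simps)
      have n: "(norm (s k *\<^sub>R (w' - w)))\<^sup>2 = (s k)\<^sup>2 * (norm (w' - w))\<^sup>2" by (simp add: power_mult_distrib)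
      have "env (xbar + s k *\<^sub>R w) = c + (s k)\<^sup>2 * A k" using A[of k] prox_point_props(2) by simp
      then have "env (xbar + s k *\<^sub>R w') \<le> c + (s k)\<^sup>2 * A k + (s k)\<^sup>2 * (Y k \<bullet> (w' - w)) + a * ((s k)\<^sup>2 * (norm (w' - w))\<^sup>2)"
        using env_upper[of "xbar + s k *\<^sub>R w'" "xbar + s k *\<^sub>R w"] unfolding d n VY by (simp add: power2_eq_square mult.assoc)
      moreover have "c + (s k)\<^sup>2 * b1 < env (xbar + s k *\<^sub>R w')" using elim prox_point_props(2) by simp
      ultimately have "(s k)\<^sup>2 * b1 \<le> (s k)\<^sup>2 * (A k + Y k \<bullet> (w' - w) + a * (norm (w' - w))\<^sup>2)" by (simp add: algebra_simps)
      then have "b1 \<le> A k + Y k \<bullet> (w' - w) + a * (norm (w' - w))\<^sup>2"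
        using sp[of k] by (simp only: mult_le_cancel_left_pos zero_less_power)
      moreover have "a * (norm (w' - w))\<^sup>2 \<le> 4 / lam * (norm (w' - w))\<^sup>2" using lam by (intro mult_right_mono) (auto simp: field_simps)
      ultimately show ?case by linarith
    qed
    have "(\<lambda>k. A k + Y k \<bullet> (w' - w) + 4 / lam * (norm (w' - w))\<^sup>2) \<longlonglongrightarrow> b + v \<bullet> (w' - w) + 4 / lam * (norm (w' - w))\<^sup>2"
      by (intro tendsto_intros Al Yl)
    then show "b1 \<le> b + v \<bullet> (w' - w) + 4 / lam * (norm (w' - w))\<^sup>2" using ev by (rule tendsto_lowerbound) simp
  qed
  show ?thesis
  proof (intro exI conjI allI impI)
    show "eh w = ereal b" by fact
    fix w' b' assume "eh w' = ereal b'"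
    then show "\<bar>b' - b - v \<bullet> (w' - w)\<bar> \<le> 4 / lam * (norm (w' - w))\<^sup>2" using up[of w' b'] low[of w' b'] by (simp add: abs_le_iff)
  qed
qed

lemma eh_quadratic_expansion: "\<exists>u G. quadratic_expansion eh u G UNIV (4 / lam)"
proof -
  obtain u G where u: "\<And>w. eh w = ereal (u w)"
    and G: "\<And>w w' b'. eh w' = ereal b' \<Longrightarrow> \<bar>b' - u w - G w \<bullet> (w' - w)\<bar> \<le> 4 / lam * (norm (w' - w))\<^sup>2"
    using eh_expansion by metis
  have "quadratic_expansion eh u G UNIV (4 / lam)" by (rule quadratic_expansion.intro[OF open_UNIV u G[OF u]])
  then show ?thesis by blast
qed

lemma eh_egradient: "has_egradient eh w (egradient eh w)" "limiting_subdiff eh w = {egradient eh w}"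
proof -
  obtain u G where "quadratic_expansion eh u G UNIV (4 / lam)" using eh_quadratic_expansion by blast
  then interpret quadratic_expansion eh u G UNIV "4 / lam" .
  show "has_egradient eh w (egradient eh w)" "limiting_subdiff eh w = {egradient eh w}"
    using has_egradient_expansion limiting_subdiff_expansion egradient_expansion by simp_all
qed

text \<open>With \<open>w' = w + lam *\<^sub>R u\<close> one has \<open>u \<bullet> w' = u \<bullet> w + lam * (norm u)\<^sup>2\<close>.\<close>

lemma root_slopes_E: "root_slopes DE 0 = root_slopes D lam"
proof -
  have "(\<exists>w. u \<in> DE w \<and> 2 * (u \<bullet> w) + 2 * 0 * (norm u)\<^sup>2 = 1) \<longleftrightarrow> (\<exists>w. u \<in> D w \<and> 2 * (u \<bullet> w) + 2 * lam * (norm u)\<^sup>2 = 1)" for u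
  proof
    assume "\<exists>w. u \<in> DE w \<and> 2 * (u \<bullet> w) + 2 * 0 * (norm u)\<^sup>2 = 1"
    then obtain w where "u \<in> D (w - lam *\<^sub>R u)" "2 * (u \<bullet> w) = 1" using DE_iff by auto
    then show "\<exists>w. u \<in> D w \<and> 2 * (u \<bullet> w) + 2 * lam * (norm u)\<^sup>2 = 1"
      by (intro exI[of _ "w - lam *\<^sub>R u"]) (simp add: inner_diff_right power2_norm_eq_inner)
  next
    assume "\<exists>w. u \<in> D w \<and> 2 * (u \<bullet> w) + 2 * lam * (norm u)\<^sup>2 = 1"
    then obtain w where "u \<in> D w" "2 * (u \<bullet> w) + 2 * lam * (norm u)\<^sup>2 = 1" by blast
    then show "\<exists>w. u \<in> DE w \<and> 2 * (u \<bullet> w) + 2 * 0 * (norm u)\<^sup>2 = 1"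
      by (intro exI[of _ "w + lam *\<^sub>R u"]) (simp add: DE_iff inner_add_right power2_norm_eq_inner)
  qed
  then show ?thesis using En.root_slopes_iff root_slopes_iff by blast
qed

lemma eh_positive_iff: "(\<exists>w. 0 < eh w \<and> eh w < \<infinity>) \<longleftrightarrow> (\<exists>w v. v \<in> D w \<and> v \<bullet> w + lam * (norm v)\<^sup>2 > 0)"
  unfolding En.positive_value_iff
proof
  assume "\<exists>w v. v \<in> DE w \<and> v \<bullet> w > 0"
  then obtain w v where "v \<in> D (w - lam *\<^sub>R v)" "v \<bullet> w > 0" using DE_iff by blast
  then show "\<exists>w v. v \<in> D w \<and> v \<bullet> w + lam * (norm v)\<^sup>2 > 0"
    by (intro exI[of _ "w - lam *\<^sub>R v"] exI[of _ v]) (simp add: inner_diff_right power2_norm_eq_inner)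
next
  assume "\<exists>w v. v \<in> D w \<and> v \<bullet> w + lam * (norm v)\<^sup>2 > 0"
  then obtain w v where "v \<in> D w" "v \<bullet> w + lam * (norm v)\<^sup>2 > 0" by blast
  then show "\<exists>w v. v \<in> DE w \<and> v \<bullet> w > 0"
    by (intro exI[of _ "w + lam *\<^sub>R v"] exI[of _ v]) (simp add: DE_iff inner_add_right power2_norm_eq_inner)
qed

end

section \<open>Prox-regular functions and admissible versions of them\<close>

lemma half_ereal_range:
  "0 < ereal (1/2) * x \<longleftrightarrow> 0 < x" "ereal (1/2) * x < \<infinity> \<longleftrightarrow> x < \<infinity>"
  by (cases x; auto simp: zero_ereal_def)+

lemma prox_regularE:
  assumes "prox_regular f xbar 0"
  obtains c \<epsilon> \<rho> where "f xbar = ereal c" "locally_lsc_at f xbar" "0 \<in> limiting_subdiff f xbar" "\<epsilon> > 0" "\<rho> \<ge> 0"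
    "\<And>x v x'. v \<in> limiting_subdiff f x \<Longrightarrow> norm v < \<epsilon> \<Longrightarrow> norm (x - xbar) < \<epsilon> \<Longrightarrow> f x < ereal (c + \<epsilon>) \<Longrightarrow>
       x' \<in> cball xbar \<epsilon> \<Longrightarrow> f x + ereal (v \<bullet> (x' - x) - \<rho> / 2 * (norm (x' - x))\<^sup>2) \<le> f x'"
proof -
  obtain c where c: "f xbar = ereal c" using assms unfolding prox_regular_def finite_at_ereal by blast
  obtain \<epsilon> \<rho> where "\<epsilon> > 0" "\<rho> \<ge> 0" and H: "\<And>x v. v \<in> limiting_subdiff f x \<and> norm (v - 0) < \<epsilon> \<and> norm (x - xbar) < \<epsilon> \<and>
        f x < f xbar + ereal \<epsilon> \<Longrightarrow>
        \<forall>x' \<in> cball xbar \<epsilon>. f x' \<ge> f x + ereal (v \<bullet> (x' - x) - \<rho> / 2 * (norm (x' - x))\<^sup>2)"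
    using assms unfolding prox_regular_def by blast
  show ?thesis
  proof (rule that[OF c _ _ \<open>\<epsilon> > 0\<close> \<open>\<rho> \<ge> 0\<close>])
    show "locally_lsc_at f xbar" "0 \<in> limiting_subdiff f xbar" using assms unfolding prox_regular_def by auto
    fix x v x' assume "v \<in> limiting_subdiff f x" "norm v < \<epsilon>" "norm (x - xbar) < \<epsilon>" "f x < ereal (c + \<epsilon>)" "x' \<in> cball xbar \<epsilon>"
    then show "f x + ereal (v \<bullet> (x' - x) - \<rho> / 2 * (norm (x' - x))\<^sup>2) \<le> f x'" using H[of v x] c by simp
  qed
qed

lemma kl_half_of_prox_regular:
  fixes f :: "'a::euclidean_space \<Rightarrow> ereal"
  assumes "prox_regular f xbar 0" and nonsing: "set_inv (graphical_deriv (limiting_subdiff f) xbar 0) 0 = {0}"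
  shows "kl_property f xbar (1/2)"
    and "0 < second_subderiv f xbar 0 w \<Longrightarrow> second_subderiv f xbar 0 w < \<infinity> \<Longrightarrow> kl_sharp f xbar (1/2)"
proof -
  obtain c \<epsilon> \<rho> where c: "f xbar = ereal c" and lsc: "locally_lsc_at f xbar" and zero: "0 \<in> limiting_subdiff f xbar"
    and eps: "\<epsilon> > 0" "\<rho> \<ge> 0"
    and prox: "\<And>x v x'. v \<in> limiting_subdiff f x \<Longrightarrow> norm v < \<epsilon> \<Longrightarrow> norm (x - xbar) < \<epsilon> \<Longrightarrow> f x < ereal (c + \<epsilon>) \<Longrightarrow>
       x' \<in> cball xbar \<epsilon> \<Longrightarrow> f x + ereal (v \<bullet> (x' - x) - \<rho> / 2 * (norm (x' - x))\<^sup>2) \<le> f x'"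
    using prox_regularE[OF assms(1)] by blast
  obtain \<kappa> \<delta> where \<kappa>: "\<kappa> > 0" "\<delta> > 0"
    and est: "\<And>y v. norm (y - xbar) < \<delta> \<Longrightarrow> v \<in> limiting_subdiff f y \<Longrightarrow> norm (y - xbar) \<le> \<kappa> * norm v"
    using nonsingular_imp_strong_subregular[OF nonsing] by blast
  show kl: "kl_property f xbar (1/2)"
    by (rule kl_half_of_strong_subregularity[where f = f, OF c lsc eps prox \<kappa> est]) (use eps in auto)
  assume w: "0 < second_subderiv f xbar 0 w" "second_subderiv f xbar 0 w < \<infinity>"
  let ?h = "\<lambda>w. ereal (1/2) * second_subderiv f xbar 0 w"
  have "0 < ?h w" "?h w < \<infinity>" using w by (simp_all add: half_ereal_range)
  then obtain a where a: "?h w = ereal a" "a > 0" by (cases "?h w") auto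
  have "ereal (c - \<rho> / 2 * (norm (y - xbar))\<^sup>2) \<le> f y" if "y \<in> cball xbar \<epsilon>" for y
    using prox[OF zero _ _ _ that] eps c by simp
  from lsc_upto_of_quadratic_lower_bound[where f = f, OF c lsc eps(1) this]
  obtain r where r: "r > 0" "lsc_upto f (cball xbar r) (ereal (c + r))" by blast
  have up: "\<exists>t w'. 0 < t \<and> t < \<eta> \<and> norm (w' - w) < \<eta> \<and> f (xbar + t *\<^sub>R w') \<le> ereal (c + t\<^sup>2 * (a + 1))" if "\<eta> > 0" for \<eta>
    by (rule second_subderiv_upper[where f = f, OF c _ that]) (use a in simp)
  show "kl_sharp f xbar (1/2)"
    by (rule kl_sharp_of_second_order_minorant[where f = f, OF c r kl second_order_minorant_second_subderiv[where f = f, OF c]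
        \<open>0 < ?h w\<close> _ up]) (use a in auto)
qed

text \<open>Subdifferential continuity gives, by contradiction along sequences, a neighbourhood of \<open>(xbar, 0)\<close> in
  which all points of the graph of \<open>\<partial>f\<close> have function values close to \<open>f xbar\<close>.\<close>

lemma epi_quadratic_of_prox_regular:
  fixes f :: "'a::euclidean_space \<Rightarrow> ereal"
  assumes "prox_regular f xbar 0" and nonsing: "set_inv (graphical_deriv (limiting_subdiff f) xbar 0) 0 = {0}"
    and "twice_epi_diff f xbar 0" and cont: "subdiff_continuous f xbar 0"
  shows "\<exists>c \<epsilon> \<rho>. epi_quadratic f xbar c \<epsilon> \<rho> (\<lambda>w. ereal (1/2) * second_subderiv f xbar 0 w)"
proof -
  obtain c \<epsilon> \<rho> where c: "f xbar = ereal c" and lsc: "locally_lsc_at f xbar" and zero: "0 \<in> limiting_subdiff f xbar"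
    and eps: "\<epsilon> > 0" "\<rho> \<ge> 0"
    and prox: "\<And>x v x'. v \<in> limiting_subdiff f x \<Longrightarrow> norm v < \<epsilon> \<Longrightarrow> norm (x - xbar) < \<epsilon> \<Longrightarrow> f x < ereal (c + \<epsilon>) \<Longrightarrow>
       x' \<in> cball xbar \<epsilon> \<Longrightarrow> f x + ereal (v \<bullet> (x' - x) - \<rho> / 2 * (norm (x' - x))\<^sup>2) \<le> f x'"
    using prox_regularE[OF assms(1)] by blast
  have "\<exists>\<delta>>0. \<forall>x v. v \<in> limiting_subdiff f x \<and> norm (x - xbar) < \<delta> \<and> norm v < \<delta> \<longrightarrow> f x < ereal (c + \<epsilon>)"
  proof (rule ccontr)
    assume neg: "\<not> ?thesis"
    have ex: "\<exists>x v. v \<in> limiting_subdiff f x \<and> norm (x - xbar) < \<delta> \<and> norm v < \<delta> \<and> \<not> f x < ereal (c + \<epsilon>)" if "\<delta> > 0" for \<delta>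
      using neg \<open>\<delta> > 0\<close> by blast
    obtain X V where X: "\<And>k. V k \<in> limiting_subdiff f (X k) \<and> norm (X k - xbar) < inverse (real (Suc k)) \<and>
        norm (V k) < inverse (real (Suc k)) \<and> \<not> f (X k) < ereal (c + \<epsilon>)"
      using null_seq_choice[of "\<lambda>\<delta> x v. v \<in> limiting_subdiff f x \<and> norm (x - xbar) < \<delta> \<and> norm v < \<delta> \<and> \<not> f x < ereal (c + \<epsilon>)", OF ex]
      by blast
    have "X \<longlonglongrightarrow> xbar" by (rule tendsto_of_inverse_Suc) (use X in blast)
    moreover have "V \<longlonglongrightarrow> 0" by (rule tendsto_of_inverse_Suc) (use X in simp)
    ultimately have "(\<lambda>k. f (X k)) \<longlonglongrightarrow> ereal c" using cont X c unfolding subdiff_continuous_def by metis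
    then have "\<forall>\<^sub>F k in sequentially. f (X k) < ereal (c + \<epsilon>)" by (rule order_tendstoD) (use eps in simp)
    then show False using X eventually_happens by fastforce
  qed
  then obtain \<delta> where d: "\<delta> > 0" "\<And>x v. v \<in> limiting_subdiff f x \<Longrightarrow> norm (x - xbar) < \<delta> \<Longrightarrow> norm v < \<delta> \<Longrightarrow> f x < ereal (c + \<epsilon>)"
    by blast
  have "epi_quadratic f xbar c (min \<epsilon> \<delta>) \<rho> (\<lambda>w. ereal (1/2) * second_subderiv f xbar 0 w)"
  proof
    fix x v x' assume "v \<in> limiting_subdiff f x" "norm (x - xbar) < min \<epsilon> \<delta>" "norm v < min \<epsilon> \<delta>" "x' \<in> cball xbar (min \<epsilon> \<delta>)"
    then show "f x + ereal (v \<bullet> (x' - x) - \<rho> / 2 * (norm (x' - x))\<^sup>2) \<le> f x'"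
      by (intro prox d(2)) auto
  qed (use c lsc zero eps d(1) nonsing second_order_minorant_second_subderiv second_order_recovery_second_subderiv assms(3) in auto)
  then show ?thesis by blast
qed

lemma epi_quadratic_cong:
  fixes f F :: "'a::euclidean_space \<Rightarrow> ereal"
  assumes "epi_quadratic f xbar c \<epsilon> \<rho> h" and "r > 0" and eq: "\<And>y. norm (y - xbar) < r \<Longrightarrow> F y = f y"
    and lscF: "lsc F"
  shows "\<exists>\<epsilon>'. epi_quadratic F xbar c \<epsilon>' \<rho> h"
    and "graphical_deriv (limiting_subdiff F) xbar 0 = graphical_deriv (limiting_subdiff f) xbar 0"
proof -
  interpret epi_quadratic f xbar c \<epsilon> \<rho> h by fact
  have sub: "limiting_subdiff F y = limiting_subdiff f y" if "norm (y - xbar) < r" for y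
    by (rule limiting_subdiff_cong[of "ball xbar r"]) (use that eq in \<open>auto simp: dist_norm norm_minus_commute\<close>)
  show D: "graphical_deriv (limiting_subdiff F) xbar 0 = D"
    by (rule ext, rule graphical_deriv_cong[of "ball xbar r"]) (use sub \<open>r > 0\<close> in \<open>auto simp: dist_norm norm_minus_commute\<close>)
  have Fx: "F xbar = ereal c" using eq[of xbar] fin \<open>r > 0\<close> by simp
  define \<epsilon>' where "\<epsilon>' = min \<epsilon> (r / 2)"
  have e: "\<epsilon>' > 0" "\<epsilon>' \<le> \<epsilon>" "\<epsilon>' < r" using eps \<open>r > 0\<close> by (auto simp: \<epsilon>'_def)
  have "epi_quadratic F xbar c \<epsilon>' \<rho> h"
  proof
    show "F xbar = ereal c" by fact
    show "locally_lsc_at F xbar" by (rule lsc_upto_imp_locally_lsc_at[where \<phi> = F and r = 1, OF Fx _ lsc_imp_lsc_upto[OF lscF]]) simp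
    show "0 \<in> limiting_subdiff F xbar" using zero_sub sub[of xbar] \<open>r > 0\<close> by simp
    show "0 < \<epsilon>'" "0 \<le> \<rho>" using e rho by auto
    show "set_inv (graphical_deriv (limiting_subdiff F) xbar 0) 0 = {0}" unfolding D by (rule nonsing)
    show "F x + ereal (v \<bullet> (x' - x) - \<rho> / 2 * (norm (x' - x))\<^sup>2) \<le> F x'"
      if v: "v \<in> limiting_subdiff F x" "norm (x - xbar) < \<epsilon>'" "norm v < \<epsilon>'" "x' \<in> cball xbar \<epsilon>'" for x v x'
    proof -
      have n: "norm (x - xbar) < r" "norm (x' - xbar) < r" using v e by (auto simp: dist_norm norm_minus_commute)
      show ?thesis unfolding eq[OF n(1)] eq[OF n(2)]
        by (rule prox) (use v e sub[OF n(1)] in auto)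
    qed
    show "second_order_minorant F xbar h" unfolding second_order_minorant_def
    proof (intro allI impI)
      fix w b assume "ereal b < h w"
      then obtain \<delta> where d: "\<delta> > 0" "\<And>t w'. 0 < t \<Longrightarrow> t < \<delta> \<Longrightarrow> norm (w' - w) < \<delta> \<Longrightarrow> ereal (c + t\<^sup>2 * b) < f (xbar + t *\<^sub>R w')"
        using minorantD by blast
      have q: "norm w + \<delta> > 0" using d(1) by (simp add: add_nonneg_pos)
      show "\<exists>\<delta>>0. \<forall>t w'. 0 < t \<and> t < \<delta> \<and> norm (w' - w) < \<delta> \<longrightarrow> F xbar + ereal (t\<^sup>2 * b) < F (xbar + t *\<^sub>R w')"
      proof (intro exI[of _ "min \<delta> (r / (norm w + \<delta>))"] conjI allI impI)
        show "0 < min \<delta> (r / (norm w + \<delta>))" using d(1) q \<open>r > 0\<close> by simp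
        fix t w' assume t: "0 < t \<and> t < min \<delta> (r / (norm w + \<delta>)) \<and> norm (w' - w) < min \<delta> (r / (norm w + \<delta>))"
        have "norm w' \<le> norm w + \<delta>" using t norm_triangle_ineq[of "w' - w" w] by simp
        then have "t * norm w' \<le> t * (norm w + \<delta>)" using t by simp
        also have "\<dots> < r" using t q by (simp add: pos_less_divide_eq)
        finally have "norm (xbar + t *\<^sub>R w' - xbar) < r" using t by simp
        from eq[OF this] show "F xbar + ereal (t\<^sup>2 * b) < F (xbar + t *\<^sub>R w')" using d(2)[of t w'] t Fx by simp
      qed
    qed
    show "second_order_recovery F xbar h" unfolding second_order_recovery_def
    proof (intro allI impI, elim conjE)
      fix w and t :: "nat \<Rightarrow> real" assume t: "\<forall>k. 0 < t k" "t \<longlonglongrightarrow> 0"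
      obtain W where W: "W \<longlonglongrightarrow> w" "\<And>b. h w < ereal b \<Longrightarrow> \<forall>\<^sub>F k in sequentially. f (xbar + t k *\<^sub>R W k) < ereal (c + (t k)\<^sup>2 * b)"
        using recoveryE[of t w] t by blast
      have "\<forall>\<^sub>F k in sequentially. F (xbar + t k *\<^sub>R W k) < F xbar + ereal ((t k)\<^sup>2 * b)" if "h w < ereal b" for b
        using W(2)[OF that] eventually_near_xbar[OF t(2) W(1) \<open>r > 0\<close>]
        by eventually_elim (simp add: eq Fx)
      then show "\<exists>W. W \<longlonglongrightarrow> w \<and> (\<forall>b. h w < ereal b \<longrightarrow>
         (\<forall>\<^sub>F k in sequentially. F (xbar + t k *\<^sub>R W k) < F xbar + ereal ((t k)\<^sup>2 * b)))" using W(1) by blast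
    qed
  qed
  then show "\<exists>\<epsilon>'. epi_quadratic F xbar c \<epsilon>' \<rho> h" by blast
qed

text \<open>Inside the ball the prox-regularity inequality at \<open>xbar\<close> is such a bound. Outside, a finite envelope value
  gives some quadratic minorant of \<open>f\<close>, and since \<open>(norm (w - xbar))\<^sup>2 \<ge> \<epsilon>\<^sup>2\<close> there, its constant and its centre can be
  absorbed into the quadratic term.\<close>

lemma (in epi_quadratic) global_quadratic_lower_bound:
  assumes "prox_bounded f"
  shows "\<exists>R\<ge>\<rho>. \<forall>w. ereal (c - R / 2 * (norm (w - xbar))\<^sup>2) \<le> f w"
proof -
  obtain l x0 where l: "l > 0" "moreau_env l f x0 > -\<infinity>" using assms unfolding prox_bounded_def by blast
  then obtain M where M: "ereal M < moreau_env l f x0" using ereal_dense2[of "-\<infinity>" "moreau_env l f x0"] by blast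
  define \<alpha> where "\<alpha> = 1 / (2 * l)"
  have "\<alpha> > 0" using l by (simp add: \<alpha>_def)
  define q where "q = norm (x0 - xbar)"
  have low: "ereal (M - \<alpha> * (norm (w - x0))\<^sup>2) \<le> f w" for w
  proof -
    have "moreau_env l f x0 \<le> f w + ereal (\<alpha> * (norm (w - x0))\<^sup>2)" unfolding moreau_env_def \<alpha>_def by (rule INF_lower) simp
    with M have "ereal M \<le> f w + ereal (\<alpha> * (norm (w - x0))\<^sup>2)" by (meson less_le_trans less_imp_le)
    then show ?thesis by (cases "f w") auto
  qed
  \<comment> \<open>absorbs the constants: \<open>K * d\<^sup>2\<close> exceeds them for \<open>d \<ge> \<epsilon>\<close>\<close>
  define K where "K = max 0 (c - M + 2 * \<alpha> * q\<^sup>2) / \<epsilon>\<^sup>2"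
  have "K \<ge> 0" by (simp add: K_def)
  define R where "R = 2 * (2 * \<alpha> + K) + \<rho>"
  have "R \<ge> \<rho>" using \<open>\<alpha> > 0\<close> \<open>K \<ge> 0\<close> by (simp add: R_def)
  have "ereal (c - R / 2 * (norm (w - xbar))\<^sup>2) \<le> f w" for w
  proof (cases "w \<in> cball xbar \<epsilon>")
    case True
    have "\<rho> / 2 * (norm (w - xbar))\<^sup>2 \<le> R / 2 * (norm (w - xbar))\<^sup>2" using \<open>R \<ge> \<rho>\<close> by (intro mult_right_mono) auto
    then have "ereal (c - R / 2 * (norm (w - xbar))\<^sup>2) \<le> ereal (c - \<rho> / 2 * (norm (w - xbar))\<^sup>2)" by simp
    also have "\<dots> \<le> f w" by (rule growth[OF True])
    finally show ?thesis .
  next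
    case False
    define d where "d = norm (w - xbar)"
    have d: "d > \<epsilon>" using False by (simp add: d_def dist_norm norm_minus_commute)
    have "norm (w - x0) \<le> d + q" using norm_triangle_ineq4[of "w - xbar" "x0 - xbar"] by (simp add: d_def q_def)
    then have "(norm (w - x0))\<^sup>2 \<le> (d + q)\<^sup>2" by (intro power_mono) auto
    also have "\<dots> \<le> 2 * d\<^sup>2 + 2 * q\<^sup>2" using zero_le_power2[of "d - q"] by (simp add: power2_eq_square algebra_simps)
    finally have "\<alpha> * (norm (w - x0))\<^sup>2 \<le> \<alpha> * (2 * d\<^sup>2 + 2 * q\<^sup>2)" using \<open>\<alpha> > 0\<close> by simp
    then have 1: "\<alpha> * (norm (w - x0))\<^sup>2 \<le> 2 * \<alpha> * d\<^sup>2 + 2 * \<alpha> * q\<^sup>2" by (simp add: distrib_left)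
    have "\<epsilon>\<^sup>2 \<le> d\<^sup>2" using d eps by (intro power_mono) auto
    then have "K * \<epsilon>\<^sup>2 \<le> K * d\<^sup>2" using \<open>K \<ge> 0\<close> by (intro mult_left_mono) auto
    moreover have "K * \<epsilon>\<^sup>2 \<ge> c - M + 2 * \<alpha> * q\<^sup>2" using eps by (simp add: K_def)
    moreover have "\<rho> / 2 * d\<^sup>2 \<ge> 0" using rho by simp
    moreover have "R / 2 * d\<^sup>2 = 2 * \<alpha> * d\<^sup>2 + K * d\<^sup>2 + \<rho> / 2 * d\<^sup>2" by (simp add: R_def field_simps)
    ultimately have "c - R / 2 * d\<^sup>2 \<le> M - \<alpha> * (norm (w - x0))\<^sup>2" using 1 by linarith
    then have "ereal (c - R / 2 * d\<^sup>2) \<le> ereal (M - \<alpha> * (norm (w - x0))\<^sup>2)" by simp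
    also have "\<dots> \<le> f w" by (rule low)
    finally show ?thesis by (simp add: d_def)
  qed
  with \<open>R \<ge> \<rho>\<close> show ?thesis by blast
qed

lemma env_version_local:
  assumes "env_version f xbar F"
  shows "\<exists>r>0. \<forall>y. norm (y - xbar) < r \<longrightarrow> F y = f y"
proof -
  from assms consider "F = f" | r where "r > 0" "F = (\<lambda>x. f x + ind_fun (cball xbar r) x)" unfolding env_version_def by blast
  then show ?thesis
  proof cases
    case 1 then show ?thesis by (intro exI[of _ 1]) simp
  next
    case 2 then show ?thesis by (intro exI[of _ r]) (auto simp: ind_fun_def dist_norm norm_minus_commute)
  qed
qed

lemma moreau_setting_of_env_version:
  fixes f F :: "'a::euclidean_space \<Rightarrow> ereal"
  assumes f: "epi_quadratic f xbar c \<epsilon> \<rho> h" and F: "env_version f xbar F"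
  shows "\<exists>Lam>0. \<exists>\<epsilon>' R. \<forall>lam. 0 < lam \<and> lam < Lam \<longrightarrow> moreau_setting F xbar c \<epsilon>' \<rho> h R lam"
    and "graphical_deriv (limiting_subdiff F) xbar 0 = graphical_deriv (limiting_subdiff f) xbar 0"
proof -
  obtain r where r: "r > 0" "\<And>y. norm (y - xbar) < r \<Longrightarrow> F y = f y" using env_version_local[OF F] by blast
  have lsc: "lsc F" and pb: "prox_bounded F" using F unfolding env_version_def by auto
  show "graphical_deriv (limiting_subdiff F) xbar 0 = graphical_deriv (limiting_subdiff f) xbar 0"
    by (rule epi_quadratic_cong(2)[OF f r lsc])
  obtain \<epsilon>' where eF: "epi_quadratic F xbar c \<epsilon>' \<rho> h" using epi_quadratic_cong(1)[OF f r lsc] by blast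
  then interpret epi_quadratic F xbar c \<epsilon>' \<rho> h .
  obtain R where R: "R \<ge> \<rho>" "\<And>w. ereal (c - R / 2 * (norm (w - xbar))\<^sup>2) \<le> F w" using global_quadratic_lower_bound[OF pb] by blast
  have "moreau_setting F xbar c \<epsilon>' \<rho> h R lam" if lam: "0 < lam" "lam < 1 / (4 * (R + 1))" for lam
  proof (rule moreau_setting.intro[OF eF])
    have "R \<ge> 0" using R(1) rho by linarith
    then have "4 * (lam * (R + 1)) < 1" using lam(2) by (simp add: field_simps)
    moreover have "4 * (lam * (R + 1)) = 4 * (lam * R) + 4 * lam" by (simp add: algebra_simps)
    ultimately have "4 * (lam * R) \<le> 1" using lam(1) by linarith
    then show "moreau_setting_axioms F xbar c \<rho> R lam" using lsc R lam(1) by unfold_locales auto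
  qed
  moreover have "1 / (4 * (R + 1)) > 0" using R(1) rho by simp
  ultimately show "\<exists>Lam>0. \<exists>\<epsilon>' R. \<forall>lam. 0 < lam \<and> lam < Lam \<longrightarrow> moreau_setting F xbar c \<epsilon>' \<rho> h R lam" by blast
qed

section \<open>KL moduli of a function and of its Moreau envelope\<close>

lemma (in moreau_setting) envelope_conclusions:
  "KL E xbar (1/2) = edist 0 (root_slopes D lam)"
  "KL eh 0 (1/2) = edist 0 (root_slopes D lam)"
  "outer_subdiff (sqrt_gap E xbar) xbar = root_slopes D lam"
  "(\<Union>w\<in>{w. 0 < eh w \<and> eh w < \<infinity>}. {((1/2) *\<^sub>R egradient eh w) /\<^sub>R sqrt (real_of_ereal (eh w))}) = root_slopes D lam"
  "kl_property E xbar (1/2)"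
  "{w. 0 < eh w \<and> eh w < \<infinity>} \<noteq> {} \<longrightarrow> kl_sharp E xbar (1/2)"
  "{w. 0 < eh w \<and> eh w < \<infinity>} \<noteq> {} \<longleftrightarrow> (\<exists>w v. v \<in> D w \<and> v \<bullet> w + lam * (norm v)\<^sup>2 > 0)"
  using En.KL_eq En.KL_epi_limit_eq En.outer_subdiff_root En.root_slopes_union root_slopes_E
    En.kl_half En.sharp eh_positive_iff by (auto simp: eh_egradient(2))

theorem theorem4p6:
  fixes f :: "'a::euclidean_space \<Rightarrow> ereal" and xbar :: 'a
  assumes prox: "prox_regular f xbar 0"
    and nonsing: "set_inv (graphical_deriv (limiting_subdiff f) xbar 0) 0 = {0}"
  shows
    "let d2 = second_subderiv f xbar 0;
         h = (\<lambda>w. ereal (1/2) * d2 w);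
         W = {w. 0 < d2 w \<and> d2 w < \<infinity>};
         g = sqrt_gap f xbar;
         D = graphical_deriv (limiting_subdiff f) xbar 0;
         sr = subreg (limiting_subdiff f) xbar 0
     in
       kl_property f xbar (1/2) \<and>
       (W \<noteq> {} \<longrightarrow> kl_sharp f xbar (1/2)) \<and>
       (twice_epi_diff f xbar 0 \<and> subdiff_continuous f xbar 0 \<longrightarrow>
         \<comment> \<open>(a)\<close>
         ((W \<noteq> {} \<longleftrightarrow> (\<exists>w v. v \<in> D w \<and> v \<bullet> w > 0)) \<and>
          KL f xbar (1/2) = KL h 0 (1/2) \<and>
          KL h 0 (1/2) \<ge> esqrt (1 / (2 * sr)) \<and>
          esqrt (1 / (2 * sr)) > 0 \<and>
          outer_subdiff g xbar =
            (\<Union>w\<in>W. (\<lambda>v. ((1/2) *\<^sub>R v) /\<^sub>R sqrt (real_of_ereal (h w))) ` limiting_subdiff h w) \<and>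
          outer_subdiff g xbar =
            {v /\<^sub>R sqrt (2 * (v \<bullet> w)) | v w. v \<in> D w \<and> v \<bullet> w > 0}) \<and>
         (\<forall>F. env_version f xbar F \<longrightarrow>
           \<comment> \<open>(b)\<close>
           (\<exists>Lam>0. \<forall>lam. 0 < lam \<and> lam < Lam \<longrightarrow>
             (let eF = moreau_env lam F;
                  eh = moreau_env lam h;
                  Wt = {w. 0 < eh w \<and> eh w < \<infinity>};
                  gt = sqrt_gap eF xbar
              in
                kl_property eF xbar (1/2) \<and>
                (Wt \<noteq> {} \<longrightarrow> kl_sharp eF xbar (1/2)) \<and>
                (Wt \<noteq> {} \<longleftrightarrow> (\<exists>w v. v \<in> D w \<and> v \<bullet> w + lam * (norm v)\<^sup>2 > 0)) \<and>
                KL eF xbar (1/2) = KL eh 0 (1/2) \<and>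
                KL eh 0 (1/2) \<ge> esqrt (1 / (ereal (2 * lam) + 2 * sr)) \<and>
                esqrt (1 / (ereal (2 * lam) + 2 * sr)) > 0 \<and>
                (\<forall>w\<in>Wt. \<exists>G. has_egradient eh w G) \<and>
                outer_subdiff gt xbar =
                  (\<Union>w\<in>Wt. {((1/2) *\<^sub>R egradient eh w) /\<^sub>R sqrt (real_of_ereal (eh w))}) \<and>
                outer_subdiff gt xbar =
                  {v /\<^sub>R sqrt (2 * (v \<bullet> w) + 2 * lam * (norm v)\<^sup>2) | v w.
                     v \<in> D w \<and> v \<bullet> w + lam * (norm v)\<^sup>2 > 0})) \<and>
           \<comment> \<open>(c)\<close>
           pk_converges0 (\<lambda>lam. outer_subdiff (sqrt_gap (moreau_env lam F) xbar) xbar)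
                         (outer_subdiff g xbar) \<and>
           (\<exists>Lam>0. \<forall>lam1 lam2. 0 < lam1 \<and> lam1 \<le> lam2 \<and> lam2 < Lam \<longrightarrow>
              KL (moreau_env lam2 F) xbar (1/2) \<le> KL (moreau_env lam1 F) xbar (1/2)) \<and>
           ((\<lambda>lam. KL (moreau_env lam F) xbar (1/2)) \<longlongrightarrow> KL f xbar (1/2)) (at_right 0)))"
proof -
  let ?h = "\<lambda>w. ereal (1/2) * second_subderiv f xbar 0 w"
  let ?D = "graphical_deriv (limiting_subdiff f) xbar 0"
  have kl: "kl_property f xbar (1/2)" by (rule kl_half_of_prox_regular(1)[OF prox nonsing])
  have sharp: "{w. 0 < second_subderiv f xbar 0 w \<and> second_subderiv f xbar 0 w < \<infinity>} \<noteq> {} \<longrightarrow> kl_sharp f xbar (1/2)"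
    using kl_half_of_prox_regular(2)[OF prox nonsing] by blast
  show ?thesis unfolding Let_def
  proof (rule conjI[OF kl conjI[OF sharp impI]], elim conjE, goal_cases)
    case 1
    then obtain c \<epsilon> \<rho> where eq: "epi_quadratic f xbar c \<epsilon> \<rho> ?h"
      using epi_quadratic_of_prox_regular[OF prox nonsing] by blast
    interpret Q: epi_quadratic f xbar c \<epsilon> \<rho> ?h by (rule eq)
    obtain \<sigma> where sr: "subreg (limiting_subdiff f) xbar 0 = ereal \<sigma>" and ccm: "closed_cone_map ?D \<sigma>"
      using Q.subreg_bound by blast
    interpret C: closed_cone_map ?D \<sigma> by (rule ccm)
    have sr2: "2 * subreg (limiting_subdiff f) xbar 0 = ereal (2 * 0) + 2 * ereal \<sigma>" by (simp add: sr)
    have env: "\<exists>Lam>0. \<exists>\<epsilon>' R. \<forall>lam. 0 < lam \<and> lam < Lam \<longrightarrow> moreau_setting F xbar c \<epsilon>' \<rho> ?h R lam"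
      and DF: "graphical_deriv (limiting_subdiff F) xbar 0 = ?D" if "env_version f xbar F" for F
      using moreau_setting_of_env_version[OF eq that] by blast+
    have family: "\<exists>Lam>0. \<forall>lam. 0 < lam \<and> lam < Lam \<longrightarrow>
        outer_subdiff (sqrt_gap (moreau_env lam F) xbar) xbar = root_slopes ?D lam \<and>
        KL (moreau_env lam F) xbar (1/2) = edist 0 (root_slopes ?D lam)" if F: "env_version f xbar F" for F
    proof -
      obtain Lam \<epsilon>' R where "Lam > 0" and M: "\<And>lam. 0 < lam \<Longrightarrow> lam < Lam \<Longrightarrow> moreau_setting F xbar c \<epsilon>' \<rho> ?h R lam"
        using env[OF F] by blast
      then show ?thesis using moreau_setting.envelope_conclusions(1,3)[OF M] unfolding DF[OF F] by blast
    qed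
    show ?case
    proof (intro conjI allI impI, goal_cases)
      case 1
      show ?case using Q.positive_value_iff by (simp add: half_ereal_range)
    next
      case 2
      show ?case by (simp add: Q.KL_eq Q.KL_epi_limit_eq)
    next
      case 3
      show ?case unfolding Q.KL_epi_limit_eq sr2 by (rule C.edist_root_slopes_bound(1)) simp
    next
      case 4
      show ?case unfolding sr2 by (rule C.edist_root_slopes_bound(2)) simp
    next
      case 5
      show ?case using Q.root_slopes_union Q.outer_subdiff_root by (simp add: half_ereal_range)
    next
      case 6
      show ?case unfolding Q.outer_subdiff_root root_slopes_def by simp
    next
      case (7 F)
      obtain Lam \<epsilon>' R where Lam: "Lam > 0" and M: "\<And>lam. 0 < lam \<Longrightarrow> lam < Lam \<Longrightarrow> moreau_setting F xbar c \<epsilon>' \<rho> ?h R lam"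
        using env[OF 7] by blast
      show ?case
      proof (rule exI[of _ Lam], rule conjI[OF Lam], intro allI impI, elim conjE, goal_cases)
        case (1 lam)
        note B = moreau_setting.envelope_conclusions[OF M[OF 1], unfolded DF[OF 7]]
        have G: "\<exists>G. has_egradient (moreau_env lam ?h) w G" for w
          using moreau_setting.eh_egradient(1)[OF M[OF 1]] by blast
        have low: "esqrt (1 / (ereal (2 * lam) + 2 * ereal \<sigma>)) \<le> edist 0 (root_slopes ?D lam)"
          "0 < esqrt (1 / (ereal (2 * lam) + 2 * ereal \<sigma>))"
          using C.edist_root_slopes_bound[of lam] 1 by simp_all
        show ?case unfolding B(1-4) root_slopes_def[symmetric] sr by (intro conjI ballI B(5-7) low refl G)
      qed
    next
      case (8 F)
      obtain Lam where "Lam > 0" "\<And>lam. 0 < lam \<Longrightarrow> lam < Lam \<Longrightarrow>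
          outer_subdiff (sqrt_gap (moreau_env lam F) xbar) xbar = root_slopes ?D lam" using family[OF 8] by blast
      then show ?case unfolding Q.outer_subdiff_root by (rule C.pk_root_slopes)
    next
      case (9 F)
      obtain Lam where "Lam > 0" and "\<And>lam. 0 < lam \<Longrightarrow> lam < Lam \<Longrightarrow>
          KL (moreau_env lam F) xbar (1/2) = edist 0 (root_slopes ?D lam)" using family[OF 9] by blast
      then show ?case by (intro exI[of _ Lam] conjI allI impI) (auto intro: C.edist_root_slopes_antimono)
    next
      case (10 F)
      obtain Lam where Lam: "Lam > 0" "\<And>lam. 0 < lam \<Longrightarrow> lam < Lam \<Longrightarrow>
          KL (moreau_env lam F) xbar (1/2) = edist 0 (root_slopes ?D lam)" using family[OF 10] by blast
      then have "\<forall>\<^sub>F lam in at_right 0. edist 0 (root_slopes ?D lam) = KL (moreau_env lam F) xbar (1/2)"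
        unfolding eventually_at_right_field by (intro exI[of _ Lam]) auto
      with C.tendsto_edist_root_slopes show ?case unfolding Q.KL_eq by (rule Lim_transform_eventually)
    qed
  qed
qed

end
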